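(* Let $n\ge 2$. If the divisors of $n$ generate the group of units of $\mathbb Z_{n-1}=\mathbb Z/(n-1)\mathbb Z$, then the reduced signature homomorphism $\overline{\mathrm{sig}}$ from $\mathcal O_n$ to the group of units of $\mathbb Z_{n-1}$ is surjective.
   Context: Notation. Maps act on the right. $X_n=\{0,\ldots,n-1\}$; $X_n^*$ (resp. $X_n^k$) is the set of finite words (words of length $k$) over $X_n$; $\epsilon$ is the empty word; for $1\le r\le n-1$, $\dot{\mathbf r}=\{\dot 0,\ldots,\dot{(r-1)}\}$ is a further ordered alphabet; $X_{n,r}^+=\{\dot a w:\dot a\in\dot{\mathbf r},\,w\in X_n^*\}$, $X_{n,r}^*=X_{n,r}^+\cup\{\epsilon\}$. $\mathfrak C_n=X_n^\omega$ and $\mathfrak C_{n,r}=\{\dot a x:\dot a\in\dot{\mathbf r},\,x\in\mathfrak C_n\}$ are Cantor spaces; $U_\nu$ is the set of infinite words with prefix $\nu$. Transducers over $X_n$. A transducer $\langle X_n,Q,\pi,\lambda\rangle$ has transition function $\pi:X_n\times Q\to Q$ and output function $\lambda:X_n\times Q\to X_n^*$, extended to words by $\pi(wi,q)=\pi(i,\pi(w,q))$, $\lambda(wi,q)=\lambda(w,q)\lambda(i,\pi(w,q))$, such that infinite inputs give infinite outputs; $h_q:\mathfrak C_n\to\mathfrak C_n$ is the continuous map $\delta\mapsto\lambda(\delta,q)$ and $\mathrm{im}(q)$ is its image. Fixing an initial state $q_0$ gives an initial transducer, representing $h_{q_0}$; it is minimal if all states are reachable from $q_0$, $h_q\neq h_p$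 for distinct states $q,p$, and for every state $q$ and letter $i$, $\lambda(i,q)$ is the greatest common prefix of $\{(i\delta)h_q:\delta\in\mathfrak C_n\}$. A transducer is synchronizing at level $k$ if for each $\Gamma\in X_n^k$ the state $\pi(\Gamma,q)$ does not depend on $q$ (the state forced by $\Gamma$); its core is the sub-transducer on the states forced by words of $X_n^k$. Transducers over $\mathfrak C_{n,r}$. An initial transducer $A_{q_0}$ over $\mathfrak C_{n,r}$ has state set $Q=R\sqcup S$ with $R$ finite, $q_0\in R$, and functions $\pi,\lambda$ defined on $(\dot{\mathbf r}\times\{q_0\})\sqcup(X_n\times(Q\setminus\{q_0\}))$, $\pi$ with values in $Q\setminus\{q_0\}$ and $\lambda$ with values in $X_{n,r}^*\sqcup X_n^*$, such that: a transition from a state of $R$ outputs $\epsilon$ if it ends in $R$ and a word of $X_{n,r}^+$ if it ends in $S$; transitions from $S$ end in $S$ with output in $X_n^*$; infinite words read from states of $S$ give infinite output; no state of $R$ lies on a cycle. It represents the map $h_{q_0}:\mathfrak C_{n,r}\to\mathfrak C_{n,r}$. It is minimal if all its states are reachable from $q_0$, distinct states $q,p$ induce distinct maps $\delta\mapsto\lambda(\delta,q)$, $\delta\mapsto\lambda(\delta,p)$ on infinite words, and for every state $q$ and every letter $i$ readable from $q$, $\lambda(i,q)$ is the greatest common prefix of $\{\lambda(i\delta,q):\delta\in\mathfrak C_n\}$; every homeomorphism of $\mathfrak C_{n,r}$ is represented by a unique minimal transducer. It is synchronizing if for some $k$ the state reached by reading a word of length $k$ from any state from which it can be read depends only on the word;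 its core is then the transducer over $X_n$ formed by the states forced by words of $X_n^k$. Groups. $\mathcal B_{n,r}$ is the group of homeomorphisms $h$ of $\mathfrak C_{n,r}$ such that the minimal transducers of $h$ and $h^{-1}$ are finite and synchronizing. For $h\in\mathcal B_{n,r}$ let $\mathrm{Core}(h)$ be the core of its minimal transducer (a transducer over $X_n$, up to renaming states). $\mathcal O_{n,r}=\{\mathrm{Core}(h):h\in\mathcal B_{n,r}\}$ and $\mathcal O_n=\bigcup_{1\le r\le n-1}\mathcal O_{n,r}$. The product of $g,h\in\mathcal O_n$ is the core of the minimal transducer representing $h_{q_1}$ followed by $h_{q_2}$, for any states $q_1$ of $g$ and $q_2$ of $h$ (independent of the choice). With this product $\mathcal O_n$ is a group. Every state of an element of $\mathcal O_n$ induces an injective map $\mathfrak C_n\to\mathfrak C_n$ with clopen image. Signature. For $T\in\mathcal O_n$ and a state $q$ of $T$, $m_q$ is the size of the smallest set $V\subset X_n^*$ with $\bigcup_{v\in V}U_v=\mathrm{im}(q)$. Let $k$ be the minimal synchronizing level of $T$ and for $x\in X_n^k$ let $q_x$ be the state of $T$ forced by $x$. Then $(T)\mathrm{sig}=\sum_{x\in X_n^k}m_{q_x}$ and $(T)\overline{\mathrm{sig}}=(T)\mathrm{sig}\bmod (n-1)\in\mathbb Z_{n-1}$. The map $\overline{\mathrm{sig}}$ is a homomorphism from $\mathcal O_n$ to the group of units of $\mathbb Z_{n-1}$. *)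

theory Defs
  imports
    "HOL-Analysis.Abstract_Topology"
    "HOL-Analysis.Function_Topology"
    "HOL-Algebra.Generated_Groups"
    "HOL-Algebra.IntRing"
    "HOL-Library.Omega_Words_Fun"
begin

text \<open>
  Finite words are lists and infinite words are functions \<open>nat \<Rightarrow> letter\<close> (as in
  \<open>Omega_Words_Fun\<close>: \<open>w \<frown> x\<close> is concatenation and \<open>Omega_Words_Fun.prefix k x\<close> is the list of
  the first \<open>k\<close> letters). The letters of $X_n$ are \<open>Plain 0, \<dots>, Plain (n - 1)\<close>, the letters of
  the alphabet $\dot{\mathbf r}$ are \<open>Dotted 0, \<dots>, Dotted (r - 1)\<close>.
\<close>

datatype letter = Dotted nat | Plain nat

definition alphabet :: "nat \<Rightarrow> letter set" where
  "alphabet n = Plain ` {..<n}"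

definition dotted_alphabet :: "nat \<Rightarrow> letter set" where
  "dotted_alphabet r = Dotted ` {..<r}"

definition words_of_length :: "nat \<Rightarrow> nat \<Rightarrow> letter list set" where
  "words_of_length n k = {w \<in> lists (alphabet n). length w = k}"

definition dotted_words :: "nat \<Rightarrow> nat \<Rightarrow> letter list set" where
  "dotted_words n r = {a # w | a w. a \<in> dotted_alphabet r \<and> w \<in> lists (alphabet n)}"

definition Cantor :: "nat \<Rightarrow> (nat \<Rightarrow> letter) set" where
  "Cantor n = {x. \<forall>i. x i \<in> alphabet n}"

definition dotted_Cantor :: "nat \<Rightarrow> nat \<Rightarrow> (nat \<Rightarrow> letter) set" where
  "dotted_Cantor n r = {[a] \<frown> x | a x. a \<in> dotted_alphabet r \<and> x \<in> Cantor n}"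

definition dotted_Cantor_space :: "nat \<Rightarrow> nat \<Rightarrow> (nat \<Rightarrow> letter) topology" where
  "dotted_Cantor_space n r =
     subtopology (product_topology (\<lambda>_. discrete_topology UNIV) UNIV) (dotted_Cantor n r)"

definition cone :: "nat \<Rightarrow> letter list \<Rightarrow> (nat \<Rightarrow> letter) set" where
  "cone n w = {w \<frown> x | x. x \<in> Cantor n}"

definition is_prefix :: "letter list \<Rightarrow> (nat \<Rightarrow> letter) \<Rightarrow> bool" where
  "is_prefix w x \<longleftrightarrow> Omega_Words_Fun.prefix (length w) x = w"

text \<open>A set of infinite words with at most one element has no greatest common prefix.\<close>

definition is_greatest_common_prefix :: "letter list \<Rightarrow> (nat \<Rightarrow> letter) set \<Rightarrow> bool" where
  "is_greatest_common_prefix w S \<longleftrightarrow>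
     (\<forall>x\<in>S. is_prefix w x) \<and> (\<forall>v. (\<forall>x\<in>S. is_prefix v x) \<longrightarrow> length v \<le> length w)"


section \<open>Transducers\<close>

text \<open>
  One record type serves for transducers over $X_n$ and over $\mathfrak C_{n,r}$: \<open>readable A q\<close> is
  the set of letters on which $\pi(\cdot,q)$ and $\lambda(\cdot,q)$ are defined. After its first
  letter, a word read from a state continues with letters of $X_n$ in both cases.
\<close>

record 'q transducer =
  states :: "'q set"
  readable :: "'q \<Rightarrow> letter set"
  transition :: "letter \<Rightarrow> 'q \<Rightarrow> 'q"
  out :: "letter \<Rightarrow> 'q \<Rightarrow> letter list"

primrec state_after :: "'q transducer \<Rightarrow> letter list \<Rightarrow> 'q \<Rightarrow> 'q" where
  "state_after A [] q = q"
| "state_after A (i # w) q = state_after A w (transition A i q)"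

primrec out_word :: "'q transducer \<Rightarrow> letter list \<Rightarrow> 'q \<Rightarrow> letter list" where
  "out_word A [] q = []"
| "out_word A (i # w) q = out A i q @ out_word A w (transition A i q)"

definition input_words :: "nat \<Rightarrow> 'q transducer \<Rightarrow> 'q \<Rightarrow> letter list set" where
  "input_words n A q = insert [] {i # w | i w. i \<in> readable A q \<and> w \<in> lists (alphabet n)}"

definition infinite_inputs :: "nat \<Rightarrow> 'q transducer \<Rightarrow> 'q \<Rightarrow> (nat \<Rightarrow> letter) set" where
  "infinite_inputs n A q = {[i] \<frown> x | i x. i \<in> readable A q \<and> x \<in> Cantor n}"

definition has_infinite_output :: "'q transducer \<Rightarrow> (nat \<Rightarrow> letter) \<Rightarrow> 'q \<Rightarrow> bool" where
  "has_infinite_output A x q \<longleftrightarrow>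
     (\<forall>m. \<exists>k. m \<le> length (out_word A (Omega_Words_Fun.prefix k x) q))"

text \<open>
  The output $\lambda(x,q)$ on an infinite word: its letter number \<open>i\<close> is read off from the output
  on any prefix of \<open>x\<close> that is long enough. Meaningful only under \<^const>\<open>has_infinite_output\<close>.
\<close>

definition out_inf :: "'q transducer \<Rightarrow> (nat \<Rightarrow> letter) \<Rightarrow> 'q \<Rightarrow> nat \<Rightarrow> letter" where
  "out_inf A x q = (\<lambda>i.
     out_word A (Omega_Words_Fun.prefix
       (LEAST k. i < length (out_word A (Omega_Words_Fun.prefix k x) q)) x) q ! i)"

definition transducer_over :: "nat \<Rightarrow> 'q transducer \<Rightarrow> bool" where
  "transducer_over n A \<longleftrightarrow>
     (\<forall>q\<in>states A. readable A q = alphabet n \<and>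
        (\<forall>i\<in>alphabet n. transition A i q \<in> states A \<and> out A i q \<in> lists (alphabet n)) \<and>
        (\<forall>x\<in>Cantor n. has_infinite_output A x q))"

definition dotted_transducer_over :: "nat \<Rightarrow> nat \<Rightarrow> 'q transducer \<Rightarrow> 'q \<Rightarrow> bool" where
  "dotted_transducer_over n r A q0 \<longleftrightarrow> (\<exists>R S.
     states A = R \<union> S \<and> R \<inter> S = {} \<and> finite R \<and> q0 \<in> R \<and>
     readable A q0 = dotted_alphabet r \<and>
     (\<forall>q\<in>states A - {q0}. readable A q = alphabet n) \<and>
     (\<forall>q\<in>states A. \<forall>i\<in>readable A q. transition A i q \<in> states A - {q0}) \<and>
     (\<forall>q\<in>R. \<forall>i\<in>readable A q.
        (transition A i q \<in> R \<longrightarrow> out A i q = []) \<and>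
        (transition A i q \<in> S \<longrightarrow> out A i q \<in> dotted_words n r)) \<and>
     (\<forall>q\<in>S. \<forall>i\<in>readable A q. transition A i q \<in> S \<and> out A i q \<in> lists (alphabet n)) \<and>
     (\<forall>q\<in>S. \<forall>x\<in>Cantor n. has_infinite_output A x q) \<and>
     (\<forall>q\<in>R. \<forall>w\<in>input_words n A q. w \<noteq> [] \<longrightarrow> state_after A w q \<noteq> q))"

definition minimal :: "nat \<Rightarrow> 'q transducer \<Rightarrow> 'q \<Rightarrow> bool" where
  "minimal n A q0 \<longleftrightarrow>
     (\<forall>q\<in>states A. \<exists>w\<in>input_words n A q0. state_after A w q0 = q) \<and>
     (\<forall>p\<in>states A. \<forall>q\<in>states A.
        infinite_inputs n A p = infinite_inputs n A q \<and>
        (\<forall>x\<in>infinite_inputs n A p. out_inf A x p = out_inf A x q) \<longrightarrow> p = q) \<and>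
     (\<forall>q\<in>states A. \<forall>i\<in>readable A q.
        is_greatest_common_prefix (out A i q) {out_inf A ([i] \<frown> x) q | x. x \<in> Cantor n})"

text \<open>The minimal initial transducer of a map, over $X_n$ and over $\mathfrak C_{n,r}$.\<close>

definition minimal_transducer_of ::
  "nat \<Rightarrow> ((nat \<Rightarrow> letter) \<Rightarrow> nat \<Rightarrow> letter) \<Rightarrow> 'q transducer \<Rightarrow> 'q \<Rightarrow> bool" where
  "minimal_transducer_of n h A q0 \<longleftrightarrow>
     transducer_over n A \<and> q0 \<in> states A \<and> minimal n A q0 \<and>
     (\<forall>x\<in>Cantor n. out_inf A x q0 = h x)"

definition minimal_dotted_transducer_of ::
  "nat \<Rightarrow> nat \<Rightarrow> ((nat \<Rightarrow> letter) \<Rightarrow> nat \<Rightarrow> letter) \<Rightarrow> 'q transducer \<Rightarrow> 'q \<Rightarrow> bool" where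
  "minimal_dotted_transducer_of n r h A q0 \<longleftrightarrow>
     dotted_transducer_over n r A q0 \<and> minimal n A q0 \<and>
     (\<forall>x\<in>dotted_Cantor n r. out_inf A x q0 = h x)"


section \<open>Synchronization and cores\<close>

definition synchronizing_at :: "nat \<Rightarrow> 'q transducer \<Rightarrow> nat \<Rightarrow> bool" where
  "synchronizing_at n A k \<longleftrightarrow>
     (\<forall>p\<in>states A. \<forall>q\<in>states A. \<forall>w\<in>input_words n A p \<inter> input_words n A q.
        length w = k \<longrightarrow> state_after A w p = state_after A w q)"

definition synchronizing :: "nat \<Rightarrow> 'q transducer \<Rightarrow> bool" where
  "synchronizing n A \<longleftrightarrow> (\<exists>k. synchronizing_at n A k)"

definition sync_level :: "nat \<Rightarrow> 'q transducer \<Rightarrow> nat" where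
  "sync_level n A = (LEAST k. synchronizing_at n A k)"

definition forced_states :: "nat \<Rightarrow> 'q transducer \<Rightarrow> nat \<Rightarrow> 'q set" where
  "forced_states n A k =
     {state_after A w q | w q. q \<in> states A \<and> w \<in> words_of_length n k \<inter> input_words n A q}"

text \<open>
  The states forced by words of length \<open>k\<close> are the same for every synchronizing level \<open>k\<close>, so the
  least one may be used. Outside its domain the core takes fixed values; hence two cores are
  equal as records if and only if they agree as transducers over $X_n$.
\<close>

definition core :: "nat \<Rightarrow> 'q transducer \<Rightarrow> 'q transducer" where
  "core n A = (let F = forced_states n A (sync_level n A) in
     \<lparr>states = F,
      readable = (\<lambda>_. alphabet n),
      transition = (\<lambda>i q. if i \<in> alphabet n \<and> q \<in> F then transition A i q else undefined),
      out = (\<lambda>i q. if i \<in> alphabet n \<and> q \<in> F then out A i q else undefined)\<rparr>)"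


section \<open>The groups\<close>

text \<open>
  A minimal transducer is unique up to renaming of states, and a finite one can be given natural
  numbers as states. \<open>Core n r h\<close> collects the cores of all such copies, so it is the core of the
  minimal transducer of \<open>h\<close> taken up to renaming of states.
\<close>

definition has_finite_sync_minimal_transducer ::
  "nat \<Rightarrow> nat \<Rightarrow> ((nat \<Rightarrow> letter) \<Rightarrow> nat \<Rightarrow> letter) \<Rightarrow> bool" where
  "has_finite_sync_minimal_transducer n r h \<longleftrightarrow>
     (\<exists>(A :: nat transducer) q0. minimal_dotted_transducer_of n r h A q0 \<and>
        finite (states A) \<and> synchronizing n A)"

definition B :: "nat \<Rightarrow> nat \<Rightarrow> ((nat \<Rightarrow> letter) \<Rightarrow> nat \<Rightarrow> letter) set" where
  "B n r = {h. \<exists>g. homeomorphic_maps (dotted_Cantor_space n r) (dotted_Cantor_space n r) h g \<and>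
     has_finite_sync_minimal_transducer n r h \<and> has_finite_sync_minimal_transducer n r g}"

definition Core ::
  "nat \<Rightarrow> nat \<Rightarrow> ((nat \<Rightarrow> letter) \<Rightarrow> nat \<Rightarrow> letter) \<Rightarrow> nat transducer set" where
  "Core n r h = {core n A | A q0. minimal_dotted_transducer_of n r h A q0}"

definition core_product ::
  "nat \<Rightarrow> nat transducer set \<Rightarrow> nat transducer set \<Rightarrow> nat transducer set" where
  "core_product n G H = {core n A | A q0. \<exists>T\<in>G. \<exists>U\<in>H. \<exists>q1\<in>states T. \<exists>q2\<in>states U.
     minimal_transducer_of n (\<lambda>x. out_inf U (out_inf T x q1) q2) A q0}"

text \<open>The identity of $\mathcal O_n$ is the core of the identity map.\<close>

definition O_group :: "nat \<Rightarrow> nat transducer set monoid" where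
  "O_group n =
     \<lparr>carrier = (\<Union>r\<in>{1..n - 1}. Core n r ` B n r),
      monoid.mult = core_product n,
      one = Core n 1 (\<lambda>x. x)\<rparr>"


section \<open>The signature\<close>

definition state_image :: "nat \<Rightarrow> 'q transducer \<Rightarrow> 'q \<Rightarrow> (nat \<Rightarrow> letter) set" where
  "state_image n T q = (\<lambda>x. out_inf T x q) ` Cantor n"

definition cone_number :: "nat \<Rightarrow> 'q transducer \<Rightarrow> 'q \<Rightarrow> nat" where
  "cone_number n T q = (LEAST m. \<exists>V\<subseteq>lists (alphabet n).
     finite V \<and> card V = m \<and> (\<Union>v\<in>V. cone n v) = state_image n T q)"

definition forced_state :: "nat \<Rightarrow> 'q transducer \<Rightarrow> letter list \<Rightarrow> 'q" where
  "forced_state n T x = (THE p. \<exists>q\<in>states T. x \<in> input_words n T q \<and> state_after T x q = p)"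

definition signature :: "nat \<Rightarrow> 'q transducer \<Rightarrow> nat" where
  "signature n T =
     (\<Sum>x\<in>words_of_length n (sync_level n T). cone_number n T (forced_state n T x))"

text \<open>
  The ring $\mathbb Z_{n-1}$ is the quotient ring \<open>ZFact (int n - 1)\<close>, which also covers $n = 2$, and
  \<open>ZMod (int n - 1) a\<close> is the class of \<open>a\<close>. The signature does not depend on the naming of the
  states, so any representative may be chosen.
\<close>

definition reduced_signature :: "nat \<Rightarrow> nat transducer set \<Rightarrow> int set" where
  "reduced_signature n G = ZMod (int n - 1) (int (signature n (SOME T. T \<in> G)))"

definition unit_group :: "nat \<Rightarrow> int set monoid" where
  "unit_group n = units_of (ZFact (int n - 1))"

end

theory Submission
  imports Defs "HOL-Number_Theory.Cong"
begin

text \<open>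
  Counting the cones in a finite partition of a clopen set defines a finitely additive measure with
  values in $\mathbb Z_{n-1}$, because splitting a cone into $n$ cones changes the count by $n - 1$.
  An element $h$ of $\mathcal B_{n,r}$ multiplies this measure by the signature of its core: a long
  cone is split according to the words of synchronizing length, and each piece is mapped onto a
  translate of the image of the state that its word forces. Applied to $h$ and $h^{-1}$ this shows
  that the reduced signature is a unit.

  For a divisor $d$ of $n = d e$ a letter is a pair in $X_d \times X_e$, and regrouping
  $(a_0, b_0)(a_1, b_1)\ldots$ as $a_0$ followed by $(b_0, a_1)(b_1, a_2)\ldots$ identifies
  $\mathfrak C_n$ with $d$ copies of itself. Iterating over a list of divisors with product $D$, and
  gluing with a complete prefix code of size $(n-1) D$ in $\mathfrak C_{n,n-1}$, gives an element of
  $\mathcal B_{n,n-1}$ that maps a cone onto $D$ cones, hence has reduced signature $D$. Since $n/d$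
  is inverse to $d$ modulo $n - 1$, such products exhaust the group generated by the divisors.
\<close>


section \<open>Words\<close>

text \<open>The value \<open>r = n - 1\<close> comes from the size of the code. A complete prefix
  code of \<open>dotted_Cantor n r\<close> has a size congruent to \<open>r\<close> modulo
  \<open>n - 1\<close>, whereas the construction needs \<open>r * D\<close> words, one for each of
  the \<open>D\<close> copies inside each of the \<open>r\<close> initial cones; for
  \<open>r = n - 1\<close> both numbers are congruent to 0, whatever \<open>D\<close> is.

  Membership in \<open>B n r\<close> asks for finite synchronizing minimal transducers of a map and
  of its inverse, but the regrouping is given by formulas. Its transducers are therefore obtained
  from a general criterion: it suffices that, after boundedly many further letters, the past
  influences a value only through a prefix of the output. The regrouping is a block map that
  commutes with the shift, and its inverse forgets the initial symbol after boundedly many letters,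
  so both satisfy the criterion.

  The signature is a sum of sizes of smallest covers, not of partitions. The two notions meet
  because a smallest cover by cones is automatically disjoint.\<close>

lemma conc_in_Cantor_iff: "w \<frown> x \<in> Cantor n \<longleftrightarrow> w \<in> lists (alphabet n) \<and> x \<in> Cantor n"
proof
  assume *: "w \<frown> x \<in> Cantor n"
  have "w ! i \<in> alphabet n" if "i < length w" for i
    using * that by (auto simp: Cantor_def dest: spec[of _ i])
  moreover have "x i \<in> alphabet n" for i
    using * by (auto simp: Cantor_def dest: spec[of _ "length w + i"])
  ultimately show "w \<in> lists (alphabet n) \<and> x \<in> Cantor n"
    by (auto simp: Cantor_def in_lists_conv_set in_set_conv_nth)
next
  assume "w \<in> lists (alphabet n) \<and> x \<in> Cantor n"
  then show "w \<frown> x \<in> Cantor n"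
    by (auto simp: Cantor_def conc_def in_lists_conv_set)
qed

lemma suffix_in_Cantor: "x \<in> Cantor n \<Longrightarrow> suffix k x \<in> Cantor n"
  by (simp add: Cantor_def)

lemma prefix_in_lists: "x \<in> Cantor n \<Longrightarrow> Omega_Words_Fun.prefix k x \<in> lists (alphabet n)"
  by (auto simp: Cantor_def in_lists_conv_set)

lemma Cantor_nonempty: "n \<ge> 1 \<Longrightarrow> Cantor n \<noteq> {}"
proof -
  assume "n \<ge> 1"
  then have "(\<lambda>_. Plain 0) \<in> Cantor n"
    by (auto simp: Cantor_def alphabet_def)
  then show ?thesis by blast
qed

lemma alphabet_disjoint_dotted: "alphabet n \<inter> dotted_alphabet r = {}"
  by (auto simp: alphabet_def dotted_alphabet_def)

lemma finite_alphabet: "finite (alphabet n)"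
  by (simp add: alphabet_def)

lemma card_alphabet: "card (alphabet n) = n"
  by (simp add: alphabet_def card_image inj_on_def)

lemma finite_words_of_length: "finite (words_of_length n k)"
  unfolding words_of_length_def lists_eq_set
  using finite_lists_length_eq[OF finite_alphabet, of n k] by (simp add: conj_commute)

lemma card_words_of_length: "card (words_of_length n k) = n ^ k"
  unfolding words_of_length_def lists_eq_set
  using card_lists_length_eq[OF finite_alphabet, of n k]
  by (simp add: conj_commute card_alphabet)

lemma dotted_words_nonempty: "w \<in> dotted_words n r \<Longrightarrow> w \<noteq> []"
  by (auto simp: dotted_words_def)

lemma Nil_notin_dotted_words [simp]: "[] \<notin> dotted_words n r"
  by (auto simp: dotted_words_def)

lemma append_in_dotted_words_iff:
  "w \<noteq> [] \<Longrightarrow> w @ v \<in> dotted_words n r \<longleftrightarrow> w \<in> dotted_words n r \<and> v \<in> lists (alphabet n)"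
  by (cases w) (auto simp: dotted_words_def)

lemma append_in_dotted_words:
  "w \<in> dotted_words n r \<Longrightarrow> v \<in> lists (alphabet n) \<Longrightarrow> w @ v \<in> dotted_words n r"
  by (auto simp: dotted_words_def)

lemma Cons_in_dotted_words_iff:
  "a # w \<in> dotted_words n r \<longleftrightarrow> a \<in> dotted_alphabet r \<and> w \<in> lists (alphabet n)"
  by (auto simp: dotted_words_def)

lemma conc_in_dotted_Cantor_iff:
  assumes "w \<noteq> []"
  shows "w \<frown> x \<in> dotted_Cantor n r \<longleftrightarrow> w \<in> dotted_words n r \<and> x \<in> Cantor n"
proof -
  obtain a v where w: "w = a # v"
    using assms by (cases w) auto
  have "w \<frown> x = [b] \<frown> y \<longleftrightarrow> b = a \<and> y = v \<frown> x" for b y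
  proof -
    have "w \<frown> x = [a] \<frown> (v \<frown> x)"
      by (simp add: w)
    then show ?thesis
      by (metis concat_eq length_Cons list.inject)
  qed
  then show ?thesis
    by (auto simp: dotted_Cantor_def w Cons_in_dotted_words_iff conc_in_Cantor_iff)
qed

lemma suffix_in_Cantor_of_dotted:
  assumes "x \<in> dotted_Cantor n r" "k > 0"
  shows "suffix k x \<in> Cantor n"
  using assms conc_in_dotted_Cantor_iff[of "Omega_Words_Fun.prefix k x" "suffix k x" n r]
  by simp

lemma prefix_in_dotted_words:
  assumes "x \<in> dotted_Cantor n r" "k > 0"
  shows "Omega_Words_Fun.prefix k x \<in> dotted_words n r"
  using assms conc_in_dotted_Cantor_iff[of "Omega_Words_Fun.prefix k x" "suffix k x" n r]
  by simp

lemma dotted_Cantor_first: "x \<in> dotted_Cantor n r \<Longrightarrow> x 0 \<in> dotted_alphabet r"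
  by (auto simp: dotted_Cantor_def)

lemma is_prefix_conc [simp]: "is_prefix w (w \<frown> x)"
  by (simp add: is_prefix_def)

lemma is_prefix_iff_conc: "is_prefix w x \<longleftrightarrow> x = w \<frown> suffix (length w) x"
proof
  assume "is_prefix w x"
  then show "x = w \<frown> suffix (length w) x"
    using prefix_suffix[of x "length w"] by (simp add: is_prefix_def)
next
  assume "x = w \<frown> suffix (length w) x"
  then show "is_prefix w x"
    using is_prefix_conc[of w "suffix (length w) x"] by simp
qed

lemma is_prefix_Nil [simp]: "is_prefix [] x"
  by (simp add: is_prefix_def)

lemma is_prefix_append_conc: "is_prefix (p @ v) (p \<frown> x) \<longleftrightarrow> is_prefix v x"
  by (simp add: is_prefix_def)

lemma is_prefix_nth: "is_prefix w x \<Longrightarrow> i < length w \<Longrightarrow> x i = w ! i"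
  using subsequence_nth[of i "length w" 0 x] by (simp add: is_prefix_def)

lemma is_prefixI: "(\<And>i. i < length w \<Longrightarrow> x i = w ! i) \<Longrightarrow> is_prefix w x"
  by (auto simp: is_prefix_def intro!: nth_equalityI)

lemma is_prefix_take:
  assumes "is_prefix w x" "is_prefix v x" "length w \<le> length v"
  shows "v = w @ drop (length w) v"
proof -
  have "take (length w) v = w"
    using assms by (intro nth_equalityI) (auto simp: is_prefix_nth[symmetric])
  then show ?thesis
    by (metis append_take_drop_id)
qed

lemma greatest_common_prefix_unique:
  assumes "is_greatest_common_prefix v S" "is_greatest_common_prefix w S" "S \<noteq> {}"
  shows "v = w"
proof -
  obtain x where "x \<in> S" using assms by blast
  moreover have "length v = length w"
    using assms unfolding is_greatest_common_prefix_def by (meson le_antisym)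
  ultimately show ?thesis
    using assms unfolding is_greatest_common_prefix_def is_prefix_def by metis
qed

text \<open>Output already written can be cancelled: a common prefix of the words
  \<open>p \<frown> x\<close> is either shorter than \<open>p\<close> or extends it. This is how
  statements about \<open>h\<close> on a cone are exchanged with statements about the map of a
  single state.\<close>

lemma greatest_common_prefix_conc_iff:
  assumes "S \<noteq> {}"
  shows "is_greatest_common_prefix (p @ v) ((\<lambda>x. p \<frown> x) ` S) \<longleftrightarrow> is_greatest_common_prefix v S"
proof -
  have "(\<forall>u. (\<forall>x\<in>S. is_prefix u (p \<frown> x)) \<longrightarrow> length u \<le> length p + length v) \<longleftrightarrow>
    (\<forall>u. (\<forall>x\<in>S. is_prefix u x) \<longrightarrow> length u \<le> length v)" (is "?L \<longleftrightarrow> ?R")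
  proof
    assume L: ?L
    show ?R
    proof (intro allI impI)
      fix u assume "\<forall>x\<in>S. is_prefix u x"
      then show "length u \<le> length v"
        using L[rule_format, of "p @ u"] by (simp add: is_prefix_append_conc)
    qed
  next
    assume R: ?R
    show ?L
    proof (intro allI impI)
      fix u assume u: "\<forall>x\<in>S. is_prefix u (p \<frown> x)"
      show "length u \<le> length p + length v"
      proof (cases "length p \<le> length u")
        case True
        obtain x0 where "x0 \<in> S" using assms by blast
        then have eq: "u = p @ drop (length p) u"
          using u True by (intro is_prefix_take[of p "p \<frown> x0"]) auto
        have "\<forall>x\<in>S. is_prefix (drop (length p) u) x"
          using u eq is_prefix_append_conc by metis
        then have "length (drop (length p) u) \<le> length v"
          using R by blast
        then show ?thesis by simp
      qed simp
    qed
  qed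
  then show ?thesis
    by (simp add: is_greatest_common_prefix_def is_prefix_append_conc)
qed


section \<open>Counting cones modulo \<open>n - 1\<close>\<close>

lemma in_cone_iff: "x \<in> cone n w \<longleftrightarrow> is_prefix w x \<and> suffix (length w) x \<in> Cantor n"
proof
  assume "x \<in> cone n w"
  then show "is_prefix w x \<and> suffix (length w) x \<in> Cantor n"
    by (auto simp: cone_def)
next
  assume "is_prefix w x \<and> suffix (length w) x \<in> Cantor n"
  then show "x \<in> cone n w"
    unfolding cone_def using is_prefix_iff_conc[of w x] by blast
qed

lemma cone_nonempty: "n \<ge> 1 \<Longrightarrow> cone n w \<noteq> {}"
  using Cantor_nonempty by (auto simp: cone_def)

lemma conc_image_cone: "(\<lambda>x. w \<frown> x) ` cone n v = cone n (w @ v)"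
  by (auto simp: cone_def image_iff) (metis conc_conc)

lemma cone_subset_dotted_Cantor: "w \<in> dotted_words n r \<Longrightarrow> cone n w \<subseteq> dotted_Cantor n r"
  by (auto simp: cone_def conc_in_dotted_Cantor_iff[OF dotted_words_nonempty])

lemma dotted_words_if_cone_subset:
  assumes "cone n w \<subseteq> dotted_Cantor n r" "n \<ge> 1"
  shows "w \<in> dotted_words n r"
proof -
  obtain x where x: "x \<in> Cantor n" using Cantor_nonempty assms by blast
  then have "w \<frown> x \<in> dotted_Cantor n r" using assms by (auto simp: cone_def)
  moreover have "w \<noteq> []"
  proof
    assume "w = []"
    then have "x \<in> dotted_Cantor n r" using calculation by simp
    then show False
      using x alphabet_disjoint_dotted[of n r] dotted_Cantor_first[of x n r]
      by (auto simp: Cantor_def)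
  qed
  ultimately show ?thesis
    using conc_in_dotted_Cantor_iff by blast
qed

lemma cone_UN_extensions: "(\<Union>t\<in>words_of_length n k. cone n (w @ t)) = cone n w"
proof
  show "(\<Union>t\<in>words_of_length n k. cone n (w @ t)) \<subseteq> cone n w"
  proof
    fix y assume "y \<in> (\<Union>t\<in>words_of_length n k. cone n (w @ t))"
    then obtain t x where "t \<in> lists (alphabet n)" "x \<in> Cantor n" "y = w \<frown> (t \<frown> x)"
      by (auto simp: cone_def words_of_length_def)
    then show "y \<in> cone n w"
      unfolding cone_def using conc_in_Cantor_iff by blast
  qed
  show "cone n w \<subseteq> (\<Union>t\<in>words_of_length n k. cone n (w @ t))"
  proof
    fix y assume "y \<in> cone n w"
    then obtain x where x: "y = w \<frown> x" "x \<in> Cantor n" by (auto simp: cone_def)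
    then have "y = (w @ Omega_Words_Fun.prefix k x) \<frown> suffix k x"
      using prefix_suffix[of x k] conc_conc[of w "Omega_Words_Fun.prefix k x" "suffix k x"]
      by presburger
    then show "y \<in> (\<Union>t\<in>words_of_length n k. cone n (w @ t))"
      using prefix_in_lists[OF x(2), of k] suffix_in_Cantor[OF x(2), of k]
      unfolding cone_def words_of_length_def by fastforce
  qed
qed

lemma cone_append_subset:
  assumes "t \<in> lists (alphabet n)"
  shows "cone n (w @ t) \<subseteq> cone n w"
  using assms cone_UN_extensions[of n w "length t"] by (auto simp: words_of_length_def)

lemma cones_same_length_disjoint:
  "length v = length w \<Longrightarrow> v \<noteq> w \<Longrightarrow> cone n v \<inter> cone n w = {}"
  by (auto simp: in_cone_iff is_prefix_def)

text \<open>The words in \<open>V\<close> are arbitrary lists of letters, so one notion serves for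
  subsets of \<open>Cantor n\<close> and of \<open>dotted_Cantor n r\<close>.\<close>

definition cone_partition :: "nat \<Rightarrow> letter list set \<Rightarrow> (nat \<Rightarrow> letter) set \<Rightarrow> bool" where
  "cone_partition n V C \<longleftrightarrow> finite V \<and> disjoint_family_on (cone n) V \<and> (\<Union>v\<in>V. cone n v) = C"

text \<open>The left-hand count does not mention \<open>V\<close>, which makes \<open>card V\<close>
  modulo \<open>n - 1\<close> an invariant of \<open>C\<close>. The cone of a word of length
  \<open>N\<close> inside \<open>C\<close> lies in exactly one cone of the partition, and the cone
  of \<open>v\<close> contains \<open>n ^ (N - length v)\<close> of them, a power of a number
  congruent to 1.\<close>

lemma card_cones_of_partition:
  assumes P: "cone_partition n V C" and N: "\<And>v. v \<in> V \<Longrightarrow> length v \<le> N" and n: "n \<ge> 1"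
  shows "[int (card {w. length w = N \<and> cone n w \<subseteq> C}) = int (card V)] (mod (int n - 1))"
proof -
  let ?E = "\<lambda>v. (\<lambda>t. v @ t) ` words_of_length n (N - length v)"
  have eq: "{w. length w = N \<and> cone n w \<subseteq> C} = (\<Union>v\<in>V. ?E v)"
  proof (intro equalityI subsetI)
    fix w assume w: "w \<in> {w. length w = N \<and> cone n w \<subseteq> C}"
    obtain x where x: "x \<in> Cantor n" using Cantor_nonempty n by blast
    then have "w \<frown> x \<in> C" using w by (auto simp: cone_def)
    then obtain v where v: "v \<in> V" "w \<frown> x \<in> cone n v"
      using P by (auto simp: cone_partition_def)
    then have l: "length v \<le> length w" using N w by auto
    then have w': "w = v @ drop (length v) w"
      using v by (intro is_prefix_take[of v "w \<frown> x"]) (auto simp: in_cone_iff)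
    have "drop (length v) w \<frown> x \<in> Cantor n"
      using v l by (simp add: in_cone_iff)
    then have "drop (length v) w \<in> words_of_length n (N - length v)"
      using w by (simp add: words_of_length_def conc_in_Cantor_iff)
    then show "w \<in> (\<Union>v\<in>V. ?E v)" using v w' by blast
  next
    fix w assume "w \<in> (\<Union>v\<in>V. ?E v)"
    then obtain v t where vt: "v \<in> V" "t \<in> words_of_length n (N - length v)" "w = v @ t" by auto
    then have "cone n w \<subseteq> cone n v"
      by (simp add: words_of_length_def cone_append_subset)
    then show "w \<in> {w. length w = N \<and> cone n w \<subseteq> C}"
      using vt N P by (auto simp: words_of_length_def cone_partition_def)
  qed
  have disj: "?E u \<inter> ?E v = {}" if "u \<in> V" "v \<in> V" "u \<noteq> v" for u v
  proof (rule ccontr)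
    assume "?E u \<inter> ?E v \<noteq> {}"
    then obtain w where "w \<in> ?E u" "w \<in> ?E v" by blast
    then have "cone n w \<subseteq> cone n u" "cone n w \<subseteq> cone n v"
      by (auto simp: words_of_length_def dest!: cone_append_subset)
    moreover have "cone n u \<inter> cone n v = {}"
      using that P by (auto simp: cone_partition_def disjoint_family_on_def)
    ultimately show False
      using cone_nonempty[OF n, of w] by blast
  qed
  have "card (\<Union>v\<in>V. ?E v) = (\<Sum>v\<in>V. card (?E v))"
    using P disj by (intro card_UN_disjoint) (auto simp: cone_partition_def finite_words_of_length)
  also have "\<dots> = (\<Sum>v\<in>V. n ^ (N - length v))"
    by (intro sum.cong) (auto simp: card_image inj_on_def card_words_of_length)
  finally have "int (card {w. length w = N \<and> cone n w \<subseteq> C}) = (\<Sum>v\<in>V. int n ^ (N - length v))"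
    using eq by simp
  also have "[\<dots> = (\<Sum>v\<in>V. 1 ^ (N - length v))] (mod (int n - 1))"
    by (intro cong_sum cong_pow) (simp add: cong_iff_dvd_diff)
  finally show ?thesis by simp
qed

text \<open>A relation instead of a function: only finite disjoint unions of cones are measured, and
  the value is meaningful only modulo \<open>n - 1\<close>.\<close>

definition has_cone_measure :: "nat \<Rightarrow> (nat \<Rightarrow> letter) set \<Rightarrow> int \<Rightarrow> bool" where
  "has_cone_measure n C c \<longleftrightarrow>
     (\<exists>V. cone_partition n V C \<and> [int (card V) = c] (mod (int n - 1)))"

lemma has_cone_measure_unique:
  assumes "has_cone_measure n C c" "has_cone_measure n C d" "n \<ge> 1"
  shows "[c = d] (mod (int n - 1))"
proof -
  obtain V W where V: "cone_partition n V C" "[int (card V) = c] (mod (int n - 1))"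
    and W: "cone_partition n W C" "[int (card W) = d] (mod (int n - 1))"
    using assms by (auto simp: has_cone_measure_def)
  \<comment> \<open>A common bound for the words of both partitions, so that both are compared with
    the same set of cones; \<open>insert 0\<close> keeps \<open>Max\<close> defined when both are
    empty.\<close>
  define N where "N = Max (insert 0 (length ` (V \<union> W)))"
  have fin: "finite (insert 0 (length ` (V \<union> W)))"
    using V W by (simp add: cone_partition_def)
  have "length v \<le> N" if "v \<in> V \<union> W" for v
    unfolding N_def using that by (intro Max_ge[OF fin]) auto
  then show ?thesis
    using card_cones_of_partition[OF V(1), of N] card_cones_of_partition[OF W(1), of N]
      V(2) W(2) assms(3) by (meson UnCI cong_sym cong_trans)
qed

lemma has_cone_measure_cong:
  "has_cone_measure n C c \<Longrightarrow> [c = d] (mod (int n - 1)) \<Longrightarrow> has_cone_measure n C d"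
  by (auto simp: has_cone_measure_def intro: cong_trans)

lemma has_cone_measure_partition: "cone_partition n V C \<Longrightarrow> has_cone_measure n C (int (card V))"
  by (auto simp: has_cone_measure_def)

lemma cone_partition_cone: "cone_partition n {w} (cone n w)"
  by (simp add: cone_partition_def disjoint_family_on_def)

lemma has_cone_measure_cone: "has_cone_measure n (cone n w) 1"
  using has_cone_measure_partition[OF cone_partition_cone] by simp

lemma cone_partition_UN:
  assumes "finite I" "disjoint_family_on C I" "\<And>i. i \<in> I \<Longrightarrow> cone_partition n (V i) (C i)"
  shows "cone_partition n (\<Union>i\<in>I. V i) (\<Union>i\<in>I. C i)"
proof -
  have sub: "cone n v \<subseteq> C i" if "i \<in> I" "v \<in> V i" for i v
    using that assms(3) by (auto simp: cone_partition_def)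
  have "cone n u \<inter> cone n v = {}" if "i \<in> I" "j \<in> I" "u \<in> V i" "v \<in> V j" "u \<noteq> v" for i j u v
  proof (cases "i = j")
    case True
    then show ?thesis using that assms(3)[of i] by (auto simp: cone_partition_def disjoint_family_on_def)
  next
    case False
    then show ?thesis using that sub assms(2) by (fastforce simp: disjoint_family_on_def)
  qed
  then show ?thesis
    using assms by (auto simp: cone_partition_def disjoint_family_on_def)
qed

lemma has_cone_measure_UN:
  assumes I: "finite I" "disjoint_family_on C I" and m: "\<And>i. i \<in> I \<Longrightarrow> has_cone_measure n (C i) (c i)"
    and n: "n \<ge> 1"
  shows "has_cone_measure n (\<Union>i\<in>I. C i) (\<Sum>i\<in>I. c i)"
proof -
  obtain V where V: "\<And>i. i \<in> I \<Longrightarrow> cone_partition n (V i) (C i)"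
      "\<And>i. i \<in> I \<Longrightarrow> [int (card (V i)) = c i] (mod (int n - 1))"
    using m unfolding has_cone_measure_def by metis
  have "V i \<inter> V j = {}" if "i \<in> I" "j \<in> I" "i \<noteq> j" for i j
  proof (rule ccontr)
    assume "V i \<inter> V j \<noteq> {}"
    then obtain v where "v \<in> V i" "v \<in> V j" by blast
    then have "cone n v \<subseteq> C i \<inter> C j"
      using V(1)[of i] V(1)[of j] that by (auto simp: cone_partition_def)
    moreover have "C i \<inter> C j = {}"
      using that I(2) by (simp add: disjoint_family_on_def)
    ultimately show False
      using cone_nonempty[OF n, of v] by simp
  qed
  then have "card (\<Union>i\<in>I. V i) = (\<Sum>i\<in>I. card (V i))"
    using I V by (intro card_UN_disjoint) (auto simp: cone_partition_def)
  then have "[int (card (\<Union>i\<in>I. V i)) = (\<Sum>i\<in>I. c i)] (mod (int n - 1))"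
    using V(2) by (auto intro: cong_sum)
  then show ?thesis
    using cone_partition_UN[OF I V(1)] by (auto simp: has_cone_measure_def)
qed

lemma has_cone_measure_conc:
  assumes "has_cone_measure n C c"
  shows "has_cone_measure n ((\<lambda>x. w \<frown> x) ` C) c"
proof -
  obtain V where V: "cone_partition n V C" "[int (card V) = c] (mod (int n - 1))"
    using assms by (auto simp: has_cone_measure_def)
  have "cone n (w @ u) \<inter> cone n (w @ v) = {}" if "cone n u \<inter> cone n v = {}" for u v
    using that by (force simp flip: conc_image_cone)
  then have "cone_partition n ((\<lambda>v. w @ v) ` V) ((\<lambda>x. w \<frown> x) ` C)"
    using V(1) by (auto simp: cone_partition_def disjoint_family_on_def image_UN
        simp flip: conc_image_cone)
  moreover have "card ((\<lambda>v. w @ v) ` V) = card V"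
    by (simp add: card_image inj_on_def)
  ultimately show ?thesis
    using V(2) by (auto simp: has_cone_measure_def)
qed


section \<open>Transducers and their local maps\<close>

lemma state_after_append:
  "state_after A (u @ v) q = state_after A v (state_after A u q)"
  by (induction u arbitrary: q) auto

lemma out_word_append:
  "out_word A (u @ v) q = out_word A u q @ out_word A v (state_after A u q)"
  by (induction u arbitrary: q) auto

text \<open>Replaces the \<open>LEAST\<close> in \<open>out_inf\<close> by a limit: a word that
  extends all finite outputs is the infinite output, since these outputs become arbitrarily
  long.\<close>

lemma out_inf_eqI:
  assumes inf: "has_infinite_output A x q"
    and pre: "\<And>k. is_prefix (out_word A (Omega_Words_Fun.prefix k x) q) z"
  shows "out_inf A x q = z"
proof
  fix i
  define k where "k = (LEAST k. i < length (out_word A (Omega_Words_Fun.prefix k x) q))"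
  have "\<exists>k. i < length (out_word A (Omega_Words_Fun.prefix k x) q)"
    using inf unfolding has_infinite_output_def by (meson Suc_le_lessD)
  then have "i < length (out_word A (Omega_Words_Fun.prefix k x) q)"
    unfolding k_def by (rule LeastI_ex)
  then show "out_inf A x q i = z i"
    unfolding out_inf_def k_def[symmetric] using is_prefix_nth[OF pre] by simp
qed

lemma is_prefix_out_inf:
  assumes inf: "has_infinite_output A x q"
  shows "is_prefix (out_word A (Omega_Words_Fun.prefix k x) q) (out_inf A x q)"
proof (rule is_prefixI)
  fix i assume i: "i < length (out_word A (Omega_Words_Fun.prefix k x) q)"
  define l where "l = (LEAST k. i < length (out_word A (Omega_Words_Fun.prefix k x) q))"
  have l: "i < length (out_word A (Omega_Words_Fun.prefix l x) q)"
    unfolding l_def using i by (rule LeastI)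
  have "l \<le> k"
    unfolding l_def using i by (rule Least_le)
  then obtain d where "k = l + d" using le_Suc_ex by blast
  then show "out_inf A x q i = out_word A (Omega_Words_Fun.prefix k x) q ! i"
    using l by (simp add: out_inf_def l_def[symmetric] subsequence_append out_word_append nth_append)
qed

lemma has_infinite_output_conc:
  assumes "has_infinite_output A x (state_after A w q)"
  shows "has_infinite_output A (w \<frown> x) q"
  unfolding has_infinite_output_def
proof
  fix m
  obtain k where "m \<le> length (out_word A (Omega_Words_Fun.prefix k x) (state_after A w q))"
    using assms unfolding has_infinite_output_def by blast
  then have "m \<le> length (out_word A (Omega_Words_Fun.prefix (length w + k) (w \<frown> x)) q)"
    by (simp add: out_word_append)
  then show "\<exists>k. m \<le> length (out_word A (Omega_Words_Fun.prefix k (w \<frown> x)) q)" by blast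
qed

lemma out_inf_conc:
  assumes "has_infinite_output A x (state_after A w q)"
  shows "out_inf A (w \<frown> x) q = out_word A w q \<frown> out_inf A x (state_after A w q)"
proof (rule out_inf_eqI)
  show "has_infinite_output A (w \<frown> x) q"
    using assms by (rule has_infinite_output_conc)
  fix k
  show "is_prefix (out_word A (Omega_Words_Fun.prefix k (w \<frown> x)) q)
    (out_word A w q \<frown> out_inf A x (state_after A w q))"
  proof (cases "length w \<le> k")
    case True
    then show ?thesis
      using is_prefix_out_inf[OF assms]
      by (simp add: out_word_append is_prefix_append_conc)
  next
    case False
    then have "out_word A w q = out_word A (take k w) q @ out_word A (drop k w) (state_after A (take k w) q)"
      by (metis append_take_drop_id out_word_append)
    then show ?thesis
      using False by (simp flip: conc_conc)
  qed
qed

lemma synchronizing_atD: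
  assumes "synchronizing_at n A k" "p \<in> states A" "q \<in> states A"
    "w \<in> input_words n A p" "w \<in> input_words n A q" "length w = k"
  shows "state_after A w p = state_after A w q"
  using assms unfolding synchronizing_at_def by blast

locale dotted_transducer =
  fixes n r :: nat and A :: "'q transducer" and q0 :: 'q and R S :: "'q set"
  assumes n_pos: "n \<ge> 1" and r_pos: "r \<ge> 1"
    and states_eq: "states A = R \<union> S" and RS_disjoint: "R \<inter> S = {}" and finite_R: "finite R"
    and q0_R: "q0 \<in> R" and readable_q0: "readable A q0 = dotted_alphabet r"
    and readable_other: "\<And>q. q \<in> states A \<Longrightarrow> q \<noteq> q0 \<Longrightarrow> readable A q = alphabet n"
    and transition_states: "\<And>q i. q \<in> states A \<Longrightarrow> i \<in> readable A q \<Longrightarrow> transition A i q \<in> states A - {q0}"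
    and out_R_R: "\<And>q i. q \<in> R \<Longrightarrow> i \<in> readable A q \<Longrightarrow> transition A i q \<in> R \<Longrightarrow> out A i q = []"
    and out_R_S: "\<And>q i. q \<in> R \<Longrightarrow> i \<in> readable A q \<Longrightarrow> transition A i q \<in> S \<Longrightarrow>
      out A i q \<in> dotted_words n r"
    and transition_S: "\<And>q i. q \<in> S \<Longrightarrow> i \<in> readable A q \<Longrightarrow> transition A i q \<in> S"
    and out_S: "\<And>q i. q \<in> S \<Longrightarrow> i \<in> readable A q \<Longrightarrow> out A i q \<in> lists (alphabet n)"
    and infinite_output_S: "\<And>q x. q \<in> S \<Longrightarrow> x \<in> Cantor n \<Longrightarrow> has_infinite_output A x q"
    and no_cycle: "\<And>q w. q \<in> R \<Longrightarrow> w \<in> input_words n A q \<Longrightarrow> w \<noteq> [] \<Longrightarrow> state_after A w q \<noteq> q"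
begin

lemma q0_state: "q0 \<in> states A"
  using states_eq q0_R by simp

lemma input_words_other:
  assumes "q \<in> states A" "q \<noteq> q0"
  shows "input_words n A q = lists (alphabet n)"
proof -
  have "w \<in> insert [] {i # w | i w. i \<in> alphabet n \<and> w \<in> lists (alphabet n)} \<longleftrightarrow> w \<in> lists (alphabet n)"
    for w by (cases w) auto
  then show ?thesis
    unfolding input_words_def readable_other[OF assms] by blast
qed

lemma input_words_q0: "input_words n A q0 = insert [] (dotted_words n r)"
  by (auto simp: input_words_def readable_q0 dotted_words_def)

lemma infinite_inputs_other:
  assumes "q \<in> states A" "q \<noteq> q0"
  shows "infinite_inputs n A q = Cantor n"
proof -
  have "x \<in> infinite_inputs n A q \<longleftrightarrow> x \<in> Cantor n" for x
  proof
    assume "x \<in> infinite_inputs n A q"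
    then show "x \<in> Cantor n"
      unfolding infinite_inputs_def readable_other[OF assms] by (auto simp only: conc_in_Cantor_iff) simp
  next
    assume x: "x \<in> Cantor n"
    then have "x = [x 0] \<frown> suffix 1 x" "x 0 \<in> alphabet n"
      using prefix_suffix[of x 1] by (auto simp: Cantor_def)
    then show "x \<in> infinite_inputs n A q"
      using suffix_in_Cantor[OF x] unfolding infinite_inputs_def readable_other[OF assms] by blast
  qed
  then show ?thesis by blast
qed

lemma state_after_other:
  assumes "q \<in> states A" "q \<noteq> q0" "w \<in> lists (alphabet n)"
  shows "state_after A w q \<in> states A - {q0}"
  using assms
proof (induction w arbitrary: q)
  case (Cons i w)
  then show ?case
    using transition_states[of q i] readable_other[of q] by auto
qed auto

lemma state_after_q0:
  assumes "w \<in> dotted_words n r"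
  shows "state_after A w q0 \<in> states A - {q0}"
proof -
  obtain a v where "w = a # v" "a \<in> dotted_alphabet r" "v \<in> lists (alphabet n)"
    using assms by (auto simp: dotted_words_def)
  then show ?thesis
    using state_after_other[of "transition A a q0" v] transition_states[of q0 a] q0_state readable_q0
    by auto
qed

lemma state_after_S:
  assumes "q \<in> S" "w \<in> lists (alphabet n)"
  shows "state_after A w q \<in> S \<and> out_word A w q \<in> lists (alphabet n)"
  using assms
proof (induction w arbitrary: q)
  case (Cons i w)
  have "i \<in> readable A q"
    using Cons.prems readable_other[of q] q0_R RS_disjoint states_eq by auto
  then show ?case
    using Cons transition_S[of q i] out_S[of q i] by auto
qed auto

text \<open>A run from \<open>R\<close> writes nothing while it stays there, writes a dotted word at
  the step into \<open>S\<close>, and only plain letters afterwards, as \<open>S\<close> is never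
  left.\<close>

lemma out_word_R:
  assumes "q \<in> R" "w \<in> input_words n A q"
  shows "if state_after A w q \<in> R then out_word A w q = [] else out_word A w q \<in> dotted_words n r"
  using assms
proof (induction w arbitrary: q)
  case (Cons i w)
  then have i: "i \<in> readable A q" and w: "w \<in> lists (alphabet n)"
    by (auto simp: input_words_def)
  have t: "transition A i q \<in> states A" "transition A i q \<noteq> q0"
    using transition_states[of q i] i Cons.prems states_eq by auto
  show ?case
  proof (cases "transition A i q \<in> R")
    case True
    have "w \<in> input_words n A (transition A i q)"
      using input_words_other t w by simp
    then show ?thesis
      using Cons.IH[OF True] out_R_R[OF Cons.prems(1) i True] by simp
  next
    case False
    then have TS: "transition A i q \<in> S" using t states_eq by auto
    have o: "out A i q \<in> dotted_words n r" using out_R_S[OF Cons.prems(1) i TS] .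
    show ?thesis
      using state_after_S[OF TS w] RS_disjoint o
        append_in_dotted_words_iff[OF dotted_words_nonempty[OF o]] by auto
  qed
qed auto

text \<open>A run inside \<open>R\<close> visits no state twice, so it leaves \<open>R\<close> after at most \<open>card R\<close> steps.\<close>

lemma leaves_R:
  assumes q: "q \<in> R" and x: "x \<in> infinite_inputs n A q"
  shows "\<exists>k. state_after A (Omega_Words_Fun.prefix k x) q \<in> S"
proof (rule ccontr)
  assume no: "\<not> ?thesis"
  obtain i y where iy: "i \<in> readable A q" "y \<in> Cantor n" "x = [i] \<frown> y"
    using x by (auto simp: infinite_inputs_def)
  let ?s = "\<lambda>k. state_after A (Omega_Words_Fun.prefix k x) q"
  have t: "transition A i q \<in> states A" "transition A i q \<noteq> q0"
    using transition_states[of q i] iy q states_eq by auto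
  have pre: "Omega_Words_Fun.prefix (Suc k) x = i # Omega_Words_Fun.prefix k y" for k
    using prefix_conc_snd[of "[i]" "Suc k" y] iy(3) by simp
  have st: "?s (Suc k) \<in> states A - {q0}" for k
    unfolding pre using state_after_other[OF t prefix_in_lists[OF iy(2)]] by simp
  have "?s k \<in> R" for k
    using no[unfolded not_ex, rule_format, of k] st[of "k - 1"] q states_eq by (cases k) auto
  then have "\<not> inj ?s"
    using finite_R by (meson finite_subset image_subsetI infinite_UNIV_nat finite_imageD)
  then obtain a b where ab: "a < b" "?s a = ?s b"
    unfolding inj_def by (metis linorder_neqE_nat)
  then have a: "a > 0" if "q = q0"
    using that st[of "b - 1"] by (cases a) auto
  define w where "w = Omega_Words_Fun.prefix (b - a) (suffix a x)"
  have "state_after A w (?s a) = ?s a"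
    using ab subsequence_append[of x a "b - a"]
    by (simp add: w_def subsequence_prefix_suffix state_after_append)
  moreover have "w \<noteq> []" using ab by (simp add: w_def)
  moreover have "w \<in> input_words n A (?s a)"
  proof (cases a)
    case 0
    then have "w = i # Omega_Words_Fun.prefix (b - 1) y" using ab pre[of "b - 1"] by (simp add: w_def)
    then show ?thesis using 0 iy prefix_in_lists by (auto simp: input_words_def)
  next
    case (Suc c)
    have "suffix a x = suffix c y"
      using suffix_conc_snd[of "[i]" a y] iy(3) Suc by simp
    then have "suffix a x \<in> Cantor n" using iy suffix_in_Cantor by simp
    then have "w \<in> lists (alphabet n)"
      unfolding w_def by (rule prefix_in_lists)
    moreover have "input_words n A (?s a) = lists (alphabet n)"
      unfolding Suc using st[of c] by (intro input_words_other) auto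
    ultimately show ?thesis by blast
  qed
  ultimately show False
    using no_cycle[of "?s a" w] \<open>\<And>k. ?s k \<in> R\<close> by blast
qed

lemma infinite_output:
  assumes "q \<in> states A" "x \<in> infinite_inputs n A q"
  shows "has_infinite_output A x q"
proof (cases "q \<in> S")
  case True
  then have "q \<noteq> q0" using q0_R RS_disjoint by auto
  then show ?thesis
    using True infinite_output_S assms infinite_inputs_other by simp
next
  case False
  then have "q \<in> R" using assms states_eq by auto
  then obtain k where k: "state_after A (Omega_Words_Fun.prefix k x) q \<in> S"
    using leaves_R assms by blast
  have "k > 0"
    using k False by (cases k) auto
  obtain i y where y: "x = [i] \<frown> y" "y \<in> Cantor n"
    using assms by (auto simp: infinite_inputs_def)
  then have "suffix k x = suffix (k - 1) y"
    using \<open>k > 0\<close> suffix_conc_snd[of "[i]" k y] by simp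
  then have "suffix k x \<in> Cantor n"
    using y suffix_in_Cantor by simp
  then have "has_infinite_output A (suffix k x) (state_after A (Omega_Words_Fun.prefix k x) q)"
    using k infinite_output_S by blast
  from has_infinite_output_conc[OF this] show ?thesis
    by simp
qed

lemma out_inf_q0:
  assumes "w \<in> dotted_words n r" "x \<in> Cantor n"
  shows "out_inf A (w \<frown> x) q0 = out_word A w q0 \<frown> out_inf A x (state_after A w q0)"
  using assms infinite_output infinite_inputs_other state_after_q0 by (intro out_inf_conc) simp

text \<open>Level 0 would leave only one state, but \<open>q0\<close> reads the letter
  \<open>Dotted 0\<close> and is never the target of a transition.\<close>

lemma synchronizing_level_pos:
  assumes "synchronizing_at n A k"
  shows "k > 0"
proof (rule ccontr)
  assume "\<not> k > 0"
  then have "q = p" if "p \<in> states A" "q \<in> states A" for p q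
    using assms that by (auto simp: synchronizing_at_def input_words_def)
  moreover have "Dotted 0 \<in> readable A q0"
    using readable_q0 r_pos by (auto simp: dotted_alphabet_def)
  ultimately show False
    using transition_states q0_state by blast
qed

end

lemma dotted_transducer_if_over:
  assumes "dotted_transducer_over n r A q0" "n \<ge> 1" "r \<ge> 1"
  obtains R S where "dotted_transducer n r A q0 R S"
proof -
  obtain R S where *: "states A = R \<union> S" "R \<inter> S = {}" "finite R" "q0 \<in> R"
     "readable A q0 = dotted_alphabet r" "\<forall>q\<in>states A - {q0}. readable A q = alphabet n"
     "\<forall>q\<in>states A. \<forall>i\<in>readable A q. transition A i q \<in> states A - {q0}"
     "\<forall>q\<in>R. \<forall>i\<in>readable A q. (transition A i q \<in> R \<longrightarrow> out A i q = []) \<and>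
        (transition A i q \<in> S \<longrightarrow> out A i q \<in> dotted_words n r)"
     "\<forall>q\<in>S. \<forall>i\<in>readable A q. transition A i q \<in> S \<and> out A i q \<in> lists (alphabet n)"
     "\<forall>q\<in>S. \<forall>x\<in>Cantor n. has_infinite_output A x q"
     "\<forall>q\<in>R. \<forall>w\<in>input_words n A q. w \<noteq> [] \<longrightarrow> state_after A w q \<noteq> q"
    using assms(1) unfolding dotted_transducer_over_def by (elim exE conjE)
  have "dotted_transducer n r A q0 R S"
    by unfold_locales (use * assms(2,3) in auto)
  then show thesis by (rule that)
qed


section \<open>Continuity and compactness\<close>

text \<open>Uniform continuity for the metric in which words are close when they share a long
  prefix. This is the form in which continuity enters arguments about transducers.\<close>

definition uniformly_determined :: "nat \<Rightarrow> nat \<Rightarrow> ((nat \<Rightarrow> letter) \<Rightarrow> nat \<Rightarrow> letter) \<Rightarrow> bool" where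
  "uniformly_determined n r h \<longleftrightarrow> (\<forall>j. \<exists>N. \<forall>x\<in>dotted_Cantor n r. \<forall>y\<in>dotted_Cantor n r.
     (\<forall>i<N. x i = y i) \<longrightarrow> (\<forall>i<j. h x i = h y i))"

definition dotted_letters :: "nat \<Rightarrow> nat \<Rightarrow> nat \<Rightarrow> letter set" where
  "dotted_letters n r i = (if i = 0 then dotted_alphabet r else alphabet n)"

lemma in_dotted_Cantor_iff: "x \<in> dotted_Cantor n r \<longleftrightarrow> (\<forall>i. x i \<in> dotted_letters n r i)"
proof -
  have "x \<in> dotted_Cantor n r \<longleftrightarrow> [x 0] \<in> dotted_words n r \<and> suffix 1 x \<in> Cantor n"
    using conc_in_dotted_Cantor_iff[of "[x 0]" "suffix 1 x" n r] prefix_suffix[of x 1] by simp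
  then show ?thesis
    by (auto simp: Cons_in_dotted_words_iff Cantor_def gr0_conv_Suc dotted_letters_def)
qed

lemma dotted_Cantor_eq_PiE: "dotted_Cantor n r = (\<Pi>\<^sub>E i\<in>UNIV. dotted_letters n r i)"
  by (auto simp: in_dotted_Cantor_iff PiE_iff)

lemma dotted_Cantor_space_eq_product:
  "dotted_Cantor_space n r = product_topology (\<lambda>i. discrete_topology (dotted_letters n r i)) UNIV"
  unfolding dotted_Cantor_space_def dotted_Cantor_eq_PiE
  by (subst subtopology_product_topology) simp

lemma topspace_dotted_Cantor_space: "topspace (dotted_Cantor_space n r) = dotted_Cantor n r"
  by (simp add: dotted_Cantor_space_def)

lemma compact_space_dotted_Cantor_space: "compact_space (dotted_Cantor_space n r)"
  unfolding dotted_Cantor_space_eq_product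
  by (simp add: compact_space_product_topology compact_space_discrete_topology finite_alphabet
      dotted_alphabet_def dotted_letters_def)

text \<open>Centred at a point instead of given by a word, so that \<open>N = 0\<close> yields the
  whole space, while the cone of the empty word is \<open>Cantor n\<close>.\<close>

definition cylinder :: "nat \<Rightarrow> nat \<Rightarrow> nat \<Rightarrow> (nat \<Rightarrow> letter) \<Rightarrow> (nat \<Rightarrow> letter) set" where
  "cylinder n r N x = {y \<in> dotted_Cantor n r. \<forall>i<N. y i = x i}"

text \<open>A basic open set of the product restricts finitely many coordinates, so around each of
  its points it contains a cylinder whose length exceeds all of them.\<close>

lemma openin_dotted_Cantor_space_iff:
  "openin (dotted_Cantor_space n r) U \<longleftrightarrow>
     U \<subseteq> dotted_Cantor n r \<and> (\<forall>x\<in>U. \<exists>N. cylinder n r N x \<subseteq> U)" (is "?L \<longleftrightarrow> ?R")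
proof
  assume L: ?L
  have sub: "U \<subseteq> dotted_Cantor n r"
    using openin_subset[OF L] by (simp add: topspace_dotted_Cantor_space)
  have "\<exists>N. cylinder n r N x \<subseteq> U" if "x \<in> U" for x
  proof -
    obtain V where V: "finite {i. V i \<noteq> dotted_letters n r i}" "x \<in> Pi\<^sub>E UNIV V" "Pi\<^sub>E UNIV V \<subseteq> U"
      using bspec[OF L[unfolded dotted_Cantor_space_eq_product openin_product_topology_alt] \<open>x \<in> U\<close>]
      unfolding topspace_discrete_topology by fastforce
    obtain N where N: "\<forall>i\<in>{i. V i \<noteq> dotted_letters n r i}. i < N"
      using V(1) finite_nat_set_iff_bounded by blast
    have "cylinder n r N x \<subseteq> Pi\<^sub>E UNIV V"
    proof
      fix y assume y: "y \<in> cylinder n r N x"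
      have "y i \<in> V i" for i
      proof (cases "i < N")
        case True
        then show ?thesis using y V(2) by (auto simp: cylinder_def)
      next
        case False
        then have "V i = dotted_letters n r i" using N by blast
        then show ?thesis using y by (simp add: cylinder_def in_dotted_Cantor_iff)
      qed
      then show "y \<in> Pi\<^sub>E UNIV V" by auto
    qed
    then show ?thesis using V(3) by blast
  qed
  then show ?R using sub by blast
next
  assume R: ?R
  show ?L
    unfolding dotted_Cantor_space_eq_product openin_product_topology_alt
  proof
    fix x assume x: "x \<in> U"
    then obtain N where N: "cylinder n r N x \<subseteq> U" using R by blast
    have xL: "x i \<in> dotted_letters n r i" for i
      using R x in_dotted_Cantor_iff by blast
    define V where "V i = (if i < N then {x i} else dotted_letters n r i)" for i
    have "finite {i \<in> UNIV. V i \<noteq> topspace (discrete_topology (dotted_letters n r i))}"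
      by (rule finite_subset[of _ "{..<N}"]) (auto simp: V_def split: if_splits)
    moreover have "\<forall>i. openin (discrete_topology (dotted_letters n r i)) (V i)"
      using xL by (auto simp: V_def)
    moreover have "x \<in> Pi\<^sub>E UNIV V" using xL by (auto simp: V_def)
    moreover have "Pi\<^sub>E UNIV V \<subseteq> cylinder n r N x"
    proof
      fix y assume y: "y \<in> Pi\<^sub>E UNIV V"
      have "y i \<in> dotted_letters n r i" "i < N \<Longrightarrow> y i = x i" for i
      proof -
        have "y i \<in> V i" using y by blast
        then show "y i \<in> dotted_letters n r i" "i < N \<Longrightarrow> y i = x i"
          using xL[of i] by (auto simp: V_def split: if_splits)
      qed
      then show "y \<in> cylinder n r N x" unfolding cylinder_def in_dotted_Cantor_iff by blast
    qed
    ultimately show "\<exists>V. finite {i \<in> UNIV. V i \<noteq> topspace (discrete_topology (dotted_letters n r i))} \<and>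
        (\<forall>i\<in>UNIV. openin (discrete_topology (dotted_letters n r i)) (V i)) \<and>
        x \<in> Pi\<^sub>E UNIV V \<and> Pi\<^sub>E UNIV V \<subseteq> U"
      using N by blast
  qed
qed

lemma openin_cylinder: "openin (dotted_Cantor_space n r) (cylinder n r N x)"
  unfolding openin_dotted_Cantor_space_iff
proof (intro conjI ballI)
  fix y assume "y \<in> cylinder n r N x"
  then have "cylinder n r N y \<subseteq> cylinder n r N x" by (auto simp: cylinder_def)
  then show "\<exists>M. cylinder n r M y \<subseteq> cylinder n r N x" by blast
qed (auto simp: cylinder_def)

text \<open>The forward direction is the Heine-Cantor argument. No radius has to be halved: a point
  that agrees with a member of a cylinder on the prefix defining it lies in the same cylinder, so a
  common bound of the \<open>N z\<close> over a finite subcover works.\<close>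

lemma continuous_map_iff_uniformly_determined:
  "continuous_map (dotted_Cantor_space n r) (dotted_Cantor_space n r) h \<longleftrightarrow>
     h \<in> dotted_Cantor n r \<rightarrow> dotted_Cantor n r \<and> uniformly_determined n r h" (is "?L \<longleftrightarrow> ?R")
proof
  assume L: ?L
  have maps: "h \<in> dotted_Cantor n r \<rightarrow> dotted_Cantor n r"
    using L by (simp add: continuous_map_def topspace_dotted_Cantor_space)
  have "\<exists>N. \<forall>x\<in>dotted_Cantor n r. \<forall>y\<in>dotted_Cantor n r.
     (\<forall>i<N. x i = y i) \<longrightarrow> (\<forall>i<j. h x i = h y i)" for j
  proof -
    have "\<exists>N. cylinder n r N x \<subseteq> {y \<in> dotted_Cantor n r. h y \<in> cylinder n r j (h x)}"
      if x: "x \<in> dotted_Cantor n r" for x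
    proof -
      have "openin (dotted_Cantor_space n r) {y \<in> dotted_Cantor n r. h y \<in> cylinder n r j (h x)}"
        using openin_continuous_map_preimage[OF L openin_cylinder]
        by (simp add: topspace_dotted_Cantor_space)
      moreover have "h x \<in> cylinder n r j (h x)"
        using maps x by (auto simp: cylinder_def)
      ultimately show ?thesis
        using x unfolding openin_dotted_Cantor_space_iff by blast
    qed
    then obtain N where N: "\<And>x. x \<in> dotted_Cantor n r \<Longrightarrow>
        cylinder n r (N x) x \<subseteq> {y \<in> dotted_Cantor n r. h y \<in> cylinder n r j (h x)}"
      by metis
    define \<U> where "\<U> = (\<lambda>x. cylinder n r (N x) x) ` dotted_Cantor n r"
    have "dotted_Cantor n r \<subseteq> \<Union>\<U>"
      by (auto simp: \<U>_def cylinder_def)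
    moreover have "\<forall>U\<in>\<U>. openin (dotted_Cantor_space n r) U"
      using openin_cylinder by (auto simp: \<U>_def)
    ultimately obtain \<F> where F: "finite \<F>" "\<F> \<subseteq> \<U>" "dotted_Cantor n r \<subseteq> \<Union>\<F>"
      using compact_space_dotted_Cantor_space[of n r]
      unfolding compact_space_def compactin_def topspace_dotted_Cantor_space by (elim conjE allE[of _ \<U>]) blast
    obtain Z where Z: "Z \<subseteq> dotted_Cantor n r" "finite Z" "\<F> = (\<lambda>x. cylinder n r (N x) x) ` Z"
      using finite_subset_image[OF F(1) F(2)[unfolded \<U>_def]] by blast
    obtain M where M: "\<forall>z\<in>Z. N z \<le> M"
      using finite_nat_set_iff_bounded_le[THEN iffD1, OF finite_imageI[OF Z(2), of N]] by blast
    have "h x i = h y i"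
      if "x \<in> dotted_Cantor n r" "y \<in> dotted_Cantor n r" "\<forall>i<M. x i = y i" "i < j" for x y i
    proof -
      obtain z where z: "z \<in> Z" "x \<in> cylinder n r (N z) z"
        using subsetD[OF F(3) \<open>x \<in> dotted_Cantor n r\<close>] unfolding Z(3) by blast
      then have "y \<in> cylinder n r (N z) z"
        using that M by (auto simp: cylinder_def)
      then have "h x \<in> cylinder n r j (h z)" "h y \<in> cylinder n r j (h z)"
        using N[of z] z Z(1) by auto
      then show ?thesis using that(4) by (simp add: cylinder_def)
    qed
    then show ?thesis by blast
  qed
  then show ?R using maps by (simp add: uniformly_determined_def)
next
  assume R: ?R
  then have maps: "\<And>x. x \<in> dotted_Cantor n r \<Longrightarrow> h x \<in> dotted_Cantor n r" by blast
  have "openin (dotted_Cantor_space n r) {x \<in> dotted_Cantor n r. h x \<in> U}"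
    if U: "openin (dotted_Cantor_space n r) U" for U
    unfolding openin_dotted_Cantor_space_iff
  proof (intro conjI ballI)
    fix x assume x: "x \<in> {x \<in> dotted_Cantor n r. h x \<in> U}"
    then obtain j where j: "cylinder n r j (h x) \<subseteq> U"
      using U unfolding openin_dotted_Cantor_space_iff by blast
    obtain N where "\<forall>x\<in>dotted_Cantor n r. \<forall>y\<in>dotted_Cantor n r.
        (\<forall>i<N. x i = y i) \<longrightarrow> (\<forall>i<j. h x i = h y i)"
      using R unfolding uniformly_determined_def by blast
    then have "cylinder n r N x \<subseteq> {y \<in> dotted_Cantor n r. h y \<in> cylinder n r j (h x)}"
      using x maps by (auto simp: cylinder_def)
    then show "\<exists>N. cylinder n r N x \<subseteq> {x \<in> dotted_Cantor n r. h x \<in> U}"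
      using j by blast
  qed auto
  then show ?L
    using maps by (auto simp: continuous_map_def topspace_dotted_Cantor_space)
qed

locale dotted_homeo =
  fixes n r :: nat and h g :: "(nat \<Rightarrow> letter) \<Rightarrow> nat \<Rightarrow> letter"
  assumes n2: "n \<ge> 2" and r1: "r \<ge> 1"
    and homeo: "homeomorphic_maps (dotted_Cantor_space n r) (dotted_Cantor_space n r) h g"
begin

lemma maps: "x \<in> dotted_Cantor n r \<Longrightarrow> h x \<in> dotted_Cantor n r"
  "x \<in> dotted_Cantor n r \<Longrightarrow> g x \<in> dotted_Cantor n r"
  using homeo continuous_map_iff_uniformly_determined unfolding homeomorphic_maps_def by blast+

lemma inverse: "x \<in> dotted_Cantor n r \<Longrightarrow> g (h x) = x" "x \<in> dotted_Cantor n r \<Longrightarrow> h (g x) = x"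
  using homeo by (auto simp: homeomorphic_maps_def topspace_dotted_Cantor_space)

lemma uniformly_determined: "uniformly_determined n r h" "uniformly_determined n r g"
  using homeo by (simp_all add: homeomorphic_maps_def continuous_map_iff_uniformly_determined)

lemma inj_h: "inj_on h (dotted_Cantor n r)"
  using inverse by (metis inj_onI)

text \<open>Whether \<open>y\<close> lies in the image of a cone is decided by a prefix of \<open>y\<close>, as \<open>g\<close> is uniformly
  continuous; the words of that length give the partition.\<close>

lemma cone_partition_image:
  assumes u: "u \<in> dotted_words n r"
  shows "\<exists>V. cone_partition n V (h ` cone n u) \<and> (\<forall>v\<in>V. v \<in> dotted_words n r \<and> M \<le> length v)"
proof -
  obtain N where N: "\<forall>x\<in>dotted_Cantor n r. \<forall>y\<in>dotted_Cantor n r.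
        (\<forall>i<N. x i = y i) \<longrightarrow> (\<forall>i<length u. g x i = g y i)"
    using uniformly_determined(2) unfolding uniformly_determined_def by blast
  \<comment> \<open>\<open>N\<close> makes membership in the image depend on the prefix,
    \<open>M\<close> is the length asked for, and \<open>Suc\<close> keeps the prefix nonempty, so
    that it begins with a dotted letter.\<close>
  define L where "L = Suc (max N M)"
  have "N \<le> L" by (simp add: L_def)
  define V where "V = {w \<in> dotted_words n r. length w = L \<and> cone n w \<subseteq> h ` cone n u}"
  have in_image: "y \<in> h ` cone n u \<longleftrightarrow> g y \<in> cone n u" if "y \<in> dotted_Cantor n r" for y
    using that inverse maps cone_subset_dotted_Cantor[OF u] by (metis image_iff subsetD)
  have in_cone_u: "z \<in> cone n u \<longleftrightarrow> is_prefix u z" if "z \<in> dotted_Cantor n r" for z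
    using that suffix_in_Cantor_of_dotted dotted_words_nonempty[OF u] by (simp add: in_cone_iff)
  have "y \<in> (\<Union>v\<in>V. cone n v)" if y: "y \<in> h ` cone n u" for y
  proof -
    have yd: "y \<in> dotted_Cantor n r"
      using y maps cone_subset_dotted_Cantor[OF u] by blast
    define w where "w = Omega_Words_Fun.prefix L y"
    have w: "w \<in> dotted_words n r" using prefix_in_dotted_words[OF yd, of L] unfolding w_def L_def by blast
    have "z \<in> h ` cone n u" if z: "z \<in> cone n w" for z
    proof -
      have zd: "z \<in> dotted_Cantor n r" using z cone_subset_dotted_Cantor[OF w] by blast
      have "is_prefix w z" "length w = L" using z by (simp_all add: in_cone_iff w_def)
      then have "\<forall>i<N. z i = y i"
        using is_prefix_nth[of w z] \<open>N \<le> L\<close> by (simp add: w_def)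
      then have "\<forall>i<length u. g z i = g y i"
        using N zd yd by blast
      moreover have "is_prefix u (g y)" using y in_image in_cone_u yd maps by blast
      ultimately have "is_prefix u (g z)"
        using is_prefix_nth[of u "g y"] by (intro is_prefixI) simp
      then show ?thesis using in_image in_cone_u zd maps by blast
    qed
    then have "w \<in> V" using w by (auto simp: V_def w_def)
    moreover have "y \<in> cone n w"
      using suffix_in_Cantor_of_dotted[OF yd, of L] by (simp add: in_cone_iff w_def is_prefix_def L_def)
    ultimately show ?thesis by blast
  qed
  then have "(\<Union>v\<in>V. cone n v) = h ` cone n u" by (auto simp: V_def)
  moreover have "finite V"
  proof (rule finite_subset)
    show "V \<subseteq> {w. set w \<subseteq> dotted_alphabet r \<union> alphabet n \<and> length w = L}"
      by (auto simp: V_def dotted_words_def)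
    show "finite {w. set w \<subseteq> dotted_alphabet r \<union> alphabet n \<and> length w = L}"
      by (intro finite_lists_length_eq) (simp add: finite_alphabet dotted_alphabet_def)
  qed
  moreover have "disjoint_family_on (cone n) V"
    unfolding disjoint_family_on_def V_def using cones_same_length_disjoint by auto
  ultimately have "cone_partition n V (h ` cone n u)" by (simp add: cone_partition_def)
  then show ?thesis by (intro exI[of _ V]) (auto simp: V_def L_def)
qed

end


section \<open>The minimal transducer of a homeomorphism\<close>

locale homeo_transducer = dotted_homeo n r h g + dotted_transducer n r A q0 R S
  for n r :: nat and h g and A :: "'q transducer" and q0 R S +
  assumes minimal: "minimal n A q0"
    and represents: "\<And>x. x \<in> dotted_Cantor n r \<Longrightarrow> out_inf A x q0 = h x"
begin

lemma h_conc:
  assumes "w \<in> dotted_words n r" "x \<in> Cantor n"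
  shows "h (w \<frown> x) = out_word A w q0 \<frown> out_inf A x (state_after A w q0)"
  using assms out_inf_q0[OF assms] represents conc_in_dotted_Cantor_iff dotted_words_nonempty by metis

lemma image_cone:
  assumes "w \<in> dotted_words n r"
  shows "h ` cone n w = (\<lambda>x. out_word A w q0 \<frown> x) ` state_image n A (state_after A w q0)"
proof -
  have "cone n w = (\<lambda>x. w \<frown> x) ` Cantor n" by (auto simp: cone_def)
  then show ?thesis
    using h_conc[OF assms] by (auto simp: state_image_def image_image)
qed

text \<open>Minimality constrains the output of single letters only. The output on the word without
  its last letter is common to the whole image and can be cancelled, so the condition at the last
  letter yields the claim for the word. In particular the output on \<open>w\<close> depends on
  \<open>h\<close> alone.\<close>

lemma out_word_greatest_common_prefix:
  assumes w: "w \<in> dotted_words n r"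
  shows "is_greatest_common_prefix (out_word A w q0) (h ` cone n w)"
proof -
  obtain u i where ui: "w = u @ [i]"
    using dotted_words_nonempty[OF w] by (metis rev_exhaust)
  define q where "q = state_after A u q0"
  have q: "q \<in> states A" "i \<in> readable A q"
  proof -
    show "q \<in> states A" "i \<in> readable A q"
    proof (atomize (full), cases "u = []")
      case True
      then show "q \<in> states A \<and> i \<in> readable A q"
        using w ui q0_state readable_q0 by (auto simp: q_def Cons_in_dotted_words_iff)
    next
      case False
      then have "u \<in> dotted_words n r" "i \<in> alphabet n"
        using w ui append_in_dotted_words_iff by auto
      then show "q \<in> states A \<and> i \<in> readable A q"
        using state_after_q0[of u] readable_other by (auto simp: q_def)
    qed
  qed
  let ?S = "{out_inf A ([i] \<frown> x) q | x. x \<in> Cantor n}"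
  have gcp: "is_greatest_common_prefix (out A i q) ?S"
    using minimal q unfolding minimal_def by blast
  have eq: "h (w \<frown> x) = out_word A u q0 \<frown> out_inf A ([i] \<frown> x) q" if x: "x \<in> Cantor n" for x
  proof -
    have "out_inf A ([i] \<frown> x) q = out A i q \<frown> out_inf A x (state_after A w q0)"
    proof -
      have "has_infinite_output A x (state_after A w q0)"
        using infinite_output infinite_inputs_other state_after_q0[OF w] x by simp
      then show ?thesis
        using out_inf_conc[of A x "[i]" q] by (simp add: ui q_def state_after_append)
    qed
    then show ?thesis
      using h_conc[OF w x] by (simp add: ui q_def out_word_append)
  qed
  have "cone n w = (\<lambda>x. w \<frown> x) ` Cantor n" by (auto simp: cone_def)
  then have "h ` cone n w = (\<lambda>x. out_word A u q0 \<frown> x) ` ?S"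
    using eq by (auto simp: image_image Setcompr_eq_image)
  moreover have "out_word A w q0 = out_word A u q0 @ out A i q"
    by (simp add: ui q_def out_word_append)
  moreover have "?S \<noteq> {}" using Cantor_nonempty[OF n_pos] by blast
  ultimately show ?thesis
    using greatest_common_prefix_conc_iff[of ?S] gcp by simp
qed

lemma reachable:
  assumes "q \<in> states A" "q \<noteq> q0"
  obtains w where "w \<in> dotted_words n r" "state_after A w q0 = q"
proof -
  obtain w where "w \<in> input_words n A q0" "state_after A w q0 = q"
    using minimal assms unfolding minimal_def by blast
  then show thesis
    using that assms(2) input_words_q0 by (cases "w = []") auto
qed

lemma states_eqI:
  assumes "p \<in> states A" "q \<in> states A" "p \<noteq> q0" "q \<noteq> q0"
    "\<And>x. x \<in> Cantor n \<Longrightarrow> out_inf A x p = out_inf A x q"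
  shows "p = q"
  using minimal assms infinite_inputs_other[of p] infinite_inputs_other[of q]
  unfolding minimal_def by simp

end

text \<open>The local maps of \<open>h\<close> are determined by \<open>h\<close>, since \<open>out_word\<close> is a greatest common prefix;
  hence two minimal transducers of \<open>h\<close> identify the same pairs of words.\<close>

lemma synchronizing_at_transfer:
  assumes "homeo_transducer n r h g A q0 R S" and "homeo_transducer n r h g A' q0' R' S'"
    and sync: "synchronizing_at n A' k"
  shows "synchronizing_at n A k"
proof -
  interpret A: homeo_transducer n r h g A q0 R S by fact
  interpret A': homeo_transducer n r h g A' q0' R' S' by fact
  have k: "k > 0" using A'.synchronizing_level_pos[OF sync] .
  have same: "state_after A u q0 = state_after A v q0"
    if uv: "u \<in> dotted_words n r" "v \<in> dotted_words n r"
      and eq: "state_after A' u q0' = state_after A' v q0'" for u v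
  proof (rule A.states_eqI)
    show "state_after A u q0 \<in> states A" "state_after A u q0 \<noteq> q0"
      "state_after A v q0 \<in> states A" "state_after A v q0 \<noteq> q0"
      using A.state_after_q0 uv by auto
    fix x assume x: "x \<in> Cantor n"
    have local: "out_inf A x (state_after A w q0) = out_inf A' x (state_after A' w q0')"
      if w: "w \<in> dotted_words n r" for w
    proof -
      have "out_word A w q0 = out_word A' w q0'"
        using A.out_word_greatest_common_prefix[OF w] A'.out_word_greatest_common_prefix[OF w]
          greatest_common_prefix_unique cone_nonempty[OF A.n_pos] by blast
      then show ?thesis
        using A.h_conc[OF w x] A'.h_conc[OF w x] by simp
    qed
    show "out_inf A x (state_after A u q0) = out_inf A x (state_after A v q0)"
      using local uv eq by simp
  qed
  show ?thesis
    unfolding synchronizing_at_def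
  proof (intro ballI impI)
    fix p q w
    assume pq: "p \<in> states A" "q \<in> states A" and w: "w \<in> input_words n A p \<inter> input_words n A q"
      and l: "length w = k"
    have "w \<noteq> []" using l k by auto
    then obtain a w' where a: "w = a # w'" by (cases w) auto
    have ap: "a \<in> readable A p" "a \<in> readable A q"
      using w a by (auto simp: input_words_def)
    show "state_after A w p = state_after A w q"
    proof (cases "p = q0 \<or> q = q0")
      case True
      \<comment> \<open>The common first letter of \<open>w\<close> tells whether a state is
        \<open>q0\<close>: only \<open>q0\<close> reads dotted letters.\<close>
      then have "p = q"
        using ap pq A.readable_q0 A.readable_other alphabet_disjoint_dotted by (metis IntI empty_iff)
      then show ?thesis by simp
    next
      case False
      then obtain u v where u: "u \<in> dotted_words n r" "state_after A u q0 = p"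
        and v: "v \<in> dotted_words n r" "state_after A v q0 = q"
        using A.reachable pq by metis
      have wl: "w \<in> lists (alphabet n)"
        using w A.input_words_other pq False by auto
      let ?p = "state_after A' u q0'" and ?q = "state_after A' v q0'"
      have "?p \<in> states A'" "?q \<in> states A'" "w \<in> input_words n A' ?p \<inter> input_words n A' ?q"
        using A'.state_after_q0 u v A'.input_words_other wl by auto
      then have "state_after A' (u @ w) q0' = state_after A' (v @ w) q0'"
        using synchronizing_atD[OF sync, of ?p ?q w] l by (simp add: state_after_append)
      moreover have "u @ w \<in> dotted_words n r" "v @ w \<in> dotted_words n r"
        using u v wl append_in_dotted_words by blast+
      ultimately have "state_after A (u @ w) q0 = state_after A (v @ w) q0"
        using same by blast
      then show ?thesis
        using u v by (simp add: state_after_append)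
    qed
  qed
qed

section \<open>The signature of the core as a scaling factor of the measure\<close>

lemma cone_number_measure:
  assumes V: "V \<subseteq> lists (alphabet n)" "finite V" "(\<Union>v\<in>V. cone n v) = state_image n T q"
  shows "has_cone_measure n (state_image n T q) (int (cone_number n T q))"
proof -
  let ?P = "\<lambda>m. \<exists>V\<subseteq>lists (alphabet n). finite V \<and> card V = m \<and> (\<Union>v\<in>V. cone n v) = state_image n T q"
  \<comment> \<open>The given cover guarantees that the \<open>LEAST\<close> in
    \<open>cone_number\<close> is attained.\<close>
  have "?P (card V)" using V by blast
  then have "?P (cone_number n T q)" unfolding cone_number_def by (rule LeastI)
  then obtain W where W: "W \<subseteq> lists (alphabet n)" "finite W" "card W = cone_number n T q"
      "(\<Union>v\<in>W. cone n v) = state_image n T q" by blast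
  have least: "card W \<le> card U"
    if "U \<subseteq> lists (alphabet n)" "finite U" "(\<Union>v\<in>U. cone n v) = state_image n T q" for U
    unfolding W(3) cone_number_def using that by (intro Least_le) blast
  \<comment> \<open>Intersecting cones are nested, and the smaller one could be dropped from the
    cover, contradicting that \<open>W\<close> has the least size. Hence a smallest cover is a
    partition.\<close>
  have no_nesting: False
    if uv: "u \<in> W" "v \<in> W" "u \<noteq> v" "length u \<le> length v" "x \<in> cone n u" "x \<in> cone n v" for u v x
  proof -
    have "v = u @ drop (length u) v"
      using uv by (intro is_prefix_take[of u x]) (auto simp: in_cone_iff)
    moreover have "drop (length u) v \<in> lists (alphabet n)"
      using uv W(1) by (auto dest: in_set_dropD)
    ultimately have "cone n v \<subseteq> cone n u"
      using cone_append_subset by metis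
    then have "(\<Union>v\<in>W - {v}. cone n v) = (\<Union>v\<in>W. cone n v)"
      using uv by blast
    then have "card W \<le> card (W - {v})"
      using W by (intro least) auto
    then show False
      using card_Diff1_less[OF W(2) uv(2)] by simp
  qed
  have "disjoint_family_on (cone n) W"
    unfolding disjoint_family_on_def using no_nesting by (metis disjoint_iff nat_le_linear)
  then have "cone_partition n W (state_image n T q)"
    using W by (simp add: cone_partition_def)
  then show ?thesis
    using has_cone_measure_partition W(3) by metis
qed

locale synchronizing_homeo_transducer = homeo_transducer +
  assumes synchronizing: "synchronizing n A"
begin

definition "K = sync_level n A"
definition "T = core n A"

lemma synchronizing_at_K: "synchronizing_at n A K"
  using synchronizing unfolding synchronizing_def K_def sync_level_def by (auto intro: LeastI)

lemma K_pos: "K > 0"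
  using synchronizing_level_pos[OF synchronizing_at_K] .

lemma states_T: "states T = forced_states n A K"
  by (simp add: T_def core_def Let_def K_def)

lemma state_after_forced:
  assumes "p \<in> states A" "q \<in> states A" "p \<noteq> q0" "q \<noteq> q0" "w \<in> lists (alphabet n)" "length w = K"
  shows "state_after A w p = state_after A w q"
  using assms input_words_other by (intro synchronizing_atD[OF synchronizing_at_K]) auto

text \<open>Forcing words are plain, while words read from \<open>q0\<close> start with a dotted
  letter. A word longer than \<open>K\<close> therefore ends in \<open>K\<close> plain letters, and
  these force the state it reaches.\<close>

lemma states_T_iff:
  "p \<in> states T \<longleftrightarrow> (\<exists>u\<in>dotted_words n r. K < length u \<and> state_after A u q0 = p)"
proof
  assume "p \<in> states T"
  then obtain w q where w: "p = state_after A w q" "q \<in> states A" "w \<in> lists (alphabet n)"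
      "length w = K" "w \<in> input_words n A q"
    unfolding states_T forced_states_def words_of_length_def by blast
  have "q \<noteq> q0"
  proof
    assume "q = q0"
    then have "w \<in> dotted_words n r" using w K_pos input_words_q0 by auto
    then have "w ! 0 \<in> dotted_alphabet r" by (auto simp: dotted_words_def)
    moreover have "w ! 0 \<in> alphabet n" using w K_pos by auto
    ultimately show False using alphabet_disjoint_dotted by blast
  qed
  then obtain u where u: "u \<in> dotted_words n r" "state_after A u q0 = q"
    using reachable w(2) by metis
  then have "u @ w \<in> dotted_words n r" "K < length (u @ w)" "state_after A (u @ w) q0 = p"
    using w append_in_dotted_words[OF u(1)] dotted_words_nonempty[OF u(1)]
    by (auto simp: state_after_append)
  then show "\<exists>u\<in>dotted_words n r. K < length u \<and> state_after A u q0 = p" by blast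
next
  assume "\<exists>u\<in>dotted_words n r. K < length u \<and> state_after A u q0 = p"
  then obtain u where u: "u \<in> dotted_words n r" "K < length u" "state_after A u q0 = p" by blast
  define v w where "v = take (length u - K) u" and "w = drop (length u - K) u"
  have vw: "u = v @ w" "length w = K" "v \<noteq> []" using u by (auto simp: v_def w_def)
  then have v: "v \<in> dotted_words n r" and w: "w \<in> lists (alphabet n)"
    using u(1) append_in_dotted_words_iff by metis+
  let ?q = "state_after A v q0"
  have q: "?q \<in> states A" "?q \<noteq> q0" using state_after_q0[OF v] by auto
  have "w \<in> words_of_length n K \<inter> input_words n A ?q"
    using w vw input_words_other[OF q] by (simp add: words_of_length_def)
  moreover have "p = state_after A w ?q"
    using u vw by (simp add: state_after_append)
  ultimately show "p \<in> states T"
    unfolding states_T forced_states_def using q by blast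
qed

lemma states_T_subset: "p \<in> states T \<Longrightarrow> p \<in> states A \<and> p \<noteq> q0"
  using states_T_iff state_after_q0 by auto

lemma state_after_in_T:
  assumes "p \<in> states T" "v \<in> lists (alphabet n)"
  shows "state_after A v p \<in> states T"
proof -
  obtain u where u: "u \<in> dotted_words n r" "K < length u" "state_after A u q0 = p"
    using assms states_T_iff by blast
  then have "u @ v \<in> dotted_words n r" "K < length (u @ v)" "state_after A (u @ v) q0 = state_after A v p"
    using assms append_in_dotted_words[OF u(1)] by (auto simp: state_after_append)
  then show ?thesis using states_T_iff by blast
qed

text \<open>A forced state lies on a cycle, labelled by a word that forces it.\<close>

lemma states_T_subset_S: "p \<in> states T \<Longrightarrow> p \<in> S"
proof (rule ccontr)
  assume p: "p \<in> states T" "p \<notin> S"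
  then have pA: "p \<in> states A" "p \<noteq> q0" and pR: "p \<in> R"
    using states_T_subset states_eq by auto
  obtain w q where w: "p = state_after A w q" "q \<in> states A" "w \<in> lists (alphabet n)"
      "length w = K" "w \<in> input_words n A q"
    using p unfolding states_T forced_states_def words_of_length_def by blast
  have wp: "w \<in> input_words n A p" using input_words_other[OF pA] w(3) by simp
  then have "state_after A w p = p"
    using synchronizing_atD[OF synchronizing_at_K pA(1) w(2) wp w(5,4)] w(1) by simp
  moreover have "w \<noteq> []"
    using w(4) K_pos by (metis length_greater_0_conv)
  ultimately show False
    using no_cycle[OF pR wp] by blast
qed

lemma core_step:
  assumes "p \<in> states T" "i \<in> alphabet n"
  shows "transition T i p = transition A i p" "out T i p = out A i p"
  using assms unfolding states_T by (simp_all add: T_def core_def Let_def K_def)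

lemma core_word:
  assumes "p \<in> states T" "v \<in> lists (alphabet n)"
  shows "state_after T v p = state_after A v p \<and> out_word T v p = out_word A v p"
  using assms
proof (induction v arbitrary: p)
  case (Cons i v)
  moreover have "transition A i p \<in> states T"
    using state_after_in_T[of p "[i]"] Cons.prems by simp
  ultimately show ?case by (simp add: core_step)
qed auto

lemma readable_T: "readable T p = alphabet n"
  by (simp add: T_def core_def Let_def)

lemma input_words_T: "input_words n T p = lists (alphabet n)"
proof -
  have "w \<in> insert [] {i # w | i w. i \<in> alphabet n \<and> w \<in> lists (alphabet n)} \<longleftrightarrow> w \<in> lists (alphabet n)"
    for w by (cases w) auto
  then show ?thesis unfolding input_words_def readable_T by blast
qed

lemma state_image_T:
  assumes "p \<in> states T"
  shows "state_image n T p = state_image n A p"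
proof -
  have "out_inf T x p = out_inf A x p" if "x \<in> Cantor n" for x
    using core_word[OF assms prefix_in_lists[OF that]] by (simp add: out_inf_def)
  then show ?thesis by (auto simp: state_image_def)
qed

text \<open>Synchronization at \<open>K\<close> passes to the core, so the core has a least level of
  its own. That level may be smaller than \<open>K\<close>, and it is the one over which the
  signature sums.\<close>

lemma synchronizing_at_core: "synchronizing_at n T (sync_level n T)"
proof -
  have "synchronizing_at n T K"
    unfolding synchronizing_at_def
  proof (intro ballI impI)
    fix p q w
    assume "p \<in> states T" "q \<in> states T" "w \<in> input_words n T p \<inter> input_words n T q" "length w = K"
    then show "state_after T w p = state_after T w q"
      using core_word state_after_forced states_T_subset input_words_T by auto
  qed
  then show ?thesis unfolding sync_level_def by (rule LeastI)
qed

text \<open>Synchronization of the core resolves the \<open>THE\<close>: the word leads to the same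
  state from everywhere, so the forced state can be computed from any core state \<open>p\<close>,
  and within \<open>A\<close>, since runs of the core are runs of \<open>A\<close>.\<close>

lemma forced_state_core:
  assumes "p \<in> states T" "w \<in> words_of_length n (sync_level n T)"
  shows "forced_state n T w = state_after A w p"
  unfolding forced_state_def
proof (rule the_equality)
  have w: "w \<in> lists (alphabet n)" "length w = sync_level n T"
    using assms by (auto simp: words_of_length_def)
  show "\<exists>q\<in>states T. w \<in> input_words n T q \<and> state_after T w q = state_after A w p"
    using assms(1) w core_word input_words_T by auto
  fix p' assume "\<exists>q\<in>states T. w \<in> input_words n T q \<and> state_after T w q = p'"
  then obtain q where q: "q \<in> states T" "state_after T w q = p'" by blast
  then have "state_after T w q = state_after T w p"
    using assms(1) w input_words_T by (intro synchronizing_atD[OF synchronizing_at_core]) auto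
  then show "p' = state_after A w p" using q core_word assms(1) w by simp
qed

text \<open>The point is that the image of \<open>p\<close> is a finite union of cones at all. It is
  visible inside \<open>h\<close>: on the cone of a long word \<open>u\<close> leading to
  \<open>p\<close>, the map \<open>h\<close> writes \<open>v\<close> and then continues as the map
  of \<open>p\<close>.\<close>

lemma measure_state_image:
  assumes "p \<in> states T"
  shows "has_cone_measure n (state_image n T p) (int (cone_number n T p))"
proof -
  obtain u where u: "u \<in> dotted_words n r" "K < length u" "state_after A u q0 = p"
    using assms states_T_iff by blast
  define v where "v = out_word A u q0"
  have "p \<in> S" using states_T_subset_S assms .
  then have v: "v \<in> dotted_words n r"
    using out_word_R[OF q0_R, of u] u RS_disjoint input_words_q0 by (auto simp: v_def split: if_splits)
  \<comment> \<open>The length bound forces all words of the partition to extend \<open>v\<close>,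
    so that \<open>v\<close> can be cut off; the remainders are plain because \<open>v\<close>
    already carries the dotted letter.\<close>
  obtain V where V: "cone_partition n V (h ` cone n u)"
      "\<forall>w\<in>V. w \<in> dotted_words n r \<and> length v \<le> length w"
    using cone_partition_image[OF u(1), of "length v"] by blast
  have image: "h ` cone n u = (\<lambda>x. v \<frown> x) ` state_image n A p"
    using image_cone[OF u(1)] u(3) by (simp add: v_def)
  have split: "w = v @ drop (length v) w \<and> drop (length v) w \<in> lists (alphabet n)" if w: "w \<in> V" for w
  proof -
    obtain x where x: "x \<in> Cantor n" using Cantor_nonempty n_pos by blast
    then have "w \<frown> x \<in> cone n w" by (auto simp: cone_def)
    then have "w \<frown> x \<in> (\<lambda>x. v \<frown> x) ` state_image n A p"
      using V(1) w image unfolding cone_partition_def by blast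
    then have "is_prefix v (w \<frown> x)" by auto
    then have "w = v @ drop (length v) w"
      using V(2) w by (intro is_prefix_take[of v "w \<frown> x"]) auto
    then show ?thesis
      using V(2) w append_in_dotted_words_iff[OF dotted_words_nonempty[OF v]] by metis
  qed
  have "(\<Union>w\<in>V. cone n w) = (\<lambda>x. v \<frown> x) ` (\<Union>w\<in>drop (length v) ` V. cone n w)"
  proof -
    have "cone n w = (\<lambda>x. v \<frown> x) ` cone n (drop (length v) w)" if "w \<in> V" for w
      using split[OF that] by (metis conc_image_cone)
    then show ?thesis by (simp add: image_UN)
  qed
  then have "(\<lambda>x. v \<frown> x) ` (\<Union>w\<in>drop (length v) ` V. cone n w) = (\<lambda>x. v \<frown> x) ` state_image n A p"
    using V(1) image by (simp add: cone_partition_def)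
  moreover have "inj (\<lambda>x. v \<frown> x)" by (simp add: inj_on_def)
  ultimately have "(\<Union>w\<in>drop (length v) ` V. cone n w) = state_image n T p"
    unfolding state_image_T[OF assms] by (simp add: inj_image_eq_iff)
  moreover have "drop (length v) ` V \<subseteq> lists (alphabet n)" using split by blast
  moreover have "finite (drop (length v) ` V)" using V(1) by (simp add: cone_partition_def)
  ultimately show ?thesis by (intro cone_number_measure)
qed

lemma disjoint_image_extensions:
  assumes "u \<in> dotted_words n r"
  shows "disjoint_family_on (\<lambda>t. h ` cone n (u @ t)) (words_of_length n k)"
  unfolding disjoint_family_on_def
proof (intro ballI impI)
  fix s t assume st: "s \<in> words_of_length n k" "t \<in> words_of_length n k" "s \<noteq> t"
  then have "u @ s \<in> dotted_words n r" "u @ t \<in> dotted_words n r"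
    using append_in_dotted_words[OF assms] by (auto simp: words_of_length_def)
  moreover have "cone n (u @ s) \<inter> cone n (u @ t) = {}"
    using st by (intro cones_same_length_disjoint) (auto simp: words_of_length_def)
  ultimately show "h ` cone n (u @ s) \<inter> h ` cone n (u @ t) = {}"
    using cone_subset_dotted_Cantor inj_on_image_Int[OF inj_h] by (metis image_empty)
qed

lemma image_extensions: "h ` cone n u = (\<Union>t\<in>words_of_length n k. h ` cone n (u @ t))"
  by (metis cone_UN_extensions image_UN)

lemma measure_image_cone:
  assumes u: "u \<in> dotted_words n r"
  shows "has_cone_measure n (h ` cone n u) (int (signature n T))"
proof -
  have ext: "u @ t \<in> dotted_words n r" if "u \<in> dotted_words n r" "t \<in> words_of_length n k" for u t k
    using append_in_dotted_words[OF that(1)] that(2) by (auto simp: words_of_length_def)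
  have long: "has_cone_measure n (h ` cone n u) (int (signature n T))"
    if u: "u \<in> dotted_words n r" and l: "K < length u" for u
  proof -
    let ?W = "words_of_length n (sync_level n T)"
    let ?p = "state_after A u q0"
    have p: "?p \<in> states T" using states_T_iff u l by blast
    have "has_cone_measure n (h ` cone n (u @ t)) (int (cone_number n T (forced_state n T t)))"
      if t: "t \<in> ?W" for t
    proof -
      have q: "state_after A t ?p \<in> states T"
        using state_after_in_T[OF p] t by (auto simp: words_of_length_def)
      have "h ` cone n (u @ t) = (\<lambda>x. out_word A (u @ t) q0 \<frown> x) ` state_image n T (state_after A t ?p)"
        using image_cone[OF ext[OF u t]] state_image_T[OF q] by (simp add: state_after_append)
      then show ?thesis
        using has_cone_measure_conc[OF measure_state_image[OF q]] forced_state_core[OF p t] by metis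
    qed
    then have "has_cone_measure n (\<Union>t\<in>?W. h ` cone n (u @ t))
        (\<Sum>t\<in>?W. int (cone_number n T (forced_state n T t)))"
      by (intro has_cone_measure_UN finite_words_of_length disjoint_image_extensions u n_pos)
    then show ?thesis
      using image_extensions[of u] by (simp add: signature_def)
  qed
  \<comment> \<open>For a short \<open>u\<close> the state reached may lie outside the core. Its
    cone is divided into \<open>n ^ K\<close> cones of words longer than \<open>K\<close>, as
    \<open>u\<close> is nonempty, and \<open>n ^ K\<close> is congruent to 1.\<close>
  let ?W = "words_of_length n K"
  have "has_cone_measure n (\<Union>t\<in>?W. h ` cone n (u @ t)) (\<Sum>t\<in>?W. int (signature n T))"
    using ext[OF u] dotted_words_nonempty[OF u]
    by (intro has_cone_measure_UN finite_words_of_length disjoint_image_extensions u n_pos long)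
      (auto simp: words_of_length_def)
  then have "has_cone_measure n (h ` cone n u) (int n ^ K * int (signature n T))"
    using image_extensions[of u K] by (simp add: card_words_of_length)
  moreover have "[int n ^ K * int (signature n T) = 1 ^ K * int (signature n T)] (mod (int n - 1))"
    by (intro cong_mult cong_pow cong_refl) (simp add: cong_iff_dvd_diff)
  ultimately show ?thesis
    using has_cone_measure_cong by fastforce
qed

lemma measure_image:
  assumes C: "C \<subseteq> dotted_Cantor n r" "has_cone_measure n C c"
  shows "has_cone_measure n (h ` C) (int (signature n T) * c)"
proof -
  obtain V where V: "cone_partition n V C" "[int (card V) = c] (mod (int n - 1))"
    using C by (auto simp: has_cone_measure_def)
  have dotted: "v \<in> dotted_words n r" if "v \<in> V" for v
    using that V(1) C(1) n_pos by (intro dotted_words_if_cone_subset) (auto simp: cone_partition_def)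
  have "disjoint_family_on (\<lambda>v. h ` cone n v) V"
    unfolding disjoint_family_on_def
  proof (intro ballI impI)
    fix u v assume uv: "u \<in> V" "v \<in> V" "u \<noteq> v"
    then have "cone n u \<inter> cone n v = {}"
      using V(1) by (simp add: cone_partition_def disjoint_family_on_def)
    then show "h ` cone n u \<inter> h ` cone n v = {}"
      using cone_subset_dotted_Cantor[OF dotted] uv inj_on_image_Int[OF inj_h] by (metis image_empty)
  qed
  then have "has_cone_measure n (\<Union>v\<in>V. h ` cone n v) (\<Sum>v\<in>V. int (signature n T))"
    using V(1) dotted measure_image_cone n_pos by (intro has_cone_measure_UN) (auto simp: cone_partition_def)
  then have "has_cone_measure n (h ` C) (int (card V) * int (signature n T))"
    using V(1) by (simp add: cone_partition_def flip: image_UN)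
  moreover have "[int (card V) * int (signature n T) = c * int (signature n T)] (mod (int n - 1))"
    using V(2) by (intro cong_mult cong_refl)
  ultimately show ?thesis
    using has_cone_measure_cong by (metis mult.commute)
qed

end

text \<open>\<open>SOME\<close> may pick the core of any minimal transducer of \<open>h\<close>, not only of the finite
  synchronizing one that membership in \<open>B n r\<close> provides.\<close>

lemma reduced_signature_scales_measure:
  assumes h: "h \<in> B n r" and n: "n \<ge> 2" and r: "r \<ge> 1"
  obtains s where "reduced_signature n (Core n r h) = ZMod (int n - 1) s"
    "\<And>C c. C \<subseteq> dotted_Cantor n r \<Longrightarrow> has_cone_measure n C c \<Longrightarrow> has_cone_measure n (h ` C) (s * c)"
proof -
  obtain g where g: "homeomorphic_maps (dotted_Cantor_space n r) (dotted_Cantor_space n r) h g"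
    and h': "has_finite_sync_minimal_transducer n r h"
    using h unfolding B_def by blast
  obtain A' :: "nat transducer" and q0' where A': "minimal_dotted_transducer_of n r h A' q0'" "synchronizing n A'"
    using h' unfolding has_finite_sync_minimal_transducer_def by blast
  have ht: "\<exists>R S. homeo_transducer n r h g A q0 R S"
    if A: "minimal_dotted_transducer_of n r h A q0" for A :: "nat transducer" and q0
  proof -
    obtain R S where "dotted_transducer n r A q0 R S"
      using A n r dotted_transducer_if_over[of n r A q0] unfolding minimal_dotted_transducer_of_def by auto
    then have "homeo_transducer n r h g A q0 R S"
      using A g n r unfolding minimal_dotted_transducer_of_def
      by (intro homeo_transducer.intro homeo_transducer_axioms.intro dotted_homeo.intro) auto
    then show ?thesis by blast
  qed
  have "(SOME T. T \<in> Core n r h) \<in> Core n r h"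
    using A'(1) by (intro someI[of "\<lambda>T. T \<in> Core n r h" "core n A'"]) (auto simp: Core_def)
  then obtain A q0 where A: "(SOME T. T \<in> Core n r h) = core n A" "minimal_dotted_transducer_of n r h A q0"
    unfolding Core_def by blast
  obtain R S R' S' where RS: "homeo_transducer n r h g A q0 R S" "homeo_transducer n r h g A' q0' R' S'"
    using ht A(2) A'(1) by blast
  then have "synchronizing n A"
    using synchronizing_at_transfer[OF RS] A'(2) unfolding synchronizing_def by blast
  then interpret synchronizing_homeo_transducer n r h g A q0 R S
    using RS(1) by (simp add: synchronizing_homeo_transducer_def synchronizing_homeo_transducer_axioms_def)
  have "reduced_signature n (Core n r h) = ZMod (int n - 1) (int (signature n T))"
    unfolding reduced_signature_def A(1) T_def ..
  then show thesis
    using measure_image by (intro that)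
qed

lemma B_inverse:
  assumes "h \<in> B n r"
  obtains g where "g \<in> B n r" "\<And>x. x \<in> dotted_Cantor n r \<Longrightarrow> g (h x) = x"
    "h \<in> dotted_Cantor n r \<rightarrow> dotted_Cantor n r"
proof -
  obtain g where g: "homeomorphic_maps (dotted_Cantor_space n r) (dotted_Cantor_space n r) h g"
    "has_finite_sync_minimal_transducer n r h" "has_finite_sync_minimal_transducer n r g"
    using assms unfolding B_def by blast
  then have "g \<in> B n r"
    unfolding B_def using homeomorphic_maps_sym by blast
  then show thesis
    using g(1) by (intro that)
      (auto simp: homeomorphic_maps_def continuous_map_def topspace_dotted_Cantor_space)
qed

section \<open>Units of the residue class ring\<close>

lemma ZMod_ring_hom:
  "ZMod k a \<in> carrier (ZFact k)" "ZMod k 1 = \<one>\<^bsub>ZFact k\<^esub>"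
  "ZMod k (a * b) = ZMod k a \<otimes>\<^bsub>ZFact k\<^esub> ZMod k b"
proof -
  interpret ideal "Idl\<^bsub>\<Z>\<^esub> {k}" \<Z>
    by (rule int.genideal_ideal) simp
  have "ZMod k = (+>\<^bsub>\<Z>\<^esub>) (Idl\<^bsub>\<Z>\<^esub> {k})"
    by (rule ext) (simp add: ZMod_def)
  then have hom: "ZMod k \<in> ring_hom \<Z> (ZFact k)"
    unfolding ZFact_def using rcos_ring_hom by simp
  show "ZMod k a \<in> carrier (ZFact k)" "ZMod k 1 = \<one>\<^bsub>ZFact k\<^esub>"
    "ZMod k (a * b) = ZMod k a \<otimes>\<^bsub>ZFact k\<^esub> ZMod k b"
    using ring_hom_closed[OF hom, of a] ring_hom_one[OF hom] ring_hom_mult[OF hom, of a b] by simp_all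
qed

lemma ZMod_eq_iff: "ZMod k a = ZMod k b \<longleftrightarrow> [a = b] (mod k)"
  by (simp add: ZMod_eq_mod cong_def)

lemma ZMod_mult_eq_one:
  assumes "[s * t = 1] (mod k)"
  shows "ZMod k s \<otimes>\<^bsub>ZFact k\<^esub> ZMod k t = \<one>\<^bsub>ZFact k\<^esub>"
  using assms ZMod_eq_iff ZMod_ring_hom by metis

lemma ZMod_unit:
  assumes "[s * t = 1] (mod k)"
  shows "ZMod k s \<in> Units (ZFact k)"
  using ZMod_mult_eq_one[OF assms] ZMod_mult_eq_one[of t s k] assms
  unfolding Units_def by (auto simp: mult.commute ZMod_ring_hom(1))

lemma reduced_signature_in_units:
  assumes h: "h \<in> B n r" and n: "n \<ge> 2" and r: "r \<ge> 1"
  shows "reduced_signature n (Core n r h) \<in> Units (ZFact (int n - 1))"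
proof -
  obtain g where g: "g \<in> B n r" "\<And>x. x \<in> dotted_Cantor n r \<Longrightarrow> g (h x) = x"
      "h \<in> dotted_Cantor n r \<rightarrow> dotted_Cantor n r"
    using B_inverse[OF h] by blast
  obtain s where s: "reduced_signature n (Core n r h) = ZMod (int n - 1) s"
    "\<And>C c. C \<subseteq> dotted_Cantor n r \<Longrightarrow> has_cone_measure n C c \<Longrightarrow> has_cone_measure n (h ` C) (s * c)"
    by (rule reduced_signature_scales_measure[OF h n r]) blast
  obtain t where t:
    "\<And>C c. C \<subseteq> dotted_Cantor n r \<Longrightarrow> has_cone_measure n C c \<Longrightarrow> has_cone_measure n (g ` C) (t * c)"
    by (rule reduced_signature_scales_measure[OF g(1) n r]) blast
  \<comment> \<open>A set of measure 1 that is mapped to itself by \<open>h\<close> followed by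
    \<open>g\<close>, so that the product of the two factors can be read off.\<close>
  define C where "C = cone n [Dotted 0]"
  have C: "C \<subseteq> dotted_Cantor n r" "has_cone_measure n C 1"
    unfolding C_def using r has_cone_measure_cone
    by (auto intro!: cone_subset_dotted_Cantor simp: Cons_in_dotted_words_iff dotted_alphabet_def)
  have "has_cone_measure n (g ` h ` C) (t * (s * 1))"
    using C g(3) by (intro s t) auto
  moreover have "g ` h ` C = C"
    using C(1) g(2) by (force simp: image_image)
  ultimately have "[t * (s * 1) = 1] (mod (int n - 1))"
    using has_cone_measure_unique[of n C "t * (s * 1)" 1] C(2) n by simp
  then show ?thesis
    unfolding s(1) by (intro ZMod_unit[of s t]) (simp add: mult.commute)
qed


section \<open>Constructing a minimal transducer from local maps\<close>

text \<open>Two distinct members differ at some position, which bounds the length of all common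
  prefixes, so a longest one exists.\<close>

lemma greatest_common_prefix_exists:
  assumes "x \<in> S" "y \<in> S" "x \<noteq> y"
  shows "\<exists>v. is_greatest_common_prefix v S"
proof -
  let ?P = "\<lambda>v. \<forall>x\<in>S. is_prefix v x"
  obtain d where d: "x d \<noteq> y d" using assms by blast
  have "length v \<le> d" if "?P v" for v
  proof (rule ccontr)
    assume "\<not> length v \<le> d"
    then show False using is_prefix_nth[of v x d] is_prefix_nth[of v y d] that assms d by auto
  qed
  moreover have "?P []" by simp
  ultimately obtain m where "\<exists>v. ?P v \<and> length v = m" "\<And>k. \<exists>v. ?P v \<and> length v = k \<Longrightarrow> k \<le> m"
    using Nat.ex_has_greatest_nat[of "\<lambda>k. \<exists>v. ?P v \<and> length v = k" 0 d] by auto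
  then show ?thesis unfolding is_greatest_common_prefix_def by blast
qed

text \<open>A criterion for a finite synchronizing minimal transducer that does not mention
  transducers. The assumption \<open>forget\<close> says that after \<open>K\<close> further plain
  letters the past survives only in the prefix already written: the continuation \<phi> is the same
  for \<open>u\<close> and \<open>u'\<close>. Injectivity makes greatest common prefixes exist, and
  uniform continuity makes them grow.\<close>

locale tame_map =
  fixes n r :: nat and h :: "(nat \<Rightarrow> letter) \<Rightarrow> nat \<Rightarrow> letter" and K :: nat
  assumes n2: "n \<ge> 2" and r1: "r \<ge> 1"
    and maps: "\<And>x. x \<in> dotted_Cantor n r \<Longrightarrow> h x \<in> dotted_Cantor n r"
    and inj: "inj_on h (dotted_Cantor n r)"
    and unif: "uniformly_determined n r h"
    and forget: "\<And>u u' v. u \<in> dotted_words n r \<Longrightarrow> u' \<in> dotted_words n r \<Longrightarrow>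
      v \<in> lists (alphabet n) \<Longrightarrow> length v = K \<Longrightarrow>
      \<exists>p p' \<phi>. \<forall>x\<in>Cantor n. h ((u @ v) \<frown> x) = p \<frown> \<phi> x \<and> h ((u' @ v) \<frown> x) = p' \<frown> \<phi> x"
begin

text \<open>The output forced by the input \<open>w\<close>. The empty word is set apart because an
  initial transducer writes nothing before its first letter, even if, as for \<open>r = 1\<close>,
  all values of \<open>h\<close> begin alike.\<close>

definition gcp :: "letter list \<Rightarrow> letter list" where
  "gcp w = (if w = [] then [] else THE v. is_greatest_common_prefix v (h ` cone n w))"

text \<open>The residual of \<open>h\<close> at \<open>w\<close>: what is still to be written once
  the forced output has been removed.\<close>

definition loc :: "letter list \<Rightarrow> (nat \<Rightarrow> letter) \<Rightarrow> nat \<Rightarrow> letter" where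
  "loc w x = suffix (length (gcp w)) (h (w \<frown> x))"

abbreviation "valid \<equiv> insert [] (dotted_words n r)"

lemma gcp_Nil [simp]: "gcp [] = []"
  by (simp add: gcp_def)

lemma cone_eq: "cone n w = (\<lambda>x. w \<frown> x) ` Cantor n"
  by (auto simp: cone_def)

lemma Cantor_ex: "\<exists>x. x \<in> Cantor n"
  using Cantor_nonempty[of n] n2 by auto

lemma conc_in_dotted: "w \<in> dotted_words n r \<Longrightarrow> x \<in> Cantor n \<Longrightarrow> w \<frown> x \<in> dotted_Cantor n r"
  using conc_in_dotted_Cantor_iff[OF dotted_words_nonempty] by blast

lemma gcp:
  assumes w: "w \<in> dotted_words n r"
  shows "is_greatest_common_prefix (gcp w) (h ` cone n w)"
proof -
  define a b where "a = (\<lambda>_::nat. Plain 0)" and "b = (\<lambda>_::nat. Plain 1)"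
  have ab: "a \<in> Cantor n" "b \<in> Cantor n" "a \<noteq> b"
    using n2 by (auto simp: a_def b_def Cantor_def alphabet_def fun_eq_iff)
  then have "w \<frown> a \<noteq> w \<frown> b" by simp
  then have "h (w \<frown> a) \<noteq> h (w \<frown> b)"
    using inj conc_in_dotted[OF w] ab by (auto dest: inj_onD)
  then obtain v where v: "is_greatest_common_prefix v (h ` cone n w)"
    using greatest_common_prefix_exists[of "h (w \<frown> a)" "h ` cone n w" "h (w \<frown> b)"] ab
    by (auto simp: cone_eq)
  have ne: "h ` cone n w \<noteq> {}" using cone_nonempty[of n w] n2 by auto
  have "(THE v. is_greatest_common_prefix v (h ` cone n w)) = v"
    by (rule the_equality[where P = "\<lambda>u. is_greatest_common_prefix u (h ` cone n w)", OF v
        greatest_common_prefix_unique[OF _ v ne]])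
  then show ?thesis
    using v dotted_words_nonempty[OF w] by (simp add: gcp_def)
qed

lemma gcp_prefix:
  assumes "w \<in> dotted_words n r" "x \<in> Cantor n"
  shows "is_prefix (gcp w) (h (w \<frown> x))"
  using gcp[OF assms(1)] assms(2) unfolding is_greatest_common_prefix_def cone_eq by blast

lemma gcp_longest:
  assumes "w \<in> dotted_words n r" "\<And>x. x \<in> Cantor n \<Longrightarrow> is_prefix v (h (w \<frown> x))"
  shows "length v \<le> length (gcp w)"
  using gcp[OF assms(1)] assms(2) unfolding is_greatest_common_prefix_def cone_eq by blast

lemma h_conc:
  assumes "w \<in> valid" "w = [] \<or> x \<in> Cantor n"
  shows "h (w \<frown> x) = gcp w \<frown> loc w x"
proof (cases "w = []")
  case True
  then show ?thesis by (simp add: loc_def)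
next
  case False
  then show ?thesis
    using gcp_prefix[of w x] assms is_prefix_iff_conc unfolding loc_def by blast
qed

lemma append_valid: "w \<in> valid \<Longrightarrow> w @ v \<in> dotted_words n r \<Longrightarrow> w = [] \<or> v \<in> lists (alphabet n)"
  using append_in_dotted_words_iff by blast

lemma gcp_append:
  assumes w: "w \<in> valid" and wv: "w @ v \<in> valid"
  shows "gcp (w @ v) = gcp w @ drop (length (gcp w)) (gcp (w @ v))"
proof (cases "w = []")
  case False
  then have w': "w \<in> dotted_words n r" and wv': "w @ v \<in> dotted_words n r" and v: "v \<in> lists (alphabet n)"
    using w wv append_valid[of w v] by auto
  have p: "is_prefix (gcp w) (h ((w @ v) \<frown> x))" if x: "x \<in> Cantor n" for x
    using gcp_prefix[OF w', of "v \<frown> x"] x v by (simp add: conc_in_Cantor_iff)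
  obtain x where x: "x \<in> Cantor n" using Cantor_ex by blast
  show ?thesis
    by (rule is_prefix_take[OF p[OF x] gcp_prefix[OF wv' x]]) (rule gcp_longest[OF wv' p])
qed simp

text \<open>The output produced by reading \<open>v\<close> after \<open>w\<close> depends on the
  residual \<open>loc w\<close> only. This is both the prefix condition of minimality and the reason
  why outputs can be attached to states.\<close>

lemma gcp_step:
  assumes w: "w \<in> valid" and wv: "w @ v \<in> dotted_words n r"
  shows "is_greatest_common_prefix (drop (length (gcp w)) (gcp (w @ v))) ((\<lambda>x. loc w (v \<frown> x)) ` Cantor n)"
proof -
  have "h ((w @ v) \<frown> x) = gcp w \<frown> loc w (v \<frown> x)" if "x \<in> Cantor n" for x
    using h_conc[OF w, of "v \<frown> x"] append_valid[OF w wv] that by (auto simp: conc_in_Cantor_iff)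
  then have "h ` cone n (w @ v) = (\<lambda>x. gcp w \<frown> x) ` (\<lambda>x. loc w (v \<frown> x)) ` Cantor n"
    by (auto simp: cone_eq image_image)
  then show ?thesis
    using gcp[OF wv] gcp_append[OF w] wv Cantor_ex
      greatest_common_prefix_conc_iff[of "(\<lambda>x. loc w (v \<frown> x)) ` Cantor n" "gcp w"]
    by (metis empty_iff image_is_empty insertCI)
qed

lemma loc_append:
  assumes w: "w \<in> valid" and wv: "w @ v \<in> dotted_words n r" and x: "x \<in> Cantor n"
  shows "loc (w @ v) x = suffix (length (drop (length (gcp w)) (gcp (w @ v)))) (loc w (v \<frown> x))"
proof -
  have "h ((w @ v) \<frown> x) = gcp w \<frown> loc w (v \<frown> x)"
    using h_conc[OF w, of "v \<frown> x"] append_valid[OF w wv] x by (auto simp: conc_in_Cantor_iff)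
  moreover have "length (gcp (w @ v)) = length (gcp w) + length (drop (length (gcp w)) (gcp (w @ v)))"
    using gcp_append[OF w, of v] wv by (metis insertCI length_append)
  ultimately show ?thesis
    unfolding loc_def[of "w @ v"] by (metis suffix_conc_length suffix_suffix)
qed

definition local_map :: "letter list \<Rightarrow> (nat \<Rightarrow> letter) \<Rightarrow> nat \<Rightarrow> letter" where
  "local_map w = restrict (loc w) (Cantor n)"

lemma local_map_eq_iff: "local_map u = local_map w \<longleftrightarrow> (\<forall>x\<in>Cantor n. loc u x = loc w x)"
  unfolding local_map_def by (metis restrict_apply' restrict_ext)

text \<open>Makes outputs and transitions well defined on classes of words with equal local
  maps.\<close>

lemma local_map_append:
  assumes uw: "u \<in> dotted_words n r" "w \<in> dotted_words n r" and eq: "local_map u = local_map w"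
    and v: "v \<in> lists (alphabet n)"
  shows "drop (length (gcp u)) (gcp (u @ v)) = drop (length (gcp w)) (gcp (w @ v))" (is ?A)
    and "local_map (u @ v) = local_map (w @ v)" (is ?B)
proof -
  have d: "u @ v \<in> dotted_words n r" "w @ v \<in> dotted_words n r"
    using uw v append_in_dotted_words by blast+
  have loc: "loc u (v \<frown> x) = loc w (v \<frown> x)" if "x \<in> Cantor n" for x
    using eq v that unfolding local_map_eq_iff by (simp add: conc_in_Cantor_iff)
  then have "(\<lambda>x. loc u (v \<frown> x)) ` Cantor n = (\<lambda>x. loc w (v \<frown> x)) ` Cantor n" by simp
  then show A: ?A
    using gcp_step[of u v] gcp_step[of w v] uw d Cantor_ex greatest_common_prefix_unique
    by (metis empty_iff image_is_empty insertCI)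
  show ?B
    unfolding local_map_eq_iff using loc_append[of u v] loc_append[of w v] uw d loc A by auto
qed

text \<open>The two cones have images that are translates, by \<open>p\<close> and by
  \<open>p'\<close>, of the image of \<phi>. The greatest common prefix \<open>c\<close> of that
  image is the same in both cases, and both local maps are \<phi> with \<open>c\<close>
  removed.\<close>

lemma local_map_forget:
  assumes u: "u \<in> dotted_words n r" "u' \<in> dotted_words n r" and v: "v \<in> lists (alphabet n)" "length v = K"
  shows "local_map (u @ v) = local_map (u' @ v)"
proof -
  obtain p p' \<phi> where \<phi>: "\<And>x. x \<in> Cantor n \<Longrightarrow> h ((u @ v) \<frown> x) = p \<frown> \<phi> x"
      "\<And>x. x \<in> Cantor n \<Longrightarrow> h ((u' @ v) \<frown> x) = p' \<frown> \<phi> x"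
    using forget[OF u v] by blast
  have strip: "\<exists>c. gcp w = q @ c \<and> is_greatest_common_prefix c (\<phi> ` Cantor n)"
    if w: "w \<in> dotted_words n r" and q: "\<And>x. x \<in> Cantor n \<Longrightarrow> h (w \<frown> x) = q \<frown> \<phi> x" for w q
  proof -
    obtain x where x: "x \<in> Cantor n" using Cantor_ex by blast
    have "length q \<le> length (gcp w)"
      using gcp_longest[OF w] q by simp
    then have c: "gcp w = q @ drop (length q) (gcp w)"
      using gcp_prefix[OF w x] q[OF x] by (intro is_prefix_take[of q "h (w \<frown> x)"]) auto
    have "h ` cone n w = (\<lambda>x. q \<frown> x) ` \<phi> ` Cantor n"
      using q by (auto simp: cone_eq image_image)
    then have "is_greatest_common_prefix (drop (length q) (gcp w)) (\<phi> ` Cantor n)"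
      using gcp[OF w] c x greatest_common_prefix_conc_iff[of "\<phi> ` Cantor n" q] by (metis empty_iff image_is_empty)
    then show ?thesis using c by blast
  qed
  have d: "u @ v \<in> dotted_words n r" "u' @ v \<in> dotted_words n r"
    using u v append_in_dotted_words by blast+
  obtain c c' where c: "gcp (u @ v) = p @ c" "is_greatest_common_prefix c (\<phi> ` Cantor n)"
    and c': "gcp (u' @ v) = p' @ c'" "is_greatest_common_prefix c' (\<phi> ` Cantor n)"
    using strip[OF d(1) \<phi>(1)] strip[OF d(2) \<phi>(2)] by blast
  have "c = c'"
    using greatest_common_prefix_unique[OF c(2) c'(2)] Cantor_ex by auto
  then have "loc (u @ v) x = suffix (length c) (\<phi> x)" "loc (u' @ v) x = suffix (length c) (\<phi> x)"
    if "x \<in> Cantor n" for x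
    using \<phi>[OF that] c(1) c'(1) by (simp_all add: loc_def)
  then show ?thesis unfolding local_map_eq_iff by simp
qed

text \<open>A word longer than \<open>Suc K\<close> has the same local map as
  \<open>[Dotted 0]\<close> followed by its last \<open>K\<close> letters, so finitely many words
  give all local maps.\<close>

lemma finite_local_maps: "finite (local_map ` dotted_words n r)"
proof (rule finite_subset)
  let ?W = "{w. set w \<subseteq> dotted_alphabet r \<union> alphabet n \<and> length w \<le> Suc K}"
  show "local_map ` dotted_words n r \<subseteq> local_map ` ?W"
  proof
    fix f assume "f \<in> local_map ` dotted_words n r"
    then obtain w where w: "w \<in> dotted_words n r" "f = local_map w" by blast
    have sub: "set w \<subseteq> dotted_alphabet r \<union> alphabet n" if "w \<in> dotted_words n r" for w
      using that by (auto simp: dotted_words_def)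
    have "\<exists>w'\<in>dotted_words n r. length w' \<le> Suc K \<and> f = local_map w'"
    proof (cases "length w \<le> Suc K")
      case False
      define u v where "u = take (length w - K) w" and "v = drop (length w - K) w"
      have uv: "w = u @ v" "length v = K" "u \<noteq> []" using False by (auto simp: u_def v_def)
      then have u: "u \<in> dotted_words n r" "v \<in> lists (alphabet n)"
        using w append_in_dotted_words_iff by metis+
      have "[Dotted 0] \<in> dotted_words n r"
        using r1 by (auto simp: Cons_in_dotted_words_iff dotted_alphabet_def)
      then have "f = local_map ([Dotted 0] @ v)" "[Dotted 0] @ v \<in> dotted_words n r"
        using local_map_forget[OF u(1) _ u(2) uv(2)] w(2) uv(1) u(2) append_in_dotted_words by blast+
      then show ?thesis using uv(2) by (intro bexI[of _ "[Dotted 0] @ v"]) auto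
    qed (use w in blast)
    then show "f \<in> local_map ` ?W" using sub by blast
  qed
  have "finite ?W"
    by (intro finite_lists_length_le) (simp add: finite_alphabet dotted_alphabet_def)
  then show "finite (local_map ` ?W)" by (rule finite_imageI)
qed

section \<open>A transducer whose states are the local maps\<close>

definition code :: "((nat \<Rightarrow> letter) \<Rightarrow> nat \<Rightarrow> letter) \<Rightarrow> nat" where
  "code = (SOME f. inj_on f (local_map ` dotted_words n r))"

lemma inj_code: "inj_on code (local_map ` dotted_words n r)"
proof -
  have "\<exists>f :: _ \<Rightarrow> nat. inj_on f (local_map ` dotted_words n r)"
    using finite_imp_inj_to_nat_seg[OF finite_local_maps] by blast
  then show ?thesis unfolding code_def by (rule someI_ex)
qed

text \<open>Natural numbers serve as states, as membership in \<open>B\<close> demands. The number 0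
  is reserved for the empty word, since the initial state reads other letters than all other states
  and is never entered again.\<close>

definition st :: "letter list \<Rightarrow> nat" where
  "st w = (if w = [] then 0 else Suc (code (local_map w)))"

lemma st_eq_iff:
  assumes "u \<in> valid" "w \<in> valid"
  shows "st u = st w \<longleftrightarrow> (u = [] \<longleftrightarrow> w = []) \<and> (u \<noteq> [] \<longrightarrow> local_map u = local_map w)"
  using assms inj_on_eq_iff[OF inj_code] by (auto simp: st_def)

lemma st_Nil [simp]: "st [] = 0"
  by (simp add: st_def)

lemma st_0_iff: "st w = 0 \<longleftrightarrow> w = []"
  by (simp add: st_def)

definition rep :: "nat \<Rightarrow> letter list" where
  "rep q = (SOME w. w \<in> valid \<and> st w = q)"

lemma rep: "w \<in> valid \<Longrightarrow> rep (st w) \<in> valid \<and> st (rep (st w)) = st w"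
  unfolding rep_def by (rule someI[of "\<lambda>u. u \<in> valid \<and> st u = st w" w]) simp

text \<open>The analogue of the Nerode automaton: nonempty words with equal local maps are
  identified. Transitions and outputs are read off a chosen representative; by
  \<open>transducer_step\<close> the choice has no effect on readable letters.\<close>

definition transducer :: "nat transducer" where
  "transducer = \<lparr>states = st ` valid,
     readable = (\<lambda>q. if q = 0 then dotted_alphabet r else alphabet n),
     transition = (\<lambda>i q. st (rep q @ [i])),
     out = (\<lambda>i q. drop (length (gcp (rep q))) (gcp (rep q @ [i])))\<rparr>"

lemma finite_states: "finite (states transducer)"
proof -
  have "states transducer \<subseteq> insert 0 ((\<lambda>f. Suc (code f)) ` local_map ` dotted_words n r)"
    by (auto simp: st_def transducer_def)
  then show ?thesis using finite_local_maps finite_subset by blast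
qed

lemma statesE:
  assumes "q \<in> states transducer"
  obtains w where "w \<in> valid" "q = st w"
  using assms unfolding transducer_def transducer.simps by (elim imageE) (rule that)

lemma readable_iff: "w \<in> valid \<Longrightarrow> i \<in> readable transducer (st w) \<longleftrightarrow> w @ [i] \<in> dotted_words n r"
  using append_in_dotted_words_iff[of w "[i]" n r]
  by (cases "w = []") (auto simp: transducer_def st_def Cons_in_dotted_words_iff)

lemma transducer_step:
  assumes w: "w \<in> valid" and wi: "w @ [i] \<in> dotted_words n r"
  shows "transition transducer i (st w) = st (w @ [i])"
    "out transducer i (st w) = drop (length (gcp w)) (gcp (w @ [i]))"
proof -
  have r: "rep (st w) \<in> valid" "st (rep (st w)) = st w" using rep[OF w] by auto
  have "st (rep (st w) @ [i]) = st (w @ [i]) \<and>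
    drop (length (gcp (rep (st w)))) (gcp (rep (st w) @ [i])) = drop (length (gcp w)) (gcp (w @ [i]))"
  proof (cases "w = []")
    case True
    then have "rep (st w) = []" using r st_0_iff by metis
    then show ?thesis using True by simp
  next
    case False
    then have "rep (st w) \<noteq> []" "local_map (rep (st w)) = local_map w"
      using r w st_eq_iff by metis+
    then show ?thesis
      using local_map_append[of "rep (st w)" w "[i]"] r(1) w append_valid[OF w wi] False
      by (auto simp: st_def)
  qed
  then show "transition transducer i (st w) = st (w @ [i])"
    "out transducer i (st w) = drop (length (gcp w)) (gcp (w @ [i]))"
    by (simp_all add: transducer_def)
qed

lemma valid_appendD: "w @ v \<in> valid \<Longrightarrow> w \<in> valid"
  using append_in_dotted_words_iff by (cases "w = []") auto

lemma transducer_word: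
  assumes "w \<in> valid" "w @ v \<in> valid"
  shows "state_after transducer v (st w) = st (w @ v) \<and>
    out_word transducer v (st w) = drop (length (gcp w)) (gcp (w @ v))"
  using assms
proof (induction v arbitrary: w)
  case (Cons i v)
  have wiv: "(w @ [i]) @ v \<in> valid" using Cons.prems by simp
  then have wi: "w @ [i] \<in> valid" by (rule valid_appendD)
  then have wi': "w @ [i] \<in> dotted_words n r" by simp
  have "length (gcp w) \<le> length (gcp (w @ [i]))"
    using arg_cong[OF gcp_append[OF Cons.prems(1) wi], of length] by simp
  then have "drop (length (gcp w)) (gcp (w @ [i])) @ drop (length (gcp (w @ [i]))) (gcp ((w @ [i]) @ v))
      = drop (length (gcp w)) (gcp (w @ [i]) @ drop (length (gcp (w @ [i]))) (gcp ((w @ [i]) @ v)))"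
    by simp
  also have "\<dots> = drop (length (gcp w)) (gcp ((w @ [i]) @ v))"
    using gcp_append[OF wi wiv] by simp
  finally show ?case
    using Cons.IH[OF wi wiv] transducer_step[OF Cons.prems(1) wi'] by simp
qed simp

text \<open>By uniform continuity a long input prefix determines the first \<open>j\<close> letters
  of the value, so these letters are common to the image of the cone. Infinite output and the
  absence of cycles both rest on this.\<close>

lemma gcp_long: "\<exists>N. \<forall>w\<in>dotted_words n r. N \<le> length w \<longrightarrow> j \<le> length (gcp w)"
proof -
  obtain N where N: "\<forall>x\<in>dotted_Cantor n r. \<forall>y\<in>dotted_Cantor n r.
     (\<forall>i<N. x i = y i) \<longrightarrow> (\<forall>i<j. h x i = h y i)"
    using unif unfolding uniformly_determined_def by blast
  have "j \<le> length (gcp w)" if w: "w \<in> dotted_words n r" "N \<le> length w" for w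
  proof -
    obtain x0 where x0: "x0 \<in> Cantor n" using Cantor_ex by blast
    have "is_prefix (Omega_Words_Fun.prefix j (h (w \<frown> x0))) (h (w \<frown> x))" if x: "x \<in> Cantor n" for x
    proof (rule is_prefixI)
      fix i assume i: "i < length (Omega_Words_Fun.prefix j (h (w \<frown> x0)))"
      have "\<forall>i<N. (w \<frown> x0) i = (w \<frown> x) i" using w(2) by simp
      then have "\<forall>i<j. h (w \<frown> x0) i = h (w \<frown> x) i"
        using N conc_in_dotted[OF w(1) x0] conc_in_dotted[OF w(1) x] by blast
      then show "h (w \<frown> x) i = Omega_Words_Fun.prefix j (h (w \<frown> x0)) ! i"
        using i by simp
    qed
    from gcp_longest[OF w(1) this] show ?thesis by simp
  qed
  then show ?thesis by blast
qed

definition inputs :: "letter list \<Rightarrow> (nat \<Rightarrow> letter) set" where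
  "inputs w = (if w = [] then dotted_Cantor n r else Cantor n)"

lemma infinite_inputs_st: "w \<in> valid \<Longrightarrow> infinite_inputs n transducer (st w) = inputs w"
proof -
  assume w: "w \<in> valid"
  show ?thesis
  proof (cases "w = []")
    case True
    then show ?thesis by (simp add: infinite_inputs_def transducer_def inputs_def dotted_Cantor_def)
  next
    case False
    have "x \<in> infinite_inputs n transducer (st w) \<longleftrightarrow> x \<in> Cantor n" for x
    proof
      assume "x \<in> infinite_inputs n transducer (st w)"
      then obtain i y where "x = [i] \<frown> y" "i \<in> alphabet n" "y \<in> Cantor n"
        using False by (auto simp: infinite_inputs_def transducer_def st_0_iff)
      then show "x \<in> Cantor n" using conc_in_Cantor_iff[of "[i]" y n] by simp
    next
      assume x: "x \<in> Cantor n"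
      then have "x = [x 0] \<frown> suffix 1 x" "x 0 \<in> alphabet n"
        using prefix_suffix[of x 1] by (auto simp: Cantor_def)
      moreover have "readable transducer (st w) = alphabet n"
        using False by (simp add: transducer_def st_0_iff)
      ultimately show "x \<in> infinite_inputs n transducer (st w)"
        using suffix_in_Cantor[OF x] unfolding infinite_inputs_def by blast
    qed
    then show ?thesis using False by (auto simp: inputs_def)
  qed
qed

lemma append_prefix_valid:
  assumes "w \<in> valid" "x \<in> inputs w"
  shows "w @ Omega_Words_Fun.prefix k x \<in> valid" "k > 0 \<Longrightarrow> w @ Omega_Words_Fun.prefix k x \<in> dotted_words n r"
proof -
  show "w @ Omega_Words_Fun.prefix k x \<in> valid"
  proof (cases "w = []")
    case True
    then show ?thesis
      using assms prefix_in_dotted_words[of x n r k] by (cases "k = 0") (auto simp: inputs_def)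
  next
    case False
    then show ?thesis
      using assms append_in_dotted_words prefix_in_lists by (auto simp: inputs_def)
  qed
  then show "w @ Omega_Words_Fun.prefix k x \<in> dotted_words n r" if "k > 0"
    using that by auto
qed

lemma infinite_output:
  assumes w: "w \<in> valid" and x: "x \<in> inputs w"
  shows "has_infinite_output transducer x (st w)"
  unfolding has_infinite_output_def
proof
  fix m
  obtain N where N: "\<forall>v\<in>dotted_words n r. N \<le> length v \<longrightarrow> m + length (gcp w) \<le> length (gcp v)"
    using gcp_long by blast
  let ?v = "Omega_Words_Fun.prefix (Suc N) x"
  have "w @ ?v \<in> dotted_words n r" by (rule append_prefix_valid(2)[OF w x]) simp
  moreover have "N \<le> length (w @ ?v)" by simp
  ultimately have "m + length (gcp w) \<le> length (gcp (w @ ?v))" using N by blast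
  then have "m \<le> length (out_word transducer ?v (st w))"
    using transducer_word[OF w append_prefix_valid(1)[OF w x], of "Suc N"]
    by (simp del: subseq_to_Suc)
  then show "\<exists>k. m \<le> length (out_word transducer (Omega_Words_Fun.prefix k x) (st w))" by blast
qed

lemma out_inf_st:
  assumes w: "w \<in> valid" and x: "x \<in> inputs w"
  shows "out_inf transducer x (st w) = loc w x"
proof (rule out_inf_eqI[OF infinite_output[OF w x]])
  fix k
  let ?v = "Omega_Words_Fun.prefix k x"
  have wv: "w @ ?v \<in> valid" using append_prefix_valid[OF w x] by blast
  have "is_prefix (gcp (w @ ?v)) (h (w \<frown> x))"
  proof (cases "w @ ?v = []")
    case False
    have y: "suffix k x \<in> Cantor n"
      using x False suffix_in_Cantor suffix_in_Cantor_of_dotted[of x n r k]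
      by (cases "w = []") (auto simp: inputs_def)
    have "w \<frown> x = (w @ ?v) \<frown> suffix k x"
      using conc_conc[of w ?v "suffix k x"] prefix_suffix[of x k] by simp
    then show ?thesis
      using gcp_prefix[OF _ y, of "w @ ?v"] wv False by (metis insertE)
  qed simp
  moreover have "h (w \<frown> x) = gcp w \<frown> loc w x"
    using h_conc[OF w, of x] x by (auto simp: inputs_def split: if_splits)
  ultimately show "is_prefix (out_word transducer ?v (st w)) (loc w x)"
    using transducer_word[OF w wv] gcp_append[OF w wv] is_prefix_append_conc by metis
qed

lemma gcp_dotted:
  assumes "w \<in> dotted_words n r" "gcp w \<noteq> []"
  shows "gcp w \<in> dotted_words n r"
proof -
  obtain x where x: "x \<in> Cantor n" using Cantor_ex by blast
  have "gcp w \<frown> loc w x \<in> dotted_Cantor n r"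
    using h_conc[of w x] x assms(1) maps[OF conc_in_dotted[OF assms(1) x]] by simp
  then show ?thesis using conc_in_dotted_Cantor_iff[OF assms(2)] by blast
qed

text \<open>The image of the local map at \<open>w\<close> starts with dotted letters iff \<open>gcp w = []\<close>.\<close>

lemma gcp_Nil_cong:
  assumes uw: "u \<in> valid" "w \<in> valid" and eq: "st u = st w" and u: "gcp u = []"
  shows "gcp w = []"
proof (cases "w = []")
  case False
  then have d: "u \<in> dotted_words n r" "w \<in> dotted_words n r" and l: "local_map u = local_map w"
    using uw eq st_eq_iff[OF uw] by auto
  obtain x where x: "x \<in> Cantor n" using Cantor_ex by blast
  show ?thesis
  proof (rule ccontr)
    assume g: "gcp w \<noteq> []"
    have "loc u x \<in> dotted_Cantor n r"
      using maps[OF conc_in_dotted[OF d(1) x]] u by (simp add: loc_def)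
    moreover have "loc w x \<in> Cantor n"
      unfolding loc_def using g
      by (intro suffix_in_Cantor_of_dotted[OF maps[OF conc_in_dotted[OF d(2) x]]]) simp
    moreover have "loc u x = loc w x" using l x local_map_eq_iff by blast
    ultimately show False
      using dotted_Cantor_first[of "loc u x" n r] alphabet_disjoint_dotted[of n r]
      by (auto simp: Cantor_def)
  qed
qed simp

text \<open>Pumping: a cycle could be repeated without leaving its state, and emptiness of the
  forced output depends on the state only, so arbitrarily long words would force no output.\<close>

lemma no_cycle:
  assumes w: "w \<in> valid" "gcp w = []" and v: "w @ v \<in> valid" "v \<noteq> []"
  shows "st (w @ v) \<noteq> st w"
proof
  assume eq: "st (w @ v) = st w"
  have ne: "w \<noteq> []" using eq v st_0_iff by force
  then have wd: "w \<in> dotted_words n r" "v \<in> lists (alphabet n)"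
    using w v append_valid[of w v] by auto
  have pow: "w @ concat (replicate k v) \<in> valid \<and> st (w @ concat (replicate k v)) = st w" for k
  proof (induction k)
    case (Suc k)
    let ?u = "w @ concat (replicate k v)"
    have u: "?u \<in> valid" "?u @ v \<in> valid"
      using Suc wd append_in_dotted_words[of ?u n r v] ne by auto
    have "st (?u @ v) = state_after transducer v (st w)"
      using transducer_word[OF u] Suc by simp
    also have "\<dots> = st w"
      using transducer_word[OF w(1) v(1)] eq by simp
    finally have "st (?u @ v) = st w" .
    moreover have "concat (replicate (Suc k) v) = concat (replicate k v) @ v"
      using arg_cong[OF replicate_append_same[of k v], of concat] by simp
    ultimately show ?case using u by (simp del: replicate_Suc)
  qed (use w in simp)
  obtain N where N: "\<forall>w\<in>dotted_words n r. N \<le> length w \<longrightarrow> 1 \<le> length (gcp w)"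
    using gcp_long by blast
  let ?u = "w @ concat (replicate N v)"
  have "gcp ?u = []" using gcp_Nil_cong[OF w(1) _ _ w(2)] pow[of N] by metis
  moreover have "N \<le> length ?u"
    using mult_le_mono2[of 1 "length v" N] v(2)
    by (simp add: length_concat sum_list_replicate trans_le_add2 Suc_le_eq)
  moreover have "?u \<in> dotted_words n r" using pow[of N] ne by auto
  ultimately show False using N by fastforce
qed

lemma input_words_st:
  assumes "w \<in> valid" "v \<in> input_words n transducer (st w)"
  shows "w @ v \<in> valid"
proof (cases v)
  case (Cons i v')
  then have "w @ [i] \<in> dotted_words n r" "v' \<in> lists (alphabet n)"
    using assms readable_iff by (auto simp: input_words_def)
  then show ?thesis
    using append_in_dotted_words[of "w @ [i]" n r v'] Cons by simp
qed (use assms in simp)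

lemma dotted_transducer_over_transducer: "dotted_transducer_over n r transducer 0"
proof -
  \<comment> \<open>\<open>R\<close> holds the states reached before anything has been written. By
    \<open>gcp_Nil_cong\<close> this depends on the state and not on the word leading to it.\<close>
  define R S where "R = st ` {w \<in> valid. gcp w = []}" and "S = st ` {w \<in> valid. gcp w \<noteq> []}"
  have states: "states transducer = st ` valid" by (simp add: transducer_def)
  have RE: "\<exists>u. u \<in> valid \<and> gcp u = [] \<and> q = st u" if "q \<in> R" for q
    using that unfolding R_def by (elim imageE CollectE conjE) (intro exI conjI)
  have SE: "\<exists>u. u \<in> valid \<and> gcp u \<noteq> [] \<and> q = st u" if "q \<in> S" for q
    using that unfolding S_def by (elim imageE CollectE conjE) (intro exI conjI)
  have inR: "st w \<in> R \<longleftrightarrow> gcp w = []" if w: "w \<in> valid" for w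
  proof
    assume "st w \<in> R"
    from RE[OF this] show "gcp w = []" using gcp_Nil_cong[OF _ w] by metis
  next
    assume "gcp w = []"
    then show "st w \<in> R" unfolding R_def using w by (intro imageI CollectI conjI)
  qed
  have inS: "st w \<in> S \<longleftrightarrow> gcp w \<noteq> []" if w: "w \<in> valid" for w
  proof
    assume "st w \<in> S"
    from SE[OF this] show "gcp w \<noteq> []" using gcp_Nil_cong[OF w] by metis
  next
    assume "gcp w \<noteq> []"
    then show "st w \<in> S" unfolding S_def using w by (intro imageI CollectI conjI)
  qed
  have eqs: "states transducer = R \<union> S" "R \<inter> S = {}" "finite R" "0 \<in> R"
  proof -
    have "valid = {w \<in> valid. gcp w = []} \<union> {w \<in> valid. gcp w \<noteq> []}" by blast
    then show "states transducer = R \<union> S" unfolding states R_def S_def image_Un[symmetric] by (rule arg_cong)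
    show "R \<inter> S = {}"
    proof (rule equals0I)
      fix q assume q: "q \<in> R \<inter> S"
      then obtain u where "u \<in> valid" "gcp u \<noteq> []" "q = st u" using SE by blast
      then show False using inR q by blast
    qed
    show "finite R" by (rule finite_subset[OF _ finite_states]) (auto simp: R_def states)
    show "0 \<in> R" using iffD2[OF inR[OF insertI1] gcp_Nil] unfolding st_Nil .
  qed
  have step: "transition transducer i q \<in> states transducer - {0} \<and>
      (q \<in> R \<longrightarrow> (transition transducer i q \<in> R \<longrightarrow> out transducer i q = []) \<and>
        (transition transducer i q \<in> S \<longrightarrow> out transducer i q \<in> dotted_words n r)) \<and>
      (q \<in> S \<longrightarrow> transition transducer i q \<in> S \<and> out transducer i q \<in> lists (alphabet n))"
    if q: "q \<in> states transducer" and i: "i \<in> readable transducer q" for q i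
  proof -
    obtain w where w: "w \<in> valid" "q = st w" by (rule statesE[OF q])
    then have wi: "w @ [i] \<in> dotted_words n r" using readable_iff i by blast
    then have wi': "w @ [i] \<in> valid" by simp
    note s = transducer_step[OF w(1) wi] and a = gcp_append[OF w(1) wi']
    show ?thesis
    proof (cases "gcp w = []")
      case True
      then show ?thesis
        using s w inR inS wi' gcp_dotted[OF wi] st_0_iff by (auto simp: states)
    next
      case False
      then have "gcp (w @ [i]) \<noteq> []" using a by (metis append_is_Nil_conv)
      then have "drop (length (gcp w)) (gcp (w @ [i])) \<in> lists (alphabet n)"
        using gcp_dotted[OF wi] a append_in_dotted_words_iff[OF False] by metis
      then show ?thesis
        using s w inR inS wi' \<open>gcp (w @ [i]) \<noteq> []\<close> False st_0_iff by (auto simp: states)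
    qed
  qed
  have cyc: "state_after transducer v q \<noteq> q"
    if q: "q \<in> R" and v: "v \<in> input_words n transducer q" "v \<noteq> []" for q v
  proof -
    obtain w where w: "w \<in> valid" "gcp w = []" "q = st w" using RE[OF q] by blast
    then have wv: "w @ v \<in> valid" using input_words_st v by blast
    then show ?thesis
      using transducer_word[OF w(1) wv] no_cycle[OF w(1,2) wv v(2)] w(3) by simp
  qed
  have infS: "has_infinite_output transducer x q" if q: "q \<in> S" and x: "x \<in> Cantor n" for q x
  proof -
    obtain w where w: "w \<in> valid" "gcp w \<noteq> []" "q = st w" using SE[OF q] by blast
    then have "x \<in> inputs w" using x by (auto simp: inputs_def)
    then show ?thesis using infinite_output[OF w(1)] w(3) by blast
  qed
  show ?thesis
    unfolding dotted_transducer_over_def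
    using eqs step cyc infS by (intro exI[of _ R] exI[of _ S]) (auto simp: transducer_def)
qed

lemma minimal_transducer: "minimal n transducer 0"
proof -
  have states: "states transducer = st ` valid" by (simp add: transducer_def)
  have "\<exists>w\<in>input_words n transducer 0. state_after transducer w 0 = q" if q: "q \<in> states transducer" for q
  proof -
    obtain w where w: "w \<in> valid" "q = st w" by (rule statesE[OF q])
    moreover have "readable transducer 0 = dotted_alphabet r"
      by (simp add: transducer_def)
    then have "input_words n transducer 0 = valid"
      unfolding input_words_def dotted_words_def by simp
    ultimately have "w \<in> input_words n transducer 0" by metis
    moreover have "state_after transducer w 0 = q"
      using transducer_word[of "[]" w] w by simp
    ultimately show ?thesis by blast
  qed
  moreover have "p = q"
    if pq: "p \<in> states transducer" "q \<in> states transducer"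
      and eq: "infinite_inputs n transducer p = infinite_inputs n transducer q"
        "\<forall>x\<in>infinite_inputs n transducer p. out_inf transducer x p = out_inf transducer x q" for p q
  proof -
    obtain u w where uw: "u \<in> valid" "p = st u" "w \<in> valid" "q = st w"
      by (meson statesE pq)
    have i: "inputs u = inputs w" using eq(1) uw infinite_inputs_st by simp
    \<comment> \<open>The admissible inputs tell the initial state from the others; among the
      others, equal maps mean equal local maps and hence equal states.\<close>
    have "Cantor n \<inter> dotted_Cantor n r = {}"
      using dotted_Cantor_first alphabet_disjoint_dotted[of n r] by (fastforce simp: Cantor_def)
    then have nil: "u = [] \<longleftrightarrow> w = []"
      using i Cantor_ex by (auto simp: inputs_def split: if_splits)
    have "loc u x = loc w x" if "x \<in> inputs u" for x
      using eq(2) uw infinite_inputs_st out_inf_st i that by simp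
    then have "u \<noteq> [] \<Longrightarrow> local_map u = local_map w"
      by (simp add: local_map_eq_iff inputs_def)
    then show ?thesis using nil uw st_eq_iff by simp
  qed
  moreover have "is_greatest_common_prefix (out transducer i q)
      {out_inf transducer ([i] \<frown> x) q | x. x \<in> Cantor n}"
    if q: "q \<in> states transducer" and i: "i \<in> readable transducer q" for q i
  proof -
    obtain w where w: "w \<in> valid" "q = st w" by (rule statesE[OF q])
    then have wi: "w @ [i] \<in> dotted_words n r" using readable_iff i by blast
    have "out_inf transducer ([i] \<frown> x) q = loc w ([i] \<frown> x)" if "x \<in> Cantor n" for x
    proof -
      have "[i] \<frown> x \<in> infinite_inputs n transducer (st w)"
        using i w that unfolding infinite_inputs_def by blast
      then show ?thesis using infinite_inputs_st out_inf_st w by blast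
    qed
    then have "{out_inf transducer ([i] \<frown> x) q | x. x \<in> Cantor n} = (\<lambda>x. loc w ([i] \<frown> x)) ` Cantor n"
      unfolding Setcompr_eq_image by (rule image_cong[OF refl])
    then show ?thesis
      using gcp_step[OF w(1) wi] transducer_step[OF w(1) wi] w(2) by simp
  qed
  ultimately show ?thesis unfolding minimal_def by blast
qed

text \<open>The level is \<open>Suc K\<close>. The access words of the two states may be empty; the
  first letter turns them into dotted words, after which the remaining \<open>K\<close> letters
  erase the difference.\<close>

lemma synchronizing_transducer: "synchronizing n transducer"
proof -
  have "state_after transducer w p = state_after transducer w q"
    if pq: "p \<in> states transducer" "q \<in> states transducer"
      and w: "w \<in> input_words n transducer p" "w \<in> input_words n transducer q" "length w = Suc K" for p q w
  proof -
    obtain u u' where u: "u \<in> valid" "p = st u" "u' \<in> valid" "q = st u'"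
      by (meson statesE pq)
    obtain a v where av: "w = a # v" "length v = K" using w(3) by (cases w) auto
    then have a: "a \<in> readable transducer p" "a \<in> readable transducer q" and v: "v \<in> lists (alphabet n)"
      using w by (auto simp: input_words_def)
    have nil: "u = [] \<longleftrightarrow> u' = []"
      using a u alphabet_disjoint_dotted[of n r] by (auto simp: transducer_def st_0_iff split: if_splits)
    have d: "u @ [a] \<in> dotted_words n r" "u' @ [a] \<in> dotted_words n r"
      using a u readable_iff by auto
    have uw: "u @ w \<in> valid" "u' @ w \<in> valid" using u w input_words_st by auto
    have "local_map (u @ w) = local_map (u' @ w)"
      using local_map_forget[OF d v av(2)] av(1) by simp
    then have "st (u @ w) = st (u' @ w)"
      using uw st_eq_iff av(1) by auto
    then show ?thesis
      using transducer_word[OF u(1) uw(1)] transducer_word[OF u(3) uw(2)] u by simp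
  qed
  then show ?thesis
    unfolding synchronizing_def synchronizing_at_def by blast
qed

lemma has_finite_sync_minimal_transducer: "has_finite_sync_minimal_transducer n r h"
proof -
  have "out_inf transducer x 0 = h x" if "x \<in> dotted_Cantor n r" for x
    using out_inf_st[of "[]" x] that by (simp add: inputs_def loc_def)
  then show ?thesis
    unfolding has_finite_sync_minimal_transducer_def minimal_dotted_transducer_of_def
    using dotted_transducer_over_transducer minimal_transducer synchronizing_transducer finite_states
    by blast
qed

end


section \<open>Factoring the shift space through a divisor of \<open>n\<close>\<close>

text \<open>A bijection \<open>x \<mapsto> (\<alpha> x, \<tau> x)\<close> from \<open>Cantor n\<close> to \<open>{..<D} \<times> Cantor n\<close> with inverse \<open>\<sigma>\<close>, both
  directions being sliding block codes of window size \<open>m\<close>.\<close>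

definition shift_factorization ::
  "nat \<Rightarrow> nat \<Rightarrow> nat \<Rightarrow> ((nat \<Rightarrow> letter) \<Rightarrow> nat) \<Rightarrow> ((nat \<Rightarrow> letter) \<Rightarrow> nat \<Rightarrow> letter) \<Rightarrow>
    (nat \<Rightarrow> (nat \<Rightarrow> letter) \<Rightarrow> nat \<Rightarrow> letter) \<Rightarrow> bool" where
  "shift_factorization n D m \<alpha> \<tau> \<sigma> \<longleftrightarrow>
    (\<forall>x\<in>Cantor n. \<alpha> x < D \<and> \<tau> x \<in> Cantor n \<and> \<sigma> (\<alpha> x) (\<tau> x) = x \<and> \<tau> (suffix 1 x) = suffix 1 (\<tau> x)) \<and>
    (\<forall>a<D. \<forall>y\<in>Cantor n. \<sigma> a y \<in> Cantor n \<and> \<alpha> (\<sigma> a y) = a \<and> \<tau> (\<sigma> a y) = y) \<and>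
    (\<forall>x\<in>Cantor n. \<forall>x'\<in>Cantor n. (\<forall>i<m. x i = x' i) \<longrightarrow> \<alpha> x = \<alpha> x') \<and>
    (\<forall>j. \<forall>x\<in>Cantor n. \<forall>x'\<in>Cantor n. (\<forall>i<j + m. x i = x' i) \<longrightarrow> (\<forall>i<j. \<tau> x i = \<tau> x' i)) \<and>
    (\<forall>j. \<forall>a<D. \<forall>y\<in>Cantor n. \<forall>y'\<in>Cantor n. (\<forall>i<j. y i = y' i) \<longrightarrow> (\<forall>i<j. \<sigma> a y i = \<sigma> a y' i)) \<and>
    (\<forall>j. \<forall>a<D. \<forall>a'<D. \<forall>y\<in>Cantor n. \<forall>y'\<in>Cantor n. (\<forall>i\<ge>j. y i = y' i) \<longrightarrow>
       (\<forall>i\<ge>j + m. \<sigma> a y i = \<sigma> a' y' i))"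

lemma shift_factorizationD:
  assumes "shift_factorization n D m \<alpha> \<tau> \<sigma>"
  shows "x \<in> Cantor n \<Longrightarrow> \<alpha> x < D" "x \<in> Cantor n \<Longrightarrow> \<tau> x \<in> Cantor n"
    "x \<in> Cantor n \<Longrightarrow> \<sigma> (\<alpha> x) (\<tau> x) = x" "x \<in> Cantor n \<Longrightarrow> \<tau> (suffix 1 x) = suffix 1 (\<tau> x)"
    "a < D \<Longrightarrow> y \<in> Cantor n \<Longrightarrow> \<sigma> a y \<in> Cantor n" "a < D \<Longrightarrow> y \<in> Cantor n \<Longrightarrow> \<alpha> (\<sigma> a y) = a"
    "a < D \<Longrightarrow> y \<in> Cantor n \<Longrightarrow> \<tau> (\<sigma> a y) = y"
    "x \<in> Cantor n \<Longrightarrow> x' \<in> Cantor n \<Longrightarrow> (\<And>i. i < m \<Longrightarrow> x i = x' i) \<Longrightarrow> \<alpha> x = \<alpha> x'"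
    "x \<in> Cantor n \<Longrightarrow> x' \<in> Cantor n \<Longrightarrow> (\<And>i. i < j + m \<Longrightarrow> x i = x' i) \<Longrightarrow> i < j \<Longrightarrow> \<tau> x i = \<tau> x' i"
    "a < D \<Longrightarrow> y \<in> Cantor n \<Longrightarrow> y' \<in> Cantor n \<Longrightarrow> (\<And>i. i < j \<Longrightarrow> y i = y' i) \<Longrightarrow> i < j \<Longrightarrow>
      \<sigma> a y i = \<sigma> a y' i"
    "a < D \<Longrightarrow> a' < D \<Longrightarrow> y \<in> Cantor n \<Longrightarrow> y' \<in> Cantor n \<Longrightarrow> (\<And>i. j \<le> i \<Longrightarrow> y i = y' i) \<Longrightarrow>
      j + m \<le> i \<Longrightarrow> \<sigma> a y i = \<sigma> a' y' i"
  using assms unfolding shift_factorization_def by meson+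

lemma shift_factorization_id: "shift_factorization n 1 0 (\<lambda>_. 0) (\<lambda>x. x) (\<lambda>_ y. y)"
  by (simp add: shift_factorization_def)

text \<open>A pair of symbols is coded as \<open>a * D2 + b\<close>. Window sizes add up because
  \<tau>2 needs \<open>j + m2\<close> letters of its input, for which \<tau>1 needs
  \<open>j + m2 + m1\<close> letters.\<close>

lemma shift_factorization_compose:
  assumes F1: "shift_factorization n D1 m1 \<alpha>1 \<tau>1 \<sigma>1" and F2: "shift_factorization n D2 m2 \<alpha>2 \<tau>2 \<sigma>2"
  shows "shift_factorization n (D1 * D2) (m1 + m2) (\<lambda>x. \<alpha>1 x * D2 + \<alpha>2 (\<tau>1 x)) (\<lambda>x. \<tau>2 (\<tau>1 x))
    (\<lambda>a y. \<sigma>1 (a div D2) (\<sigma>2 (a mod D2) y))"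
proof -
  note d1 = shift_factorizationD[OF F1] and d2 = shift_factorizationD[OF F2]
  have div: "a div D2 < D1 \<and> a mod D2 < D2" if "a < D1 * D2" for a
  proof -
    have "D2 > 0" using that by (cases "D2 = 0") auto
    then show ?thesis using less_mult_imp_div_less[OF that] by simp
  qed
  have lt: "b * D2 + c < D1 * D2" if "b < D1" "c < D2" for b c
  proof -
    have "b * D2 + c < (b + 1) * D2" using that by simp
    also have "\<dots> \<le> D1 * D2" using that by (intro mult_le_mono1) simp
    finally show ?thesis .
  qed
  show ?thesis
    unfolding shift_factorization_def
  proof (intro conjI ballI allI impI)
    fix x assume x: "x \<in> Cantor n"
    have \<tau>1: "\<tau>1 x \<in> Cantor n" by (rule d1(2)[OF x])
    show "\<alpha>1 x * D2 + \<alpha>2 (\<tau>1 x) < D1 * D2" by (rule lt[OF d1(1)[OF x] d2(1)[OF \<tau>1]])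
    show "\<tau>2 (\<tau>1 x) \<in> Cantor n" by (rule d2(2)[OF \<tau>1])
    have "\<alpha>2 (\<tau>1 x) < D2" by (rule d2(1)[OF \<tau>1])
    then have "(\<alpha>1 x * D2 + \<alpha>2 (\<tau>1 x)) div D2 = \<alpha>1 x" "(\<alpha>1 x * D2 + \<alpha>2 (\<tau>1 x)) mod D2 = \<alpha>2 (\<tau>1 x)"
      by auto
    then show "\<sigma>1 ((\<alpha>1 x * D2 + \<alpha>2 (\<tau>1 x)) div D2) (\<sigma>2 ((\<alpha>1 x * D2 + \<alpha>2 (\<tau>1 x)) mod D2) (\<tau>2 (\<tau>1 x))) = x"
      using x d1(1-3) d2(1-3) by simp
    show "\<tau>2 (\<tau>1 (suffix 1 x)) = suffix 1 (\<tau>2 (\<tau>1 x))"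
      using d1(4)[OF x] d2(4)[OF d1(2)[OF x]] by simp
  next
    fix a y assume a: "a < D1 * D2" and y: "y \<in> Cantor n"
    note a' = div[OF a]
    have y2: "\<sigma>2 (a mod D2) y \<in> Cantor n" using d2(5) a' y by blast
    show "\<sigma>1 (a div D2) (\<sigma>2 (a mod D2) y) \<in> Cantor n" using d1(5) a' y2 by blast
    show "\<alpha>1 (\<sigma>1 (a div D2) (\<sigma>2 (a mod D2) y)) * D2 + \<alpha>2 (\<tau>1 (\<sigma>1 (a div D2) (\<sigma>2 (a mod D2) y))) = a"
      using d1(6,7)[OF _ y2, of "a div D2"] d2(6)[OF _ y, of "a mod D2"] a' by simp
    show "\<tau>2 (\<tau>1 (\<sigma>1 (a div D2) (\<sigma>2 (a mod D2) y))) = y"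
      using d1(7)[OF _ y2, of "a div D2"] d2(7)[OF _ y, of "a mod D2"] a' by simp
  next
    fix x x' assume x: "x \<in> Cantor n" "x' \<in> Cantor n" and eq: "\<forall>i<m1 + m2. x i = x' i"
    have "\<tau>1 x i = \<tau>1 x' i" if "i < m2" for i
      using that eq by (intro d1(9)[OF x, of m2]) auto
    then have "\<alpha>2 (\<tau>1 x) = \<alpha>2 (\<tau>1 x')"
      using d1(2) x by (intro d2(8)) auto
    moreover have "\<alpha>1 x = \<alpha>1 x'" using eq by (intro d1(8)[OF x]) auto
    ultimately show "\<alpha>1 x * D2 + \<alpha>2 (\<tau>1 x) = \<alpha>1 x' * D2 + \<alpha>2 (\<tau>1 x')" by simp
  next
    fix j x x' i assume x: "x \<in> Cantor n" "x' \<in> Cantor n"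
      and eq: "\<forall>i<j + (m1 + m2). x i = x' i" and i: "i < j"
    have "\<tau>1 x i = \<tau>1 x' i" if "i < j + m2" for i
      using that eq by (intro d1(9)[OF x, of "j + m2"]) auto
    then show "\<tau>2 (\<tau>1 x) i = \<tau>2 (\<tau>1 x') i"
      using d1(2) x i by (intro d2(9)[of _ _ j]) auto
  next
    fix j a y y' i assume a: "a < D1 * D2" and y: "y \<in> Cantor n" "y' \<in> Cantor n"
      and eq: "\<forall>i<j. y i = y' i" and i: "i < j"
    note a' = div[OF a]
    have "\<sigma>2 (a mod D2) y i = \<sigma>2 (a mod D2) y' i" if "i < j" for i
      using that eq a' y by (intro d2(10)[of _ _ _ j]) auto
    then show "\<sigma>1 (a div D2) (\<sigma>2 (a mod D2) y) i = \<sigma>1 (a div D2) (\<sigma>2 (a mod D2) y') i"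
      using d2(5) a' y i by (intro d1(10)[of _ _ _ j]) auto
  next
    fix j a b y y' i assume a: "a < D1 * D2" "b < D1 * D2" and y: "y \<in> Cantor n" "y' \<in> Cantor n"
      and eq: "\<forall>i\<ge>j. y i = y' i" and i: "j + (m1 + m2) \<le> i"
    note a' = div[OF a(1)] div[OF a(2)]
    have "\<sigma>2 (a mod D2) y i = \<sigma>2 (b mod D2) y' i" if "j + m2 \<le> i" for i
      using that eq a' y by (intro d2(11)[of _ _ _ _ j]) auto
    then show "\<sigma>1 (a div D2) (\<sigma>2 (a mod D2) y) i = \<sigma>1 (b div D2) (\<sigma>2 (b mod D2) y') i"
      using d2(5) a' y i by (intro d1(11)[of _ _ _ _ "j + m2"]) auto
  qed
qed

fun index :: "letter \<Rightarrow> nat" where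
  "index (Dotted i) = i"
| "index (Plain i) = i"

lemma in_Cantor_iff: "x \<in> Cantor n \<longleftrightarrow> (\<forall>i. Plain (index (x i)) = x i \<and> index (x i) < n)"
proof -
  have "l \<in> alphabet n \<longleftrightarrow> Plain (index l) = l \<and> index l < n" for l
    by (cases l) (auto simp: alphabet_def)
  then show ?thesis by (simp add: Cantor_def)
qed

text \<open>With \<open>n = d * e\<close> a letter is a pair in \<open>X\<^sub>d \<times> X\<^sub>e\<close>, and the sequence
  \<open>(a\<^sub>0, b\<^sub>0) (a\<^sub>1, b\<^sub>1) \<dots>\<close> is regrouped as \<open>a\<^sub>0\<close> followed by \<open>(b\<^sub>0, a\<^sub>1) (b\<^sub>1, a\<^sub>2) \<dots>\<close>.\<close>

lemma shift_factorization_divisor: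
  assumes n: "n = d * e" "n \<ge> 1"
  shows "shift_factorization n d 1 (\<lambda>x. index (x 0) div e)
    (\<lambda>x j. Plain (index (x j) mod e * d + index (x (Suc j)) div e))
    (\<lambda>a y j. Plain ((if j = 0 then a else index (y (j - 1)) mod d) * e + index (y j) div d))"
    (is "shift_factorization n d 1 ?\<alpha> ?\<tau> ?\<sigma>")
proof -
  have pos: "d > 0" "e > 0" using n by (auto intro: Nat.gr0I)
  have lt: "b * e' + c < d' * e'" if "b < d'" "c < e'" for b c d' e' :: nat
  proof -
    have "b * e' + c < (b + 1) * e'" using that by simp
    also have "\<dots> \<le> d' * e'" using that by (intro mult_le_mono1) simp
    finally show ?thesis .
  qed
  \<comment> \<open>Two codings of pairs are in play: \<open>i div e\<close> and
    \<open>i mod e\<close> split a letter of the original sequence, while \<open>i div d\<close> and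
    \<open>i mod d\<close> split a regrouped letter, in which the component from \<open>X_d\<close>
    comes second.\<close>
  have divd: "i div e < d" if "i < n" for i
    using that n(1) by (simp add: less_mult_imp_div_less)
  have dive: "i div d < e" if "i < n" for i
    using that n(1) by (simp add: less_mult_imp_div_less mult.commute)
  have \<tau>: "?\<tau> x \<in> Cantor n" if "x \<in> Cantor n" for x
  proof -
    have "index (x j) mod e * d + index (x (Suc j)) div e < e * d" for j
      using that divd pos by (intro lt) (simp_all add: in_Cantor_iff)
    then show ?thesis by (simp add: in_Cantor_iff n(1) mult.commute[of d])
  qed
  have \<sigma>: "?\<sigma> a y \<in> Cantor n" if "a < d" "y \<in> Cantor n" for a y
  proof -
    have "(if j = 0 then a else index (y (j - 1)) mod d) * e + index (y j) div d < d * e" for j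
      using that dive pos by (intro lt) (simp_all add: in_Cantor_iff)
    then show ?thesis by (simp add: in_Cantor_iff n(1))
  qed
  have \<sigma>\<tau>: "?\<sigma> (?\<alpha> x) (?\<tau> x) = x" if x: "x \<in> Cantor n" for x
  proof
    fix j
    have j: "index (x (Suc j)) div e < d" "Plain (index (x j)) = x j" for j
      using x divd by (auto simp: in_Cantor_iff)
    show "?\<sigma> (?\<alpha> x) (?\<tau> x) j = x j"
      using j pos by (cases j) auto
  qed
  have \<tau>\<sigma>: "?\<tau> (?\<sigma> a y) = y" if y: "y \<in> Cantor n" for a y
  proof
    fix j
    have j: "index (y j) div d < e" "Plain (index (y j)) = y j" for j
      using y dive by (auto simp: in_Cantor_iff)
    show "?\<tau> (?\<sigma> a y) j = y j"
      using j pos by simp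
  qed
  have \<alpha>\<sigma>: "?\<alpha> (?\<sigma> a y) = a" if "y \<in> Cantor n" for a y
    using that dive[of "index (y 0)"] pos by (simp add: in_Cantor_iff)
  show ?thesis
    unfolding shift_factorization_def
  proof (intro conjI ballI allI impI)
    fix x assume x: "x \<in> Cantor n"
    show "?\<alpha> x < d" using x divd by (simp add: in_Cantor_iff)
    show "?\<tau> (suffix 1 x) = suffix 1 (?\<tau> x)" by (simp add: fun_eq_iff)
  next
    fix j a a' i :: nat and y y'
    assume eq: "\<forall>i\<ge>j. y i = (y' i :: letter)" and i: "j + 1 \<le> i"
    \<comment> \<open>The symbol \<open>a\<close> enters only at position 0, and every later letter
      looks one position back, so a delay of one letter suffices.\<close>
    then have "y (i - 1) = y' (i - 1)" "y i = y' i" by auto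
    then show "?\<sigma> a y i = ?\<sigma> a' y' i" using i by simp
  qed (use \<tau> \<sigma> \<sigma>\<tau> \<tau>\<sigma> \<alpha>\<sigma> in auto)
qed

lemma shift_factorization_prod_list:
  assumes n: "n \<ge> 1" and "\<forall>d\<in>set ds. d dvd n"
  shows "\<exists>m \<alpha> \<tau> \<sigma>. shift_factorization n (prod_list ds) m \<alpha> \<tau> \<sigma>"
  using assms(2)
proof (induction ds)
  case Nil
  then show ?case using shift_factorization_id by fastforce
next
  case (Cons d ds)
  then obtain m \<alpha> \<tau> \<sigma> where F: "shift_factorization n (prod_list ds) m \<alpha> \<tau> \<sigma>" by auto
  obtain e where "n = d * e" using Cons.prems by auto
  then show ?case
    using shift_factorization_compose[OF shift_factorization_divisor F] n by fastforce
qed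


section \<open>Complete prefix codes\<close>

text \<open>The \<open>r\<close> dotted letters form a code, and replacing a word by its
  \<open>n\<close> one-letter extensions adds \<open>n - 1\<close> words.\<close>

lemma complete_code_exists:
  assumes n: "n \<ge> 2" and r: "r \<ge> 1"
  shows "\<exists>P\<subseteq>dotted_words n r. cone_partition n P (dotted_Cantor n r) \<and> card P = r + k * (n - 1)"
proof (induction k)
  case 0
  let ?P = "(\<lambda>a. [a]) ` dotted_alphabet r"
  have "(\<Union>v\<in>?P. cone n v) = dotted_Cantor n r"
    by (auto simp: cone_def dotted_Cantor_def)
  moreover have "disjoint_family_on (cone n) ?P"
    unfolding disjoint_family_on_def using cones_same_length_disjoint by auto
  ultimately have "cone_partition n ?P (dotted_Cantor n r)"
    by (simp add: cone_partition_def dotted_alphabet_def)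
  moreover have "card ?P = r"
    by (simp add: dotted_alphabet_def card_image inj_on_def)
  moreover have "?P \<subseteq> dotted_words n r" by (auto simp: Cons_in_dotted_words_iff)
  ultimately show ?case by (intro exI[of _ ?P]) simp
next
  case (Suc k)
  then obtain P where P: "P \<subseteq> dotted_words n r" "cone_partition n P (dotted_Cantor n r)"
      "card P = r + k * (n - 1)" by blast
  have fin: "finite P" using P(2) by (simp add: cone_partition_def)
  then obtain v where v: "v \<in> P" using P(3) r by (cases "P = {}") auto
  define E where "E = (\<lambda>t. v @ t) ` words_of_length n 1"
  define V where "V u = (if u = v then E else {u})" for u
  have E: "cone_partition n E (cone n v)"
  proof -
    have "disjoint_family_on (cone n) E"
      unfolding disjoint_family_on_def E_def
    proof (intro ballI impI)
      fix s t assume "s \<in> (\<lambda>t. v @ t) ` words_of_length n 1" "t \<in> (\<lambda>t. v @ t) ` words_of_length n 1" "s \<noteq> t"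
      then show "cone n s \<inter> cone n t = {}"
        by (intro cones_same_length_disjoint) (auto simp: words_of_length_def)
    qed
    then show ?thesis
      using cone_UN_extensions[of n v 1] finite_words_of_length by (simp add: cone_partition_def E_def)
  qed
  have "cone_partition n (\<Union>u\<in>P. V u) (\<Union>u\<in>P. cone n u)"
    using P(2) E cone_partition_cone fin
    by (intro cone_partition_UN) (auto simp: cone_partition_def V_def)
  moreover have UV: "(\<Union>u\<in>P. V u) = (P - {v}) \<union> E"
    using v by (auto simp: V_def split: if_splits)
  moreover have "(\<Union>u\<in>P. cone n u) = dotted_Cantor n r" using P(2) by (simp add: cone_partition_def)
  ultimately have part: "cone_partition n ((P - {v}) \<union> E) (dotted_Cantor n r)" by simp
  have "(P - {v}) \<inter> E = {}"
  proof (rule ccontr)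
    assume "(P - {v}) \<inter> E \<noteq> {}"
    then obtain u where u: "u \<in> P" "u \<noteq> v" "u \<in> E" by blast
    then have "cone n u \<subseteq> cone n v" using E by (auto simp: cone_partition_def)
    moreover have "cone n u \<inter> cone n v = {}"
      using P(2) u v by (simp add: cone_partition_def disjoint_family_on_def)
    ultimately show False using cone_nonempty[of n u] n by auto
  qed
  moreover have "finite E" "card E = n"
    using finite_words_of_length card_words_of_length[of n 1] by (auto simp: E_def card_image inj_on_def)
  moreover have "card (P - {v}) = r + k * (n - 1) - 1" using P(3) v fin by simp
  ultimately have "card ((P - {v}) \<union> E) = r + Suc k * (n - 1)"
    using fin n r by (subst card_Un_disjoint) auto
  moreover have "(P - {v}) \<union> E \<subseteq> dotted_words n r"
    using P(1) v append_in_dotted_words[of v n r] by (auto simp: E_def words_of_length_def)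
  ultimately show ?case using part by blast
qed


section \<open>A homeomorphism with prescribed signature\<close>

text \<open>The bijection \<rho> names code words by pairs: the cone of \<open>\<rho> (i, a)\<close>
  receives copy \<open>a\<close> of the factored cone of \<open>[Dotted i]\<close>.\<close>

locale code_homeo =
  fixes n D m :: nat and \<alpha> \<tau> \<sigma> and P :: "letter list set" and \<rho> :: "nat \<times> nat \<Rightarrow> letter list"
  assumes n2: "n \<ge> 2"
    and factor: "shift_factorization n D m \<alpha> \<tau> \<sigma>"
    and P: "P \<subseteq> dotted_words n (n - 1)" "cone_partition n P (dotted_Cantor n (n - 1))"
    and \<rho>: "bij_betw \<rho> ({..<n - 1} \<times> {..<D}) P"
begin

lemmas factorD = shift_factorizationD[OF factor]

lemma n1: "n - 1 \<ge> 1"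
  using n2 by simp

abbreviation "dC \<equiv> dotted_Cantor n (n - 1)"

definition h :: "(nat \<Rightarrow> letter) \<Rightarrow> nat \<Rightarrow> letter" where
  "h x = \<rho> (index (x 0), \<alpha> (suffix 1 x)) \<frown> \<tau> (suffix 1 x)"

definition code :: "(nat \<Rightarrow> letter) \<Rightarrow> letter list" where
  "code y = (THE p. p \<in> P \<and> is_prefix p y)"

definition g :: "(nat \<Rightarrow> letter) \<Rightarrow> nat \<Rightarrow> letter" where
  "g y = (case inv_into ({..<n - 1} \<times> {..<D}) \<rho> (code y) of
     (i, a) \<Rightarrow> [Dotted i] \<frown> \<sigma> a (suffix (length (code y)) y))"

lemma dC_cases:
  assumes "x \<in> dC"
  obtains i z where "x = [Dotted i] \<frown> z" "i < n - 1" "z \<in> Cantor n"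
  using assms by (auto simp: dotted_Cantor_def dotted_alphabet_def)

lemma dC_I: "i < n - 1 \<Longrightarrow> z \<in> Cantor n \<Longrightarrow> [Dotted i] \<frown> z \<in> dC"
  unfolding conc_in_dotted_Cantor_iff[of "[Dotted i]", OF not_Cons_self2]
  by (auto simp: Cons_in_dotted_words_iff dotted_alphabet_def)

lemma h_dotted: "h ([Dotted i] \<frown> z) = \<rho> (i, \<alpha> z) \<frown> \<tau> z"
  using suffix_conc_length[of "[Dotted i]" z] by (simp add: h_def)

lemma \<rho>_P: "i < n - 1 \<Longrightarrow> a < D \<Longrightarrow> \<rho> (i, a) \<in> P"
  using \<rho> by (auto simp: bij_betw_def)

lemma P_cases:
  assumes "p \<in> P"
  obtains i a where "i < n - 1" "a < D" "p = \<rho> (i, a)"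
  using assms \<rho> by (force simp: bij_betw_def)

lemma P_unique: "p \<in> P \<Longrightarrow> q \<in> P \<Longrightarrow> p \<frown> x = q \<frown> y \<Longrightarrow> x \<in> Cantor n \<Longrightarrow> y \<in> Cantor n \<Longrightarrow> p = q"
proof (rule ccontr)
  assume "p \<in> P" "q \<in> P" and eq: "p \<frown> x = q \<frown> y" "x \<in> Cantor n" "y \<in> Cantor n" and "p \<noteq> q"
  then have "cone n p \<inter> cone n q = {}"
    using P(2) by (simp add: cone_partition_def disjoint_family_on_def)
  moreover have "p \<frown> x \<in> cone n p" unfolding cone_def using eq(2) by blast
  moreover have "p \<frown> x \<in> cone n q" unfolding eq(1) cone_def using eq(3) by blast
  ultimately show False by blast
qed

lemma dC_P_cases:
  assumes "y \<in> dC"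
  obtains i a z where "y = \<rho> (i, a) \<frown> z" "i < n - 1" "a < D" "z \<in> Cantor n"
proof -
  obtain p where "p \<in> P" "y \<in> cone n p" using assms P(2) by (auto simp: cone_partition_def)
  then show thesis using that by (auto simp: cone_def elim!: P_cases)
qed

lemma code_conc: "p \<in> P \<Longrightarrow> z \<in> Cantor n \<Longrightarrow> code (p \<frown> z) = p"
proof -
  assume p: "p \<in> P" and z: "z \<in> Cantor n"
  show ?thesis
    unfolding code_def
  proof (rule the_equality)
    fix q assume q: "q \<in> P \<and> is_prefix q (p \<frown> z)"
    then have "p \<frown> z = q \<frown> suffix (length q) (p \<frown> z)" using is_prefix_iff_conc by blast
    moreover have "q \<noteq> []" using q P(1) by auto
    moreover have "p \<frown> z \<in> dC"
      using p z P(1) conc_in_dotted_Cantor_iff dotted_words_nonempty by blast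
    ultimately show "q = p"
      using P_unique[of q p] q p z suffix_in_Cantor_of_dotted[of "p \<frown> z" n "n - 1" "length q"]
      by (metis length_greater_0_conv)
  qed (use p in simp)
qed

lemma g_\<rho>:
  assumes "i < n - 1" "a < D" "z \<in> Cantor n"
  shows "g (\<rho> (i, a) \<frown> z) = [Dotted i] \<frown> \<sigma> a z"
proof -
  have "inv_into ({..<n - 1} \<times> {..<D}) \<rho> (\<rho> (i, a)) = (i, a)"
    using \<rho> assms by (auto simp: bij_betw_def intro: inv_into_f_f)
  then show ?thesis
    using code_conc[OF \<rho>_P] assms by (simp add: g_def)
qed

lemma maps_h: "x \<in> dC \<Longrightarrow> h x \<in> dC"
proof -
  assume "x \<in> dC"
  then obtain i z where x: "x = [Dotted i] \<frown> z" "i < n - 1" "z \<in> Cantor n" by (rule dC_cases)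
  then have "\<rho> (i, \<alpha> z) \<in> dotted_words n (n - 1)" using \<rho>_P factorD(1) P(1) by blast
  then show ?thesis
    unfolding x(1) h_dotted using factorD(2)[OF x(3)] conc_in_dotted_Cantor_iff dotted_words_nonempty
    by blast
qed

lemma maps_g: "y \<in> dC \<Longrightarrow> g y \<in> dC"
  using g_\<rho> factorD(5) dC_I by (metis dC_P_cases)

lemma g_h: "x \<in> dC \<Longrightarrow> g (h x) = x"
  using g_\<rho> factorD(1,2,3) h_dotted by (metis dC_cases)

lemma h_g: "y \<in> dC \<Longrightarrow> h (g y) = y"
  using g_\<rho> factorD(5,6,7) h_dotted by (metis dC_P_cases)

lemma uniformly_determined_h: "uniformly_determined n (n - 1) h"
  unfolding uniformly_determined_def
proof (intro allI exI ballI impI)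
  fix j i x y assume xy: "x \<in> dC" "y \<in> dC" and eq: "\<forall>i<Suc (j + m). x i = y i" and i: "i < j"
  obtain a z where x: "x = [Dotted a] \<frown> z" "a < n - 1" "z \<in> Cantor n" using dC_cases[OF xy(1)] .
  obtain b w where y: "y = [Dotted b] \<frown> w" "b < n - 1" "w \<in> Cantor n" using dC_cases[OF xy(2)] .
  have ab: "a = b" using eq[rule_format, of 0] x(1) y(1) by simp
  have zw: "z i = w i" if "i < j + m" for i
    using eq[rule_format, of "Suc i"] x(1) y(1) that by simp
  have "\<alpha> z = \<alpha> w" using zw by (intro factorD(8) x y) simp
  moreover have "\<tau> z i = \<tau> w i" if "i < j" for i
    using zw that by (intro factorD(9)[of _ _ j] x y) auto
  ultimately show "h x i = h y i"
    unfolding x(1) y(1) h_dotted using i ab by (simp add: conc_def)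
qed

definition L :: nat where "L = Max (length ` P)"

lemma length_le_L: "p \<in> P \<Longrightarrow> length p \<le> L"
  using P(2) by (simp add: L_def cone_partition_def)

lemma uniformly_determined_g: "uniformly_determined n (n - 1) g"
  unfolding uniformly_determined_def
proof (intro allI exI ballI impI)
  fix j i x y assume xy: "x \<in> dC" "y \<in> dC" and eq: "\<forall>i<L + j. x i = y i" and i: "i < j"
  obtain k a z where x: "x = \<rho> (k, a) \<frown> z" "k < n - 1" "a < D" "z \<in> Cantor n" using dC_P_cases[OF xy(1)] .
  let ?p = "\<rho> (k, a)"
  have p: "?p \<in> P" "length ?p \<le> L" using \<rho>_P length_le_L x by auto
  define w where "w = suffix (length ?p) y"
  have "is_prefix ?p y"
    using eq p(2) x(1) by (intro is_prefixI) (auto simp: conc_def split: if_splits dest!: spec)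
  then have y: "y = ?p \<frown> w" using is_prefix_iff_conc by (simp add: w_def)
  have w: "w \<in> Cantor n"
    using xy(2) y p(1) P(1) conc_in_dotted_Cantor_iff dotted_words_nonempty by blast
  have "z i = w i" if "i < j" for i
    using eq[rule_format, of "length ?p + i"] that p(2) unfolding x(1) y by simp
  then have "\<sigma> a z i = \<sigma> a w i" if "i < j" for i
    using that by (intro factorD(10)[of _ _ _ j] x w) auto
  then show "g x i = g y i"
    unfolding x(1) y g_\<rho>[OF x(2,3,4)] g_\<rho>[OF x(2,3) w] using i by (simp add: conc_def)
qed

lemma homeo: "homeomorphic_maps (dotted_Cantor_space n (n - 1)) (dotted_Cantor_space n (n - 1)) h g"
  unfolding homeomorphic_maps_def continuous_map_iff_uniformly_determined topspace_dotted_Cantor_space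
  using maps_h maps_g g_h h_g uniformly_determined_h uniformly_determined_g by blast

section \<open>Both directions forget the past\<close>

lemma suffix_\<tau>: "x \<in> Cantor n \<Longrightarrow> suffix k (\<tau> x) = \<tau> (suffix k x)"
proof (induction k)
  case (Suc k)
  have "suffix (Suc k) (\<tau> x) = suffix 1 (suffix k (\<tau> x))" by simp
  also have "\<dots> = \<tau> (suffix 1 (suffix k x))"
    by (simp only: Suc.IH[OF Suc.prems] factorD(4)[OF suffix_in_Cantor[OF Suc.prems]])
  also have "suffix 1 (suffix k x) = suffix (Suc k) x" by simp
  finally show ?case .
qed simp

text \<open>What remains after deleting \<open>k\<close> letters is mapped by \<tau> to the
  shortened \<open>y\<close>, so by bijectivity of the factorization it is again a value of \<sigma>
  there. The new symbol \<open>b\<close> depends on what was deleted.\<close>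

lemma suffix_\<sigma>:
  assumes "a < D" "y \<in> Cantor n"
  shows "\<exists>b<D. suffix k (\<sigma> a y) = \<sigma> b (suffix k y)"
proof -
  have s: "suffix k (\<sigma> a y) \<in> Cantor n" using factorD(5)[OF assms] suffix_in_Cantor by blast
  have "\<tau> (suffix k (\<sigma> a y)) = suffix k y"
    using suffix_\<tau>[OF factorD(5)[OF assms]] factorD(7)[OF assms] by simp
  then show ?thesis
    using factorD(1,3)[OF s] by metis
qed

lemma eq_conc_prefix:
  assumes "\<And>i. i < k \<Longrightarrow> x i = y i"
  shows "x = Omega_Words_Fun.prefix k y \<frown> suffix k x"
  using assms by (auto simp: conc_def fun_eq_iff)

text \<open>The window of \<alpha> has \<open>m\<close> letters, all within \<open>w @ v\<close>, so
  the code word is fixed. The first \<open>length w\<close> letters of the regrouped sequence are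
  fixed as well, and shift invariance turns the rest into \<open>\<tau> (v \<frown> x)\<close>, in
  which \<open>u\<close> no longer occurs.\<close>

lemma h_forget:
  assumes u: "u \<in> dotted_words n (n - 1)" and v: "v \<in> lists (alphabet n)" "length v = m"
  shows "\<exists>p. \<forall>x\<in>Cantor n. h ((u @ v) \<frown> x) = p \<frown> \<tau> (v \<frown> x)"
proof -
  obtain i w where w: "u = Dotted i # w" "i < n - 1" "w \<in> lists (alphabet n)"
    using u by (auto simp: dotted_words_def dotted_alphabet_def)
  obtain x0 where x0: "x0 \<in> Cantor n" using Cantor_nonempty[of n] n2 by auto
  let ?z = "\<lambda>x. (w @ v) \<frown> x"
  have z: "?z x \<in> Cantor n" if "x \<in> Cantor n" for x
    using that w v by (simp add: conc_in_Cantor_iff)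
  have "h ((u @ v) \<frown> x) = (\<rho> (i, \<alpha> (?z x0)) @ Omega_Words_Fun.prefix (length w) (\<tau> (?z x0))) \<frown> \<tau> (v \<frown> x)"
    if x: "x \<in> Cantor n" for x
  proof -
    have eq: "?z x k = ?z x0 k" if "k < length w + m" for k
      using that v(2) by simp
    have "(u @ v) \<frown> x = [Dotted i] \<frown> ?z x" by (simp add: w(1))
    then have "h ((u @ v) \<frown> x) = \<rho> (i, \<alpha> (?z x)) \<frown> \<tau> (?z x)" using h_dotted by metis
    moreover have "\<alpha> (?z x) = \<alpha> (?z x0)" using eq by (intro factorD(8) z x x0) simp
    moreover have "\<tau> (?z x) = Omega_Words_Fun.prefix (length w) (\<tau> (?z x0)) \<frown> suffix (length w) (\<tau> (?z x))"
      using eq by (intro eq_conc_prefix factorD(9)[of _ _ "length w"] z x x0)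
    moreover have "suffix (length w) (\<tau> (?z x)) = \<tau> (v \<frown> x)"
      using suffix_\<tau>[OF z[OF x], of "length w"] by simp
    ultimately show ?thesis by (metis conc_conc)
  qed
  then show ?thesis by blast
qed

text \<open>Of the \<open>L + m\<close> letters, \<open>L\<close> are enough to complete the code
  word, which may end inside \<open>v\<close>. The symbol reached before the last \<open>m\<close>
  letters is unknown, but its influence ends after \<open>m\<close> positions; \<open>0\<close>
  stands for a symbol chosen independently of \<open>u\<close>.\<close>

lemma g_forget:
  assumes u: "u \<in> dotted_words n (n - 1)" and v: "v \<in> lists (alphabet n)" "length v = L + m"
  shows "\<exists>p. \<forall>x\<in>Cantor n. g ((u @ v) \<frown> x) = p \<frown> suffix m (\<sigma> 0 (drop L v \<frown> x))"
proof -
  obtain x0 where x0: "x0 \<in> Cantor n" using Cantor_nonempty[of n] n2 by auto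
  have uv: "u @ v \<in> dotted_words n (n - 1)" using append_in_dotted_words u v by blast
  have in_dC: "(u @ v) \<frown> x \<in> dC" if "x \<in> Cantor n" for x
    using that uv conc_in_dotted_Cantor_iff dotted_words_nonempty by blast
  obtain i a z where z: "(u @ v) \<frown> x0 = \<rho> (i, a) \<frown> z" "i < n - 1" "a < D" "z \<in> Cantor n"
    using dC_P_cases[OF in_dC[OF x0]] .
  let ?p = "\<rho> (i, a)"
  have p: "?p \<in> P" "length ?p \<le> L" "?p \<in> dotted_words n (n - 1)" using \<rho>_P length_le_L P(1) z by auto
  define w where "w = drop (length ?p) (u @ v)"
  have uvw: "u @ v = ?p @ w"
    unfolding w_def using p(2) v(2) z(1)
    by (intro is_prefix_take[of _ "(u @ v) \<frown> x0"]) (simp, metis is_prefix_conc, simp)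
  have w: "w \<in> lists (alphabet n)"
    using uv uvw append_in_dotted_words_iff[OF dotted_words_nonempty[OF p(3)]] by metis
  \<comment> \<open>\<open>w\<close> is what follows the code word. As code words have length at
    most \<open>L\<close>, its last \<open>m\<close> letters are \<open>drop L v\<close>.\<close>
  define w1 where "w1 = take (length w - m) w"
  have lw: "m \<le> length w" using p(2) v(2) by (simp add: w_def)
  have w1: "w = w1 @ drop L v" "length w1 = length w - m"
  proof -
    have "drop (length w - m) w = drop L v"
      using p(2) v(2) by (simp add: w_def)
    then show "w = w1 @ drop L v" unfolding w1_def by (metis append_take_drop_id)
    show "length w1 = length w - m" by (simp add: w1_def)
  qed
  have D: "0 < D" using z(3) by simp
  have "g ((u @ v) \<frown> x) = ([Dotted i] @ Omega_Words_Fun.prefix (length w) (\<sigma> a (w \<frown> x0))) \<frown>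
      suffix m (\<sigma> 0 (drop L v \<frown> x))" if x: "x \<in> Cantor n" for x
  proof -
    have wx: "w \<frown> y \<in> Cantor n" "drop L v \<frown> y \<in> Cantor n" if "y \<in> Cantor n" for y
      using that w w1(1) by (auto simp: conc_in_Cantor_iff)
    have "(u @ v) \<frown> x = ?p \<frown> (w \<frown> x)" using uvw by simp
    then have "g ((u @ v) \<frown> x) = [Dotted i] \<frown> \<sigma> a (w \<frown> x)"
      using g_\<rho>[OF z(2,3) wx(1)[OF x]] by metis
    moreover have "\<sigma> a (w \<frown> x) = Omega_Words_Fun.prefix (length w) (\<sigma> a (w \<frown> x0)) \<frown> suffix (length w) (\<sigma> a (w \<frown> x))"
      using z(3) wx x x0 by (intro eq_conc_prefix factorD(10)[of _ _ _ "length w"]) auto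
    moreover have "suffix (length w) (\<sigma> a (w \<frown> x)) = suffix m (\<sigma> 0 (drop L v \<frown> x))"
    proof -
      obtain b where b: "b < D" "suffix (length w1) (\<sigma> a (w \<frown> x)) = \<sigma> b (suffix (length w1) (w \<frown> x))"
        using suffix_\<sigma>[OF z(3) wx(1)[OF x]] by blast
      have "suffix (length w1) (w \<frown> x) = drop L v \<frown> x"
        by (subst w1(1)) simp
      moreover have "suffix (length w) (\<sigma> a (w \<frown> x)) = suffix m (suffix (length w1) (\<sigma> a (w \<frown> x)))"
        using w1(2) lw by simp
      \<comment> \<open>The two inputs coincide from position 0 on, so the outputs coincide from
        position \<open>m\<close> on, whatever the symbols are.\<close>
      moreover have "\<sigma> b (drop L v \<frown> x) k = \<sigma> 0 (drop L v \<frown> x) k" if "m \<le> k" for k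
        using that by (intro factorD(11)[of _ _ _ _ 0] b D wx x) auto
      ultimately show ?thesis using b(2) by (intro ext) simp
    qed
    ultimately show ?thesis by (metis conc_conc)
  qed
  then show ?thesis by blast
qed

lemma h_in_B: "h \<in> B n (n - 1)"
proof -
  have "tame_map n (n - 1) h m"
  proof (rule tame_map.intro[OF n2 n1 maps_h _ uniformly_determined_h])
    show "inj_on h dC" by (metis inj_onI g_h)
  next
    fix u u' v
    assume u: "u \<in> dotted_words n (n - 1)" "u' \<in> dotted_words n (n - 1)"
      and v: "v \<in> lists (alphabet n)" "length v = m"
    obtain p p' where "\<forall>x\<in>Cantor n. h ((u @ v) \<frown> x) = p \<frown> \<tau> (v \<frown> x)"
        "\<forall>x\<in>Cantor n. h ((u' @ v) \<frown> x) = p' \<frown> \<tau> (v \<frown> x)"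
      using h_forget[OF u(1) v] h_forget[OF u(2) v] by (elim exE) (rule that)
    then show "\<exists>p p' \<phi>. \<forall>x\<in>Cantor n. h ((u @ v) \<frown> x) = p \<frown> \<phi> x \<and> h ((u' @ v) \<frown> x) = p' \<frown> \<phi> x"
      by (intro exI[of _ p] exI[of _ p'] exI[of _ "\<lambda>x. \<tau> (v \<frown> x)"]) blast
  qed
  moreover have "tame_map n (n - 1) g (L + m)"
  proof (rule tame_map.intro[OF n2 n1 maps_g _ uniformly_determined_g])
    show "inj_on g dC" by (metis inj_onI h_g)
  next
    fix u u' v
    assume u: "u \<in> dotted_words n (n - 1)" "u' \<in> dotted_words n (n - 1)"
      and v: "v \<in> lists (alphabet n)" "length v = L + m"
    obtain p p' where "\<forall>x\<in>Cantor n. g ((u @ v) \<frown> x) = p \<frown> suffix m (\<sigma> 0 (drop L v \<frown> x))"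
        "\<forall>x\<in>Cantor n. g ((u' @ v) \<frown> x) = p' \<frown> suffix m (\<sigma> 0 (drop L v \<frown> x))"
      using g_forget[OF u(1) v] g_forget[OF u(2) v] by (elim exE) (rule that)
    then show "\<exists>p p' \<phi>. \<forall>x\<in>Cantor n. g ((u @ v) \<frown> x) = p \<frown> \<phi> x \<and> g ((u' @ v) \<frown> x) = p' \<frown> \<phi> x"
      by (intro exI[of _ p] exI[of _ p'] exI[of _ "\<lambda>x. suffix m (\<sigma> 0 (drop L v \<frown> x))"]) blast
  qed
  ultimately show ?thesis
    unfolding B_def using homeo tame_map.has_finite_sync_minimal_transducer by blast
qed

lemma image_h_cone: "h ` cone n [Dotted i] = (\<Union>a<D. cone n (\<rho> (i, a)))"
proof (intro equalityI subsetI)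
  fix y assume "y \<in> h ` cone n [Dotted i]"
  then obtain z where "z \<in> Cantor n" "y = \<rho> (i, \<alpha> z) \<frown> \<tau> z"
    using h_dotted unfolding cone_def by auto
  then show "y \<in> (\<Union>a<D. cone n (\<rho> (i, a)))"
    using factorD(1,2) unfolding cone_def by blast
next
  fix y assume "y \<in> (\<Union>a<D. cone n (\<rho> (i, a)))"
  then obtain a z where a: "a < D" "z \<in> Cantor n" "y = \<rho> (i, a) \<frown> z"
    unfolding cone_def by blast
  then have "y = h ([Dotted i] \<frown> \<sigma> a z)" "\<sigma> a z \<in> Cantor n"
    unfolding h_dotted using factorD(5,6,7) by auto
  then show "y \<in> h ` cone n [Dotted i]" unfolding cone_def by blast
qed

lemma reduced_signature: "reduced_signature n (Core n (n - 1) h) = ZMod (int n - 1) (int D)"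
proof -
  obtain s where s: "reduced_signature n (Core n (n - 1) h) = ZMod (int n - 1) s"
    "\<And>C c. C \<subseteq> dC \<Longrightarrow> has_cone_measure n C c \<Longrightarrow> has_cone_measure n (h ` C) (s * c)"
    by (rule reduced_signature_scales_measure[OF h_in_B n2 n1]) blast
  have "[Dotted 0] \<in> dotted_words n (n - 1)"
    using n2 by (simp add: Cons_in_dotted_words_iff dotted_alphabet_def)
  then have "has_cone_measure n (h ` cone n [Dotted 0]) (s * 1)"
    by (intro s(2) cone_subset_dotted_Cantor has_cone_measure_cone)
  moreover have "has_cone_measure n (h ` cone n [Dotted 0]) (int D)"
  proof -
    let ?V = "(\<lambda>a. \<rho> (0, a)) ` {..<D}"
    have V: "?V \<subseteq> P" using \<rho>_P n2 by auto
    have "cone_partition n ?V (h ` cone n [Dotted 0])"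
      using P(2) disjoint_family_on_mono[OF V, of "cone n"] unfolding image_h_cone cone_partition_def
      by simp
    moreover have "card ?V = D"
    proof -
      have "inj_on (\<lambda>a. \<rho> (0, a)) {..<D}"
      proof (rule inj_onI)
        fix a b assume "a \<in> {..<D}" "b \<in> {..<D}" "\<rho> (0, a) = \<rho> (0, b)"
        then have "(0, a) = (0 :: nat, b)"
          using \<rho> n2 by (intro inj_onD[of \<rho> "{..<n - 1} \<times> {..<D}"]) (auto simp: bij_betw_def)
        then show "a = b" by simp
      qed
      then show ?thesis by (simp add: card_image)
    qed
    ultimately show ?thesis using has_cone_measure_partition by metis
  qed
  ultimately have "[s * 1 = int D] (mod (int n - 1))"
    using has_cone_measure_unique n2 by fastforce
  then show ?thesis unfolding s(1) ZMod_eq_iff by simp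
qed

end

section \<open>Products of divisors and the units they generate\<close>

lemma reduced_signature_attains_product:
  assumes n: "n \<ge> 2" and ds: "\<forall>d\<in>set ds. d dvd n"
  shows "\<exists>h\<in>B n (n - 1). reduced_signature n (Core n (n - 1) h) = ZMod (int n - 1) (int (prod_list ds))"
proof -
  let ?D = "prod_list ds"
  obtain m \<alpha> \<tau> \<sigma> where F: "shift_factorization n ?D m \<alpha> \<tau> \<sigma>"
    using shift_factorization_prod_list ds n by fastforce
  \<comment> \<open>Positivity of \<open>?D\<close> makes \<open>?D - 1\<close> an honest number of
    splittings, which enlarges the code from \<open>n - 1\<close> to \<open>(n - 1) * ?D\<close>
    words.\<close>
  have "\<forall>d\<in>set ds. d \<noteq> 0" using ds n by (metis dvd_0_left_iff not_numeral_le_zero)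
  then have D: "?D \<ge> 1" by (induction ds) auto
  obtain P where P: "P \<subseteq> dotted_words n (n - 1)" "cone_partition n P (dotted_Cantor n (n - 1))"
      "card P = (n - 1) + (?D - 1) * (n - 1)"
  proof -
    have "1 \<le> n - 1" using n by simp
    from complete_code_exists[OF n this, of "?D - 1"] show thesis using that by blast
  qed
  have "card P = (n - 1) * ?D" unfolding P(3) using D by (cases ?D) auto
  then obtain \<rho> where "bij_betw \<rho> ({..<n - 1} \<times> {..<?D}) P"
    using finite_same_card_bij[of "{..<n - 1} \<times> {..<?D}" P] P(2) by (auto simp: cone_partition_def)
  then interpret code_homeo n ?D m \<alpha> \<tau> \<sigma> P \<rho>
    using n F P by unfold_locales
  show ?thesis using h_in_B reduced_signature by blast
qed

lemma cring_ZFact: "cring (ZFact k)"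
proof -
  interpret ideal "Idl\<^bsub>\<Z>\<^esub> {k}" \<Z>
    by (rule int.genideal_ideal) simp
  show ?thesis unfolding ZFact_def by (rule quotient_is_cring) (rule int_is_cring)
qed

text \<open>Inverses have to be eliminated, because the construction realizes products of divisors;
  the cofactor of \<open>d\<close> in \<open>n\<close> replaces the inverse of
  \<open>d\<close>.\<close>

lemma generate_divisors:
  assumes n: "n \<ge> 1"
    and u: "u \<in> generate (unit_group n) {ZMod (int n - 1) (int d) | d. d dvd n}"
  shows "\<exists>ds. (\<forall>d\<in>set ds. d dvd n) \<and> u = ZMod (int n - 1) (int (prod_list ds))"
  using u
proof induction
  case one
  then show ?case
    by (intro exI[of _ "[]"]) (simp add: unit_group_def units_of_one ZMod_ring_hom)
next
  case (incl h)
  then obtain d where "d dvd n" "h = ZMod (int n - 1) (int d)" by blast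
  then show ?case by (intro exI[of _ "[d]"]) simp
next
  case (inv h)
  then obtain d where d: "d dvd n" "h = ZMod (int n - 1) (int d)" by blast
  interpret cring "ZFact (int n - 1)" by (rule cring_ZFact)
  interpret U: group "unit_group n" unfolding unit_group_def by (rule units_group)
  obtain e where e: "n = d * e" using d by blast
  have "[int d * int e = 1] (mod (int n - 1))"
    unfolding e by (simp add: cong_iff_dvd_diff)
  then have de: "[int e * int d = 1] (mod (int n - 1))" "[int d * int e = 1] (mod (int n - 1))"
    by (simp_all add: mult.commute)
  have "inv\<^bsub>unit_group n\<^esub> h = ZMod (int n - 1) (int e)"
    using ZMod_unit[OF de(1)] ZMod_unit[OF de(2)] ZMod_mult_eq_one[OF de(1)] d(2)
    by (intro U.inv_equality) (simp_all add: unit_group_def units_of_def)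
  then show ?case using e by (intro exI[of _ "[e]"]) simp
next
  case (eng h1 h2)
  then obtain ds es where "\<forall>d\<in>set ds. d dvd n" "h1 = ZMod (int n - 1) (int (prod_list ds))"
    "\<forall>d\<in>set es. d dvd n" "h2 = ZMod (int n - 1) (int (prod_list es))" by blast
  then show ?case
    by (intro exI[of _ "ds @ es"]) (auto simp: unit_group_def units_of_mult ZMod_ring_hom(3))
qed

theorem theorem1p10:
  fixes n :: nat
  assumes "n \<ge> 2"
    and "generate (unit_group n) {ZMod (int n - 1) (int d) | d. d dvd n} = carrier (unit_group n)"
  shows "reduced_signature n ` carrier (O_group n) = carrier (unit_group n)"
proof (intro equalityI subsetI)
  fix u assume "u \<in> reduced_signature n ` carrier (O_group n)"
  then obtain r h where "r \<ge> 1" "h \<in> B n r" "u = reduced_signature n (Core n r h)"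
    by (auto simp: O_group_def)
  then show "u \<in> carrier (unit_group n)"
    using reduced_signature_in_units assms(1) by (simp add: unit_group_def units_of_carrier)
next
  fix u assume "u \<in> carrier (unit_group n)"
  then obtain ds where ds: "\<forall>d\<in>set ds. d dvd n" "u = ZMod (int n - 1) (int (prod_list ds))"
    using generate_divisors[of n u] assms by auto
  then obtain h where h: "h \<in> B n (n - 1)" "u = reduced_signature n (Core n (n - 1) h)"
    using reduced_signature_attains_product[OF assms(1) ds(1)] by auto
  have "Core n (n - 1) h \<in> carrier (O_group n)"
    using h(1) assms(1) by (auto simp: O_group_def)
  then show "u \<in> reduced_signature n ` carrier (O_group n)" using h(2) by blast
qed

end
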